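(* Let $G$ be a compact Hausdorff group and $X$ a complete operator space. Let $1\leq p<\infty$ and let $\nu\in M_{ac}(G,X)$ be a semivariation translation and inversion invariant vector measure with $\nu(G)\neq0$. If $f\in L^p(\nu)$ and $g\in L^q_w(\nu)$ with $1\leq q\leq p'$, then $f*_\nu g\in\mathcal{B}(X',L^r_w(\nu))$ with $\|f*_\nu g\|_{\mathcal{B}(X',L^r_w(\nu))}\leq\|f\|_{\nu,p}\|g\|_{\nu,q}$, where $\frac1p+\frac1q=1+\frac1r$. In particular, if $g\in L^q(\nu)$, then $f*_\nu g\in\mathcal{B}(X',L^r(\nu))$.
   Context: $m_G$ is normalized Haar measure; $p'$ is the conjugate exponent of $p$; $X'$ is the dual of $X$ with closed unit ball $B_{X'}$. $M_{ac}(G,X)$: $\sigma$-additive $X$-valued vector measures $\nu$ on the Borel sets of $G$ with $\lim_{m_G(A)\to0}\nu(A)=0$. $\langle\nu,x'\rangle(A)=\langle\nu(A),x'\rangle$, with total variation $|\langle\nu,x'\rangle|$, and $d\langle\nu,x'\rangle=h_{x'}\,dm_G$ with $h_{x'}\in L^1(G)$. $L^1_w(\nu)$: functions $f:G\to\mathbb{C}$ with $f\in L^1(|\langle\nu,x'\rangle|)$ for all $x'\in X'$, norm $\|f\|_\nu=\sup_{x'\in B_{X'}}\int_G|f|\,d|\langle\nu,x'\rangle|$. $L^1(\nu)$: those $f\in L_w^1(\nu)$ such that for each Borel $A$ there is a unique $\int_Af\,d\nu\in X$ with $\langle\int_Af\,d\nu,x'\rangle=\int_Af\,d\langle\nu,x'\rangle$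 for all $x'$. For $1\le p<\infty$, $f\in L^p(\nu)$ (resp. $L^p_w(\nu)$) iff $|f|^p\in L^1(\nu)$ (resp. $L^1_w(\nu)$), with norm $\|f\|_{\nu,p}=\||f|^p\|_\nu^{1/p}$. $L^\infty(\nu)=L^\infty_w(\nu)$: $\nu$-a.e. bounded functions with the $\nu$-essential supremum norm. For a homeomorphism $h:G\to G$, $\nu_h(A)=\nu(h(A))$; for a simple function $\phi$, $\nu_\phi(A)=\int_A\phi\,d\nu$. For a vector measure $\mu$, $\|\mu\|=\sup_{x'\in B_{X'}}|\langle\mu,x'\rangle|(G)$. $\nu$ is semivariation $h$-invariant if $\|(\nu_h)_\phi\|=\|\nu_\phi\|$ for all complex simple functions $\phi$ on $G$. Translation (resp. inversion) invariance means this for $h=\tau_t$, $\tau_t(s)=st$, for all $t\in G$ (resp. $h(t)=t^{-1}$). The convolution is $f*_\nu g(x')=f*(gh_{x'})$ for $x'\in X'$, where $gh_{x'}\in L^1(G)$ and $f*k(t)=\int_Gf(ts^{-1})k(s)\,dm_G(s)$. It is well defined for $f\in L^p(\nu)$ because for such $\nu$ one has $L^p(\nu)\subset L^p(G)$. *)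

theory Defs
  imports "HOL-Analysis.Analysis"
begin

section \<open>Complex normed spaces and operator spaces\<close>

class complex_normed_vector = real_normed_vector +
  fixes scaleC :: "complex \<Rightarrow> 'a \<Rightarrow> 'a"  (infixr "*\<^sub>C" 75)
  assumes scaleC_add_right: "c *\<^sub>C (x + y) = c *\<^sub>C x + c *\<^sub>C y"
    and scaleC_add_left: "(c + d) *\<^sub>C x = c *\<^sub>C x + d *\<^sub>C x"
    and scaleC_scaleC: "c *\<^sub>C (d *\<^sub>C x) = (c * d) *\<^sub>C x"
    and scaleC_of_real: "complex_of_real r *\<^sub>C x = r *\<^sub>R x"
    and norm_scaleC: "norm (c *\<^sub>C x) = cmod c * norm x"

text \<open>
  A scalar or vector matrix is a function of two indices counted from 0; only the entries with
  indices below the stated dimensions are relevant. The next constant is the norm of an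
  \<open>n \<times> m\<close> matrix as an operator between the Hilbert spaces of dimensions \<open>m\<close> and \<open>n\<close>.
\<close>

definition cmat_norm :: "nat \<Rightarrow> nat \<Rightarrow> (nat \<Rightarrow> nat \<Rightarrow> complex) \<Rightarrow> real" where
  "cmat_norm n m \<alpha> =
     Sup {L2_set (\<lambda>i. cmod (\<Sum>j<m. \<alpha> i j * \<xi> j)) {..<n} | \<xi>. L2_set (\<lambda>j. cmod (\<xi> j)) {..<m} \<le> 1}"

text \<open>
  Abstract operator spaces: \<open>matnorm n\<close> is the norm of the space of \<open>n \<times> n\<close> matrices over the
  given normed space (so \<open>matnorm 1\<close> is the given norm), subject to Ruan's axioms
  \<open>matnorm_direct_sum\<close> and \<open>matnorm_mult\<close>.
\<close>

class operator_space = complex_normed_vector +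
  fixes matnorm :: "nat \<Rightarrow> (nat \<Rightarrow> nat \<Rightarrow> 'a) \<Rightarrow> real"
  assumes matnorm_cong:
      "n \<ge> 1 \<Longrightarrow> (\<And>i j. i < n \<Longrightarrow> j < n \<Longrightarrow> x i j = y i j) \<Longrightarrow> matnorm n x = matnorm n y"
    and matnorm_eq_0_iff:
      "n \<ge> 1 \<Longrightarrow> matnorm n x = 0 \<longleftrightarrow> (\<forall>i<n. \<forall>j<n. x i j = 0)"
    and matnorm_triangle:
      "n \<ge> 1 \<Longrightarrow> matnorm n (\<lambda>i j. x i j + y i j) \<le> matnorm n x + matnorm n y"
    and matnorm_scaleC:
      "n \<ge> 1 \<Longrightarrow> matnorm n (\<lambda>i j. c *\<^sub>C x i j) = cmod c * matnorm n x"
    and matnorm_1: "matnorm 1 x = norm (x 0 0)"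
    and matnorm_direct_sum:
      "m \<ge> 1 \<Longrightarrow> n \<ge> 1 \<Longrightarrow>
       matnorm (m + n) (\<lambda>i j. if i < m \<and> j < m then x i j
                              else if m \<le> i \<and> m \<le> j then y (i - m) (j - m) else 0)
       = max (matnorm m x) (matnorm n y)"
    and matnorm_mult:
      "m \<ge> 1 \<Longrightarrow> n \<ge> 1 \<Longrightarrow>
       matnorm n (\<lambda>i j. \<Sum>k<m. \<Sum>l<m. (\<alpha> i k * \<beta> l j) *\<^sub>C x k l)
       \<le> cmat_norm n m \<alpha> * matnorm m x * cmat_norm m n \<beta>"

text \<open>The dual consists of complex-linear functionals; its norm is \<^const>\<open>onorm\<close>.\<close>

definition dual_space :: "('x::complex_normed_vector \<Rightarrow> complex) set" where
  "dual_space = {x'. bounded_linear x' \<and> (\<forall>c x. x' (c *\<^sub>C x) = c * x' x)}"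

definition dual_ball :: "('x::complex_normed_vector \<Rightarrow> complex) set" where
  "dual_ball = {x' \<in> dual_space. onorm x' \<le> 1}"


section \<open>Haar measure\<close>

text \<open>
  Groups are written additively, because \<^class>\<open>topological_group_add\<close> is the library's class of
  topological groups. Addition is not assumed commutative: \<open>s + t\<close> is the product \<open>st\<close>,
  \<open>- t\<close> the inverse of \<open>t\<close>, and \<open>t - s\<close> the product of \<open>t\<close> with the inverse of \<open>s\<close>.
\<close>

definition normalized_haar :: "'g::{topological_group_add,t2_space} measure \<Rightarrow> bool" where
  "normalized_haar m \<longleftrightarrow>
     sets m = sets borel \<and> emeasure m UNIV = 1 \<and>
     (\<forall>A\<in>sets borel. emeasure m A = (SUP K\<in>{K. compact K \<and> K \<subseteq> A}. emeasure m K)) \<and>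
     (\<forall>a. \<forall>A\<in>sets borel. emeasure m ((\<lambda>s. a + s) ` A) = emeasure m A)"


section \<open>Complex measures\<close>

text \<open>
  Complex and vector measures are functions on sets of which only the values on Borel sets matter.
\<close>

definition total_variation :: "('g::topological_space set \<Rightarrow> complex) \<Rightarrow> 'g set \<Rightarrow> ennreal" where
  "total_variation \<mu> A =
     (SUP P\<in>{P. finite P \<and> P \<subseteq> sets borel \<and> disjoint P \<and> \<Union>P = A}. \<Sum>E\<in>P. ennreal (cmod (\<mu> E)))"

definition variation_measure :: "('g::topological_space set \<Rightarrow> complex) \<Rightarrow> 'g measure" where
  "variation_measure \<mu> = measure_of UNIV (sets borel) (total_variation \<mu>)"

text \<open>Integration against a complex measure goes through its polar decomposition.\<close>

definition polar_density :: "('g::topological_space set \<Rightarrow> complex) \<Rightarrow> 'g \<Rightarrow> complex" where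
  "polar_density \<mu> = (SOME k. k \<in> borel_measurable borel \<and> (\<forall>t. cmod (k t) = 1) \<and>
     (\<forall>A\<in>sets borel. \<mu> A = (LINT t:A|variation_measure \<mu>. k t)))"

definition complex_integral ::
    "('g::topological_space set \<Rightarrow> complex) \<Rightarrow> 'g set \<Rightarrow> ('g \<Rightarrow> complex) \<Rightarrow> complex" where
  "complex_integral \<mu> A f = (LINT t:A|variation_measure \<mu>. f t * polar_density \<mu> t)"


section \<open>Vector measures\<close>

definition vector_measure :: "('g::topological_space set \<Rightarrow> 'x::real_normed_vector) \<Rightarrow> bool" where
  "vector_measure \<nu> \<longleftrightarrow>
     (\<forall>A::nat \<Rightarrow> 'g set. range A \<subseteq> sets borel \<longrightarrow> disjoint_family A \<longrightarrow>
        (\<lambda>n. \<nu> (A n)) sums \<nu> (\<Union>n. A n))"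

definition M_ac :: "'g::topological_space measure \<Rightarrow> ('g set \<Rightarrow> 'x::real_normed_vector) set" where
  "M_ac m = {\<nu>. vector_measure \<nu> \<and>
     (\<forall>e>0. \<exists>d>0. \<forall>A\<in>sets borel. emeasure m A < ennreal d \<longrightarrow> norm (\<nu> A) < e)}"

definition scalar_measure :: "('g set \<Rightarrow> 'x) \<Rightarrow> ('x \<Rightarrow> complex) \<Rightarrow> 'g set \<Rightarrow> complex" where
  "scalar_measure \<nu> x' A = x' (\<nu> A)"

abbreviation scalar_variation ::
    "('g::topological_space set \<Rightarrow> 'x) \<Rightarrow> ('x \<Rightarrow> complex) \<Rightarrow> 'g measure" where
  "scalar_variation \<nu> x' \<equiv> variation_measure (scalar_measure \<nu> x')"

definition scalar_density ::
    "'g::topological_space measure \<Rightarrow> ('g set \<Rightarrow> 'x) \<Rightarrow> ('x \<Rightarrow> complex) \<Rightarrow> 'g \<Rightarrow> complex" where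
  "scalar_density m \<nu> x' =
     (SOME h. integrable m h \<and> (\<forall>A\<in>sets borel. scalar_measure \<nu> x' A = (LINT t:A|m. h t)))"

definition semivariation ::
    "('g::topological_space set \<Rightarrow> 'x::complex_normed_vector) \<Rightarrow> ennreal" where
  "semivariation \<mu> = (SUP x'\<in>dual_ball. total_variation (scalar_measure \<mu> x') UNIV)"

definition simple_vector_measure ::
    "('g set \<Rightarrow> 'x::complex_normed_vector) \<Rightarrow> ('g \<Rightarrow> complex) \<Rightarrow> 'g set \<Rightarrow> 'x" where
  "simple_vector_measure \<nu> \<phi> A = (\<Sum>y\<in>range \<phi>. y *\<^sub>C \<nu> (A \<inter> \<phi> -` {y}))"

definition semivariation_invariant ::
    "('g::topological_space \<Rightarrow> 'g) \<Rightarrow> ('g set \<Rightarrow> 'x::complex_normed_vector) \<Rightarrow> bool" where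
  "semivariation_invariant h \<nu> \<longleftrightarrow>
     (\<forall>\<phi>. simple_function borel \<phi> \<longrightarrow>
        semivariation (simple_vector_measure (\<lambda>A. \<nu> (h ` A)) \<phi>)
        = semivariation (simple_vector_measure \<nu> \<phi>))"

definition semivariation_translation_invariant ::
    "('g::topological_group_add set \<Rightarrow> 'x::complex_normed_vector) \<Rightarrow> bool" where
  "semivariation_translation_invariant \<nu> \<longleftrightarrow> (\<forall>t. semivariation_invariant (\<lambda>s. s + t) \<nu>)"

definition semivariation_inversion_invariant ::
    "('g::topological_group_add set \<Rightarrow> 'x::complex_normed_vector) \<Rightarrow> bool" where
  "semivariation_inversion_invariant \<nu> \<longleftrightarrow> semivariation_invariant (\<lambda>t. - t) \<nu>"

text \<open>A property holds \<open>\<nu>\<close>-a.e. if it holds off a Borel set on which the semivariation vanishes.\<close>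

definition ae_vec ::
    "('g::topological_space set \<Rightarrow> 'x::complex_normed_vector) \<Rightarrow> ('g \<Rightarrow> bool) \<Rightarrow> bool" where
  "ae_vec \<nu> P \<longleftrightarrow>
     (\<exists>N\<in>sets borel. (\<forall>x'\<in>dual_space. total_variation (scalar_measure \<nu> x') N = 0) \<and> {t. \<not> P t} \<subseteq> N)"


section \<open>Spaces of integrable functions\<close>

text \<open>
  The members of the spaces below are Borel functions, not classes of functions.
  Norms are extended nonnegative reals.
\<close>

definition L1w ::
    "('g::topological_space set \<Rightarrow> 'x::complex_normed_vector) \<Rightarrow> ('g \<Rightarrow> complex) set" where
  "L1w \<nu> = {f. f \<in> borel_measurable borel \<and> (\<forall>x'\<in>dual_space. integrable (scalar_variation \<nu> x') f)}"

definition L1_norm ::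
    "('g::topological_space set \<Rightarrow> 'x::complex_normed_vector) \<Rightarrow> ('g \<Rightarrow> complex) \<Rightarrow> ennreal" where
  "L1_norm \<nu> f = (SUP x'\<in>dual_ball. \<integral>\<^sup>+t. ennreal (cmod (f t)) \<partial>scalar_variation \<nu> x')"

definition L1 ::
    "('g::topological_space set \<Rightarrow> 'x::complex_normed_vector) \<Rightarrow> ('g \<Rightarrow> complex) set" where
  "L1 \<nu> = {f \<in> L1w \<nu>. \<forall>A\<in>sets borel. \<exists>!x. \<forall>x'\<in>dual_space.
     x' x = complex_integral (scalar_measure \<nu> x') A f}"

definition abs_powr :: "('g \<Rightarrow> complex) \<Rightarrow> real \<Rightarrow> 'g \<Rightarrow> complex" where
  "abs_powr f p t = complex_of_real (cmod (f t) powr p)"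

definition ennreal_powr :: "ennreal \<Rightarrow> real \<Rightarrow> ennreal" where
  "ennreal_powr x a = (if x = \<infinity> then \<infinity> else ennreal (enn2real x powr a))"

definition Linf ::
    "('g::topological_space set \<Rightarrow> 'x::complex_normed_vector) \<Rightarrow> ('g \<Rightarrow> complex) set" where
  "Linf \<nu> = {f \<in> borel_measurable borel. \<exists>C. ae_vec \<nu> (\<lambda>t. cmod (f t) \<le> C)}"

definition Lp ::
    "('g::topological_space set \<Rightarrow> 'x::complex_normed_vector) \<Rightarrow> ennreal \<Rightarrow> ('g \<Rightarrow> complex) set" where
  "Lp \<nu> p = (if p = \<infinity> then Linf \<nu>
     else {f \<in> borel_measurable borel. abs_powr f (enn2real p) \<in> L1 \<nu>})"

definition Lpw ::
    "('g::topological_space set \<Rightarrow> 'x::complex_normed_vector) \<Rightarrow> ennreal \<Rightarrow> ('g \<Rightarrow> complex) set" where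
  "Lpw \<nu> p = (if p = \<infinity> then Linf \<nu>
     else {f \<in> borel_measurable borel. abs_powr f (enn2real p) \<in> L1w \<nu>})"

definition Lp_norm ::
    "('g::topological_space set \<Rightarrow> 'x::complex_normed_vector) \<Rightarrow> ennreal \<Rightarrow> ('g \<Rightarrow> complex) \<Rightarrow> ennreal"
  where
  "Lp_norm \<nu> p f = (if p = \<infinity> then Inf {C. ae_vec \<nu> (\<lambda>t. ennreal (cmod (f t)) \<le> C)}
     else ennreal_powr (L1_norm \<nu> (abs_powr f (enn2real p))) (1 / enn2real p))"

definition conj_exponent :: "ennreal \<Rightarrow> ennreal" where
  "conj_exponent p = inverse (1 - inverse p)"


section \<open>Operators on the dual and convolution\<close>

text \<open>
  Bounded complex-linear operators from the dual of \<open>X\<close> into \<open>E\<close>, where \<open>E\<close> is one of the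
  spaces above with exponent \<open>r\<close>. An operator is given by representing functions, hence linear up
  to \<open>\<nu>\<close>-a.e. equality.
\<close>

definition dual_operators ::
    "('g::topological_space set \<Rightarrow> 'x::complex_normed_vector) \<Rightarrow> ennreal \<Rightarrow> ('g \<Rightarrow> complex) set
     \<Rightarrow> (('x \<Rightarrow> complex) \<Rightarrow> 'g \<Rightarrow> complex) set" where
  "dual_operators \<nu> r E = {T.
     (\<forall>x'\<in>dual_space. T x' \<in> E) \<and>
     (\<forall>x'\<in>dual_space. \<forall>y'\<in>dual_space. ae_vec \<nu> (\<lambda>t. T (\<lambda>x. x' x + y' x) t = T x' t + T y' t)) \<and>
     (\<forall>c. \<forall>x'\<in>dual_space. ae_vec \<nu> (\<lambda>t. T (\<lambda>x. c * x' x) t = c * T x' t)) \<and>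
     (\<exists>C\<ge>0. \<forall>x'\<in>dual_space. Lp_norm \<nu> r (T x') \<le> ennreal (C * onorm x'))}"

definition dual_operator_norm ::
    "('g::topological_space set \<Rightarrow> 'x::complex_normed_vector) \<Rightarrow> ennreal
     \<Rightarrow> (('x \<Rightarrow> complex) \<Rightarrow> 'g \<Rightarrow> complex) \<Rightarrow> ennreal" where
  "dual_operator_norm \<nu> r T = (SUP x'\<in>dual_ball. Lp_norm \<nu> r (T x'))"

definition convolution ::
    "'g::topological_group_add measure \<Rightarrow> ('g \<Rightarrow> complex) \<Rightarrow> ('g \<Rightarrow> complex) \<Rightarrow> 'g \<Rightarrow> complex" where
  "convolution m f k t = (LINT s|m. f (t - s) * k s)"

definition vec_convolution ::
    "'g::topological_group_add measure \<Rightarrow> ('g set \<Rightarrow> 'x) \<Rightarrow> ('g \<Rightarrow> complex) \<Rightarrow> ('g \<Rightarrow> complex)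
     \<Rightarrow> ('x \<Rightarrow> complex) \<Rightarrow> 'g \<Rightarrow> complex" where
  "vec_convolution m \<nu> f g x' = convolution m f (\<lambda>s. g s * scalar_density m \<nu> x' s)"

end

theory Submission
  imports Defs "HOL-Probability.Giry_Monad"
begin

text \<open>
  Write \<open>h_x'\<close> for the density of \<open>\<langle>\<nu>, x'\<rangle>\<close> with respect to \<open>m\<close>. The variation of \<open>\<langle>\<nu>, x'\<rangle>\<close> is
  \<open>|h_x'| m\<close>, so the norm of \<open>L\<^sup>1\<^sub>w(\<nu>)\<close> is the supremum of the integrals of \<open>|f| |h_x'|\<close> over the dual
  ball; for nonnegative Borel functions it is called \<open>wnorm\<close> below. Semivariation invariance is a
  statement about \<open>wnorm\<close> of simple functions, and monotone convergence extends it to all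
  nonnegative Borel functions (\<open>wnorm_translate\<close>, \<open>wnorm_reflect\<close>). In particular,
  both \<open>s \<mapsto> f (t - s)\<close> and \<open>t \<mapsto> f (t - s)\<close> have the same \<open>wnorm\<close>
  of the \<open>p\<close>-th power as \<open>f\<close>.

  With this the classical proof of Young's inequality runs with two different weights, \<open>|h_x'|\<close> in
  the inner variable (it comes from the kernel \<open>g h_x'\<close>) and \<open>|h_y'|\<close> in the outer one (it comes
  from the norm of \<open>L\<^sup>r\<^sub>w(\<nu>)\<close>). One splits \<open>|f (t - s)| |g s|\<close> into powers of \<open>|f|\<^sup>p |g|\<^sup>q\<close>, \<open>|f|\<^sup>p\<close> and
  \<open>|g|\<^sup>q\<close> (\<open>hoelder_young\<close>), raises to the power \<open>r\<close> and integrates in \<open>t\<close>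
  (\<open>young_convolution\<close>). The interchange of integrals concerns Borel functions on \<open>G \<times> G\<close>, whose
  Borel sets need not belong to the product \<open>\<sigma>\<close>-algebra; inner regularity of \<open>m\<close> makes up for
  that (\<open>borel_fubini\<close>).

  For the last claim the convolution \<open>F = f * (g h_x')\<close> has to be approximated by bounded functions
  in \<open>L\<^sup>r\<^sub>w(\<nu>)\<close>. The kernel \<open>g h_x'\<close> is cut off at height \<open>n\<close>. The bounded part gives a bounded
  function, because \<open>L\<^sup>p\<^sub>w(\<nu>)\<close> embeds into \<open>L\<^sup>1(G)\<close> (\<open>wnorm_dominates_integral\<close>); the remainder
  is small by Young's inequality, because its \<open>L\<^sup>q\<close> norm with respect to the single measure
  \<open>|h_x'| m\<close> tends to \<open>0\<close> (\<open>truncated_vec_convolution_small\<close>). A function approximated in this way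
  is \<open>\<nu>\<close>-integrable: its integrals are limits in \<open>X\<close> of integrals of simple functions
  (\<open>L1_if_truncations_converge\<close>).

  The underlying functional analysis is built first: norming functionals (Hahn-Banach), which turn
  \<open>wnorm\<close> estimates into norm estimates in \<open>X\<close>; uniform boundedness, which makes \<open>wnorm\<close> finite on
  \<open>L\<^sup>1\<^sub>w(\<nu>)\<close>; and the Radon-Nikodym theorem for signed set functions, which provides \<open>h_x'\<close>.
\<close>

section \<open>Norming functionals and uniform boundedness\<close>

definition sublinear_below_norm :: "('x::real_normed_vector \<Rightarrow> real) \<Rightarrow> bool" where
  "sublinear_below_norm q \<longleftrightarrow> (\<forall>x y. q (x + y) \<le> q x + q y) \<and> (\<forall>c x. 0 \<le> c \<longrightarrow> q (c *\<^sub>R x) = c * q x)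
     \<and> (\<forall>x. q x \<le> norm x)"

lemma sublinear_lower_bound:
  assumes "sublinear_below_norm q" shows "- q y \<le> q (- y)" "- norm x \<le> q x"
proof -
  have 0: "q 0 = 0" using assms unfolding sublinear_below_norm_def by (metis mult_zero_left order_refl scaleR_zero_left)
  show 1: "- q y \<le> q (- y)" for y
  proof -
    have "q (y + - y) \<le> q y + q (- y)" using assms unfolding sublinear_below_norm_def by blast
    then show ?thesis using 0 by simp
  qed
  have "q (-x) \<le> norm x" using assms unfolding sublinear_below_norm_def by (metis norm_minus_cancel)
  then show "- norm x \<le> q x" using 1[of "-x"] by simp
qed

text \<open>
  Allowing \<open>x\<close> to be shifted by multiples of \<open>y\<close> at the price \<open>q y\<close> gives a smaller sublinear
  functional. For a minimal \<open>q\<close> it coincides with \<open>q\<close>, and this forces additivity. Starting from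
  the norm, it produces a functional with value \<open>- norm y\<close> at \<open>- y\<close>.
\<close>

definition sublinear_shift :: "('x::real_normed_vector \<Rightarrow> real) \<Rightarrow> 'x \<Rightarrow> 'x \<Rightarrow> real" where
  "sublinear_shift q y x = (INF t\<in>{0..}. q (x + t *\<^sub>R y) - t * q y)"

lemma sublinear_shift:
  fixes q :: "'x::real_normed_vector \<Rightarrow> real"
  assumes q: "sublinear_below_norm q"
  shows "0 \<le> t \<Longrightarrow> sublinear_shift q y x \<le> q (x + t *\<^sub>R y) - t * q y"
    and "sublinear_shift q y x \<le> q x"
    and "sublinear_below_norm (sublinear_shift q y)"
proof -
  note q' = q[unfolded sublinear_below_norm_def]
  have lower: "- q (- x) \<le> q (x + t *\<^sub>R y) - t * q y" if "0 \<le> t" for t x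
  proof -
    have "q (t *\<^sub>R y) \<le> q (x + t *\<^sub>R y) + q (- x)"
      using q'[THEN conjunct1, rule_format, of "x + t *\<^sub>R y" "- x"] by simp
    then show ?thesis using q' that by simp
  qed
  have bdd: "bdd_below ((\<lambda>t. q (x + t *\<^sub>R y) - t * q y) ` {0..})" for x
    using lower by (intro bdd_belowI2[of _ "- q (- x)"]) auto
  show le: "sublinear_shift q y x \<le> q (x + t *\<^sub>R y) - t * q y" if "0 \<le> t" for t x
    unfolding sublinear_shift_def using that by (intro cINF_lower bdd) auto
  show le0: "sublinear_shift q y x \<le> q x" for x
    using le[of 0 x] by simp
  have ge: "c \<le> sublinear_shift q y x" if "\<And>t. 0 \<le> t \<Longrightarrow> c \<le> q (x + t *\<^sub>R y) - t * q y" for c x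
    unfolding sublinear_shift_def using that by (intro cINF_greatest) auto
  have add: "sublinear_shift q y (u + v) \<le> sublinear_shift q y u + sublinear_shift q y v" for u v
  proof -
    have *: "sublinear_shift q y (u + v) \<le> (q (u + s *\<^sub>R y) - s * q y) + (q (v + t *\<^sub>R y) - t * q y)"
      if "0 \<le> s" "0 \<le> t" for s t
    proof -
      have "q ((u + v) + (s + t) *\<^sub>R y) \<le> q (u + s *\<^sub>R y) + q (v + t *\<^sub>R y)"
        using q'[THEN conjunct1, rule_format, of "u + s *\<^sub>R y" "v + t *\<^sub>R y"] by (simp add: algebra_simps)
      then show ?thesis using le[of "s + t" "u + v"] that by (simp add: algebra_simps)
    qed
    have "sublinear_shift q y (u + v) - (q (u + s *\<^sub>R y) - s * q y) \<le> sublinear_shift q y v" if "0 \<le> s" for s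
      by (rule ge) (use *[OF that] in \<open>simp add: algebra_simps\<close>)
    then have "sublinear_shift q y (u + v) - sublinear_shift q y v \<le> sublinear_shift q y u"
      by (intro ge) (smt (verit))
    then show ?thesis by simp
  qed
  have half: "sublinear_shift q y (c *\<^sub>R x) \<le> c * sublinear_shift q y x" if "0 < c" for c x
  proof -
    have "sublinear_shift q y (c *\<^sub>R x) / c \<le> q (x + t *\<^sub>R y) - t * q y" if "0 \<le> t" for t
    proof -
      have "c *\<^sub>R x + (c * t) *\<^sub>R y = c *\<^sub>R (x + t *\<^sub>R y)" by (simp add: algebra_simps)
      then have "q (c *\<^sub>R x + (c * t) *\<^sub>R y) = c * q (x + t *\<^sub>R y)" using q' \<open>0 < c\<close> by simp
      then show ?thesis using le[of "c * t" "c *\<^sub>R x"] that \<open>0 < c\<close> by (simp add: field_simps)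
    qed
    then have "sublinear_shift q y (c *\<^sub>R x) / c \<le> sublinear_shift q y x" by (rule ge)
    then show ?thesis using that by (simp add: field_simps)
  qed
  have q0: "q 0 = 0" using q' by (metis mult_zero_left order_refl scaleR_zero_left)
  have hom: "sublinear_shift q y (c *\<^sub>R x) = c * sublinear_shift q y x" if "0 \<le> c" for c x
  proof (cases "c = 0")
    case True
    have "0 \<le> sublinear_shift q y 0" by (rule ge) (use q0 q' in auto)
    then show ?thesis using le0[of 0] q0 True by simp
  next
    case False
    then have c: "0 < c" using that by simp
    have "sublinear_shift q y x \<le> inverse c * sublinear_shift q y (c *\<^sub>R x)"
      using half[of "inverse c" "c *\<^sub>R x"] c by simp
    then have "c * sublinear_shift q y x \<le> sublinear_shift q y (c *\<^sub>R x)"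
      using c by (simp add: field_simps)
    then show ?thesis using half[OF c, of x] by simp
  qed
  show "sublinear_below_norm (sublinear_shift q y)"
    unfolding sublinear_below_norm_def using add hom le0 q' by (meson order_trans)
qed

text \<open>
  Pointwise infima of chains are again sublinear, because sublinear functionals below the norm are
  bounded below by minus the norm; so Zorn's lemma applies.
\<close>

lemma minimal_sublinear_exists:
  fixes p :: "'x::real_normed_vector \<Rightarrow> real"
  assumes p: "sublinear_below_norm p"
  obtains q where "sublinear_below_norm q" "\<And>x. q x \<le> p x"
    "\<And>q'. sublinear_below_norm q' \<Longrightarrow> (\<And>x. q' x \<le> q x) \<Longrightarrow> q' = q"
proof -
  define A where "A = {q. sublinear_below_norm q \<and> (\<forall>x. q x \<le> p x)}"
  define P where "P q q' \<longleftrightarrow> (\<forall>x. q' x \<le> q x)" for q q' :: "'x \<Rightarrow> real"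
  have "\<exists>m\<in>A. \<forall>a\<in>A. P m a \<longrightarrow> a = m"
  proof (rule predicate_Zorn)
    show "partial_order_on A (relation_of P A)"
      unfolding partial_order_on_def preorder_on_def refl_on_def trans_def antisym_def relation_of_def P_def
      by (auto intro: order_trans simp: order_antisym fun_eq_iff)
    fix C assume C: "C \<in> Chains (relation_of P A)"
    show "\<exists>u\<in>A. \<forall>a\<in>C. P a u"
    proof (cases "C = {}")
      case True then show ?thesis using p by (auto simp: A_def)
    next
      case False
      have CA: "c \<in> A" if "c \<in> C" for c using C that unfolding Chains_def relation_of_def by auto
      have sub: "sublinear_below_norm c" if "c \<in> C" for c using CA that by (auto simp: A_def)
      have tot: "(\<forall>x. c x \<le> d x) \<or> (\<forall>x. d x \<le> c x)" if "c \<in> C" "d \<in> C" for c d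
        using C that unfolding Chains_def relation_of_def P_def by blast
      define u where "u x = (INF c\<in>C. c x)" for x
      have bdd: "bdd_below ((\<lambda>c. c x) ` C)" for x
        by (intro bdd_belowI2[of _ "- norm x"] sublinear_lower_bound(2) sub)
      have le: "u x \<le> c x" if "c \<in> C" for c x
        unfolding u_def using that by (intro cINF_lower bdd)
      have ge: "e \<le> u x" if "\<And>c. c \<in> C \<Longrightarrow> e \<le> c x" for e x
        unfolding u_def using that False by (intro cINF_greatest)
      have add: "u (x + y) \<le> u x + u y" for x y
      proof -
        have *: "u (x + y) \<le> c x + d y" if "c \<in> C" "d \<in> C" for c d
          using tot[OF that] le[OF that(1), of "x + y"] le[OF that(2), of "x + y"]
            sub[OF that(1)] sub[OF that(2)] unfolding sublinear_below_norm_def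
          by (smt (verit))
        have "u (x + y) - c x \<le> u y" if "c \<in> C" for c
          by (rule ge) (use *[OF that] in \<open>simp add: algebra_simps\<close>)
        then have "u (x + y) - u y \<le> u x"
          by (intro ge) (smt (verit))
        then show ?thesis by simp
      qed
      have hom: "u (c *\<^sub>R x) = c * u x" if "0 \<le> c" for c x
      proof (cases "c = 0")
        case True
        have "b 0 = 0" if "b \<in> C" for b
          using sub[OF that] unfolding sublinear_below_norm_def by (metis mult_zero_left order_refl scaleR_zero_left)
        then have "u 0 = (INF b\<in>C. 0)" unfolding u_def by (intro INF_cong) auto
        then have "u 0 = 0" using False by simp
        then show ?thesis using True by simp
      next
        case nz: False
        then have c: "0 < c" using that by simp
        have b: "b (c *\<^sub>R x) = c * b x" if "b \<in> C" for b
          using sub[OF that] c unfolding sublinear_below_norm_def by simp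
        have "u (c *\<^sub>R x) / c \<le> u x"
          by (rule ge) (use le b c in \<open>fastforce simp: field_simps\<close>)
        moreover have "c * u x \<le> u (c *\<^sub>R x)"
          by (rule ge) (use le c in \<open>simp add: b mult_left_mono\<close>)
        ultimately show ?thesis using c by (simp add: field_simps)
      qed
      obtain c where c: "c \<in> C" using False by auto
      have "u x \<le> norm x" "u x \<le> p x" for x
        using le[OF c, of x] CA[OF c] unfolding A_def sublinear_below_norm_def by (auto intro: order_trans)
      then have "u \<in> A" using add hom unfolding A_def sublinear_below_norm_def by auto
      then show ?thesis using le unfolding P_def by auto
    qed
  qed
  then obtain m where m: "m \<in> A" "\<And>a. a \<in> A \<Longrightarrow> P m a \<Longrightarrow> a = m" by auto
  show thesis
  proof (rule that[of m])
    fix q' assume "sublinear_below_norm q'" "\<And>x. q' x \<le> m x"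
    then show "q' = m" using m(1) by (intro m(2)) (auto simp: A_def P_def intro: order_trans)
  qed (use m(1) in \<open>auto simp: A_def\<close>)
qed

text \<open>
  A minimal sublinear functional \<open>q\<close> is linear: it equals all its shifts, so
  \<open>q x \<le> q (x + y) - q y\<close>. Minimality is taken below the shift of the norm by \<open>x0\<close>, which
  makes \<open>q (- x0) \<le> - norm x0\<close>.
\<close>

lemma real_norming_functional:
  fixes x0 :: "'x::real_normed_vector"
  obtains f where "linear f" "\<And>x. \<bar>f x\<bar> \<le> norm x" "f x0 = norm x0"
proof -
  have N: "sublinear_below_norm (norm :: 'x \<Rightarrow> real)"
    unfolding sublinear_below_norm_def by (auto intro: norm_triangle_ineq)
  obtain q where q: "sublinear_below_norm q" "\<And>x. q x \<le> sublinear_shift norm x0 x"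
    and min: "\<And>q'. sublinear_below_norm q' \<Longrightarrow> (\<And>x. q' x \<le> q x) \<Longrightarrow> q' = q"
    using minimal_sublinear_exists[OF sublinear_shift(3)[OF N, of x0]] by blast
  have shift: "sublinear_shift q y = q" for y
    by (rule min[OF sublinear_shift(3,2)[OF q(1)]])
  have add: "q (x + y) = q x + q y" for x y
    using sublinear_shift(1)[OF q(1), of 1 y x] q(1) unfolding shift sublinear_below_norm_def by (smt (verit) scaleR_one mult_1)
  have neg: "q (- x) = - q x" for x
    using add[of x "-x"] add[of 0 0] by simp
  have sc: "q (c *\<^sub>R x) = c * q x" for c x
  proof (cases "0 \<le> c")
    case True then show ?thesis using q(1) unfolding sublinear_below_norm_def by auto
  next
    case False
    then have "q ((- c) *\<^sub>R x) = (- c) * q x" using q(1) unfolding sublinear_below_norm_def by (smt (verit))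
    then show ?thesis using neg[of "c *\<^sub>R x"] by simp
  qed
  have le: "q x \<le> norm x" for x using q(1) unfolding sublinear_below_norm_def by auto
  have "q (- x0) \<le> - norm x0"
    using q(2)[of "- x0"] sublinear_shift(1)[OF N, of 1 x0 "- x0"] by simp
  then have "q x0 = norm x0" using le[of x0] neg[of x0] by simp
  moreover have "\<bar>q x\<bar> \<le> norm x" for x using le[of x] le[of "-x"] neg[of x] by (simp add: abs_le_iff)
  moreover have "linear q" by (rule linearI) (auto simp: add sc)
  ultimately show thesis using that by blast
qed

lemma dual_space_scaleC: "x' \<in> dual_space \<Longrightarrow> x' (c *\<^sub>C x) = c * x' x"
  by (simp add: dual_space_def)

lemma dual_space_linear: "x' \<in> dual_space \<Longrightarrow> bounded_linear x'"
  by (simp add: dual_space_def)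

lemma dual_ball_le: "x' \<in> dual_ball \<Longrightarrow> cmod (x' x) \<le> norm x"
  unfolding dual_ball_def dual_space_def using onorm[of x' x] mult_right_mono[of "onorm x'" 1 "norm x"]
  by auto

lemma dual_ball_in_dual: "x' \<in> dual_ball \<Longrightarrow> x' \<in> dual_space"
  by (simp add: dual_ball_def)

lemma dual_ballI:
  assumes "\<And>x y. x' (x + y) = x' x + x' y" "\<And>c x. x' (c *\<^sub>C x) = c * x' x" "\<And>x. cmod (x' x) \<le> norm x"
  shows "x' \<in> dual_ball"
proof -
  have "bounded_linear x'"
    using assms by (intro bounded_linear_intro[of _ 1]) (auto simp flip: scaleC_of_real simp: scaleR_conv_of_real)
  then show ?thesis using assms unfolding dual_ball_def dual_space_def by (auto intro!: onorm_bound)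
qed

lemma scaleC_one [simp]: "1 *\<^sub>C x = (x :: 'x::complex_normed_vector)"
  using scaleC_of_real[of 1 x] by simp

text \<open>
  The complex functional with real part \<open>f\<close> is \<open>f y - \<i> f (\<i> y)\<close>; rotating \<open>y\<close> by a unimodular
  scalar shows that it is bounded by the norm.
\<close>

lemma norming_functional:
  fixes x :: "'x::complex_normed_vector"
  obtains x' where "x' \<in> dual_ball" "norm x \<le> cmod (x' x)"
proof -
  obtain f where f: "linear f" "\<And>y. \<bar>f y\<bar> \<le> norm y" "f x = norm x" using real_norming_functional[of x] by blast
  note [simp] = linear_add[OF f(1)] linear_cmul[OF f(1)]
  define x' where "x' y = Complex (f y) (- f (\<i> *\<^sub>C y))" for y
  have add: "x' (y + z) = x' y + x' z" for y z by (simp add: x'_def scaleC_add_right complex_eq_iff)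
  have re: "x' (r *\<^sub>R y) = r * x' y" for r y
  proof -
    have "\<i> *\<^sub>C (r *\<^sub>R y) = r *\<^sub>R (\<i> *\<^sub>C y)"
      unfolding scaleC_of_real[symmetric] scaleC_scaleC by (simp add: mult.commute)
    then show ?thesis by (simp add: x'_def complex_eq_iff)
  qed
  have im: "x' (\<i> *\<^sub>C y) = \<i> * x' y" for y
  proof -
    have "\<i> *\<^sub>C \<i> *\<^sub>C y = (-1) *\<^sub>R y" unfolding scaleC_scaleC using scaleC_of_real[of "-1" y] by simp
    then have "f (\<i> *\<^sub>C \<i> *\<^sub>C y) = - f y" by (simp add: linear_neg[OF f(1)])
    then show ?thesis by (simp add: x'_def complex_eq_iff)
  qed
  have sc: "x' (c *\<^sub>C y) = c * x' y" for c y
  proof -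
    have "c *\<^sub>C y = Re c *\<^sub>R y + Im c *\<^sub>R (\<i> *\<^sub>C y)"
      unfolding scaleC_of_real[symmetric] scaleC_scaleC scaleC_add_left[symmetric]
      by (metis complex_eq mult.commute)
    then have "x' (c *\<^sub>C y) = Re c * x' y + Im c * (\<i> * x' y)" by (simp only: add re im)
    also have "\<dots> = c * x' y" by (subst (3) complex_eq) (simp add: algebra_simps)
    finally show ?thesis .
  qed
  have Re: "Re (x' y) \<le> norm y" for y using f(2)[of y] by (simp add: x'_def)
  have le: "cmod (x' y) \<le> norm y" for y
  proof (cases "x' y = 0")
    case False
    define u where "u = cnj (sgn (x' y))"
    have "cnj (sgn z) * z = cmod z" if "z \<noteq> 0" for z
      using that complex_norm_square[of z] by (simp add: sgn_eq field_simps power2_eq_square)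
    then have u: "cmod u = 1" "u * x' y = cmod (x' y)"
      using False by (auto simp: u_def norm_sgn)
    have "cmod (x' y) = Re (x' (u *\<^sub>C y))" by (simp add: sc u)
    also have "\<dots> \<le> norm (u *\<^sub>C y)" by (rule Re)
    finally show ?thesis by (simp add: norm_scaleC u)
  qed simp
  have "norm x \<le> cmod (x' x)" using abs_Re_le_cmod[of "x' x"] f(3) by (simp add: x'_def)
  then show thesis using that dual_ballI[OF add sc le] by blast
qed

lemma norm_le_if_dual_ball_le:
  fixes x :: "'x::complex_normed_vector"
  assumes "\<And>x'. x' \<in> dual_ball \<Longrightarrow> cmod (x' x) \<le> c"
  shows "norm x \<le> c"
proof -
  obtain x' where "x' \<in> dual_ball" "norm x \<le> cmod (x' x)" by (rule norming_functional)
  then show ?thesis using assms[of x'] by simp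
qed

text \<open>
  Uniform boundedness by a gliding hump. If \<open>norm (x n) > 4 ^ n\<close>, one builds a functional as a
  series \<open>\<Sum>n. e n * u n / 3 ^ n\<close> where \<open>u n\<close> norms \<open>x n\<close> and the sign \<open>e n\<close> is chosen such that
  the partial sum through \<open>n\<close> has modulus at least \<open>norm (x n) / 3 ^ n\<close> at \<open>x n\<close>. The tail of
  the series can cancel at most half of this, so the values at \<open>x n\<close> grow at least like \<open>(4/3) ^ n\<close>.
\<close>

lemma weakly_bounded_imp_bounded:
  fixes S :: "'x::complex_normed_vector set"
  assumes S: "\<And>x'. x' \<in> dual_ball \<Longrightarrow> \<exists>C. \<forall>x\<in>S. cmod (x' x) \<le> C"
  obtains C where "\<And>x. x \<in> S \<Longrightarrow> norm x \<le> C"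
proof (rule ccontr)
  assume "\<not> thesis"
  then have "\<exists>x\<in>S. norm x > C" for C using that by (meson not_le_imp_less)
  then have "\<exists>x. x \<in> S \<and> norm x > 4 ^ n" for n :: nat by blast
  then obtain x where x: "\<And>n::nat. x n \<in> S" "\<And>n. norm (x n) > 4 ^ n" by metis
  have "\<forall>n. \<exists>u. u \<in> dual_ball \<and> norm (x n) \<le> cmod (u (x n))"
    using norming_functional by metis
  then obtain u where u: "\<And>n. u n \<in> dual_ball" "\<And>n. norm (x n) \<le> cmod (u n (x n))" by metis
  define sg where "sg z w = (if cmod w \<le> cmod (z + w) then 1 else - 1 :: complex)" for z w
  have sg: "cmod w \<le> cmod (z + sg z w * w)" "cmod (sg z w) = 1" for z w
  proof -
    have "2 * cmod w \<le> cmod (z + w) + cmod (z - w)"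
      using norm_triangle_ineq4[of "z + w" "z - w"] by (simp add: norm_mult[symmetric])
    then show "cmod w \<le> cmod (z + sg z w * w)" by (auto simp: sg_def)
  qed (auto simp: sg_def)
  define v where "v = rec_nat (\<lambda>_. 0::complex) (\<lambda>n w y. w y + sg (w (x n)) (u n (x n) / 3 ^ n) * u n y / 3 ^ n)"
  define e where "e n = sg (v n (x n)) (u n (x n) / 3 ^ n)" for n
  have v_Suc: "v (Suc n) y = v n y + e n * u n y / 3 ^ n" for n y by (simp add: v_def e_def)
  have e: "cmod (e n) = 1" for n by (simp add: e_def sg)
  define a where "a y n = e n * u n y / 3 ^ n" for y n
  have v: "v n y = sum (a y) {..<n}" for n y
    by (induction n) (auto simp: v_Suc a_def, simp add: v_def)
  have a_le: "cmod (a y n) \<le> norm y * (1/3) ^ n" for y n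
    using dual_ball_le[OF u(1), of n y] by (simp add: a_def norm_mult norm_divide norm_power e field_simps)
  have geo: "summable (\<lambda>n. norm y * (1/3::real) ^ n)" for y :: 'x
    by (intro summable_mult summable_geometric) simp
  have summ: "summable (a y)" for y
    by (rule summable_comparison_test'[OF geo a_le])
  have a_add: "a (y + z) n = a y n + a z n" for y z n
    using bounded_linear.linear[OF dual_space_linear[OF dual_ball_in_dual[OF u(1)[of n]]]]
    by (simp add: a_def linear_add algebra_simps add_divide_distrib)
  have a_sc: "a (c *\<^sub>C y) n = c * a y n" for c y n
    using dual_space_scaleC[OF dual_ball_in_dual[OF u(1)[of n]]] by (simp add: a_def)
  \<comment> \<open>The full sum has norm at most \<open>3/2\<close>; halving it puts it into the dual ball.\<close>
  define y' where "y' y = (\<Sum>n. a y n) / 2" for y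
  have suma: "cmod (\<Sum>n. a y (n + N)) \<le> norm y * (1/3) ^ N * (3/2)" for y N
  proof -
    have "cmod (\<Sum>n. a y (n + N)) \<le> (\<Sum>n. norm y * (1/3) ^ (n + N))"
      by (intro order_trans[OF summable_norm] suminf_le a_le)
         (auto intro!: summable_comparison_test'[OF summable_ignore_initial_segment[OF geo, of y]] a_le
            simp: summable_iff_shift[of "\<lambda>n. norm y * (1/3::real)^n"] geo)
    also have "\<dots> = norm y * (1/3) ^ N * (\<Sum>n. (1/3) ^ n)"
      by (subst suminf_mult[symmetric]) (auto simp: power_add mult_ac)
    finally show ?thesis by (simp add: suminf_geometric)
  qed
  have "y' \<in> dual_ball"
  proof (rule dual_ballI)
    show "y' (y + z) = y' y + y' z" for y z
      by (simp add: y'_def a_add suminf_add[symmetric] summ add_divide_distrib)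
    show "y' (c *\<^sub>C y) = c * y' y" for c y by (simp add: y'_def a_sc suminf_mult summ)
    show "cmod (y' y) \<le> norm y" for y
    proof -
      have "cmod (suminf (a y)) * 2 \<le> norm y * 3" using suma[of y 0] by simp
      then have "cmod (suminf (a y)) \<le> norm y * 2" using norm_ge_zero[of y] by linarith
      then show ?thesis by (simp add: y'_def norm_divide)
    qed
  qed
  then obtain C where C: "\<And>z. z \<in> S \<Longrightarrow> cmod (y' z) \<le> C" using S by blast
  have big: "(4/3) ^ n / 4 \<le> C" for n
  proof -
    have "(\<Sum>k. a (x n) k) = (\<Sum>k. a (x n) (k + Suc n)) + v (Suc n) (x n)"
      unfolding v by (rule suminf_split_initial_segment[OF summ])
    then have "cmod (v (Suc n) (x n)) \<le> cmod (\<Sum>k. a (x n) k) + cmod (\<Sum>k. a (x n) (k + Suc n))"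
      by (metis norm_triangle_ineq4 add_diff_cancel_left')
    moreover have "norm (x n) / 3 ^ n \<le> cmod (v (Suc n) (x n))"
    proof -
      have "norm (x n) / 3 ^ n \<le> cmod (u n (x n) / 3 ^ n)"
        using u(2)[of n] by (simp add: norm_divide norm_power divide_right_mono)
      also have "\<dots> \<le> cmod (v (Suc n) (x n))"
        using sg(1)[of "u n (x n) / 3 ^ n" "v n (x n)"] by (simp add: v_Suc e_def)
      finally show ?thesis .
    qed
    moreover have "cmod (\<Sum>k. a (x n) (k + Suc n)) \<le> norm (x n) / 3 ^ n / 2"
      using suma[of "x n" "Suc n"] by (simp add: power_divide)
    ultimately have "norm (x n) / 3 ^ n / 2 \<le> cmod (\<Sum>k. a (x n) k)" by simp
    also have "\<dots> = 2 * cmod (y' (x n))" by (simp add: y'_def norm_divide)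
    also have "\<dots> \<le> 2 * C" using C[OF x(1)[of n]] by simp
    finally have "norm (x n) / 3 ^ n / 2 \<le> 2 * C" .
    moreover have "4 ^ n / 3 ^ n \<le> norm (x n) / 3 ^ n"
      using x(2)[of n] by (intro divide_right_mono) auto
    ultimately show ?thesis by (simp add: power_divide)
  qed
  have "\<exists>n. 4 * C < (4/3) ^ n" by (rule real_arch_pow) simp
  then show False using big by (metis divide_le_eq_numeral1(1) linorder_not_le mult.commute)
qed

section \<open>Densities of signed and complex measures\<close>

locale signed_set_function =
  fixes M :: "'a measure" and \<mu> :: "'a set \<Rightarrow> real"
  assumes additive: "\<And>A :: nat \<Rightarrow> 'a set. range A \<subseteq> sets M \<Longrightarrow> disjoint_family A \<Longrightarrow> (\<lambda>n. \<mu> (A n)) sums \<mu> (\<Union>n. A n)"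
begin

lemma empty [simp]: "\<mu> {} = 0"
proof -
  have "(\<lambda>n::nat. \<mu> {}) sums \<mu> (\<Union>n::nat. {})" by (rule additive) (auto simp: disjoint_family_on_def)
  then show ?thesis by (auto dest!: sums_summable simp: summable_const_iff)
qed

lemma union:
  assumes "A \<in> sets M" "B \<in> sets M" "A \<inter> B = {}"
  shows "\<mu> (A \<union> B) = \<mu> A + \<mu> B"
proof -
  have "range (binaryset A B) \<subseteq> sets M" using assms by (auto simp: range_binaryset_eq)
  moreover have "disjoint_family (binaryset A B)"
    using assms(3) by (auto simp: disjoint_family_on_def binaryset_def)
  ultimately have "(\<lambda>n. \<mu> (binaryset A B n)) sums \<mu> (A \<union> B)"
    using additive[of "binaryset A B"] by (simp add: UN_binaryset_eq)
  then show ?thesis using binaryset_sums[of \<mu> A B] by (auto dest: sums_unique2)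
qed

text \<open>
  If a set \<open>E\<close> contains sets of arbitrarily large measure, then it splits into two parts such that
  one of them has the same property and the other has measure at least \<open>1\<close> in modulus. Iterating
  gives infinitely many disjoint sets of measure at least \<open>1\<close>, against countable additivity.
\<close>

lemma bounded: "\<exists>C. \<forall>A\<in>sets M. \<bar>\<mu> A\<bar> \<le> C"
proof (rule ccontr)
  assume neg: "\<not> ?thesis"
  have nb: "\<exists>A\<in>sets M. C < \<bar>\<mu> A\<bar>" for C using neg not_le by blast
  define unb where "unb E \<longleftrightarrow> E \<in> sets M \<and> (\<forall>C. \<exists>A\<in>sets M. A \<subseteq> E \<and> C < \<bar>\<mu> A\<bar>)" for E
  have unb0: "unb (space M)" unfolding unb_def
  proof (intro conjI allI)
    fix C
    obtain A where "A \<in> sets M" "C < \<bar>\<mu> A\<bar>" using nb[of C] by auto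
    then show "\<exists>A\<in>sets M. A \<subseteq> space M \<and> C < \<bar>\<mu> A\<bar>" using sets.sets_into_space by blast
  qed auto
  have step: "\<exists>E'. unb E' \<and> E' \<subseteq> E \<and> 1 \<le> \<bar>\<mu> (E - E')\<bar>" if E_unb: "unb E" for E
  proof -
    have E: "E \<in> sets M" using E_unb by (auto simp: unb_def)
    obtain B where B: "B \<in> sets M" "B \<subseteq> E" "\<bar>\<mu> E\<bar> + 1 < \<bar>\<mu> B\<bar>" using E_unb unfolding unb_def by blast
    have eq: "\<mu> E = \<mu> B + \<mu> (E - B)" using union[of B "E - B"] B(1) E Un_Diff_cancel[of B E] Un_absorb1[OF B(2)] by simp
    have "unb B \<or> unb (E - B)"
    proof (rule ccontr)
      assume "\<not> ?thesis"
      then have "\<not> unb B" "\<not> unb (E - B)" by auto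
      moreover have "E - B \<in> sets M" using B E by auto
      ultimately obtain C D where CD: "\<forall>A\<in>sets M. A \<subseteq> B \<longrightarrow> \<bar>\<mu> A\<bar> \<le> C"
        "\<forall>A\<in>sets M. A \<subseteq> E - B \<longrightarrow> \<bar>\<mu> A\<bar> \<le> D"
        unfolding unb_def using B(1) not_less by metis
      obtain A where A: "A \<in> sets M" "A \<subseteq> E" "C + D < \<bar>\<mu> A\<bar>" using E_unb unfolding unb_def by blast
      have "\<mu> A = \<mu> (A \<inter> B) + \<mu> (A - B)"
      proof -
        have "(A \<inter> B) \<union> (A - B) = A" "(A \<inter> B) \<inter> (A - B) = {}" by blast+
        then show ?thesis using union[of "A \<inter> B" "A - B"] A(1) B(1) by simp
      qed
      moreover have "\<bar>\<mu> (A \<inter> B)\<bar> \<le> C" "\<bar>\<mu> (A - B)\<bar> \<le> D"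
        using CD(1)[rule_format, of "A \<inter> B"] CD(2)[rule_format, of "A - B"] A(1,2) B(1) by blast+
      ultimately show False using A(3) by linarith
    qed
    then show ?thesis
    proof
      assume "unb B" then show ?thesis using B eq by (intro exI[of _ B]) auto
    next
      assume "unb (E - B)"
      moreover have "E - (E - B) = B" using B by auto
      ultimately show ?thesis using B by (intro exI[of _ "E - B"]) auto
    qed
  qed
  obtain E where E: "\<And>n::nat. unb (E n)" "\<And>n. E (Suc n) \<subseteq> E n \<and> 1 \<le> \<bar>\<mu> (E n - E (Suc n))\<bar>"
    using dependent_nat_choice[of "\<lambda>_. unb" "\<lambda>_ E E'. E' \<subseteq> E \<and> 1 \<le> \<bar>\<mu> (E - E')\<bar>"] unb0 step by metis
  have anti: "E n \<subseteq> E k" if "k \<le> n" for k n by (rule lift_Suc_antimono_le[of E]) (use that E(2) in auto)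
  have disj: "(E i - E (Suc i)) \<inter> (E j - E (Suc j)) = {}" if "i < j" for i j
    using anti[of "Suc i" j] that by auto
  have "(\<lambda>n. \<mu> (E n - E (Suc n))) sums \<mu> (\<Union>n. E n - E (Suc n))"
  proof (rule additive)
    show "range (\<lambda>n. E n - E (Suc n)) \<subseteq> sets M" using E(1) unfolding unb_def by auto
    show "disjoint_family (\<lambda>n. E n - E (Suc n))"
      unfolding disjoint_family_on_def using disj by (metis Int_commute linorder_neqE_nat)
  qed
  then have "(\<lambda>n. \<bar>\<mu> (E n - E (Suc n))\<bar>) \<longlonglongrightarrow> 0"
    by (intro tendsto_rabs_zero summable_LIMSEQ_zero sums_summable)
  then have "(1::real) \<le> 0" using E(2) by (intro LIMSEQ_le_const) auto
  then show False by simp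
qed

definition positive_part :: "'a set \<Rightarrow> ennreal" where
  "positive_part A = (SUP B\<in>{B\<in>sets M. B \<subseteq> A}. ennreal (\<mu> B))"

lemma positive_part_upper: "B \<in> sets M \<Longrightarrow> B \<subseteq> A \<Longrightarrow> ennreal (\<mu> B) \<le> positive_part A"
  unfolding positive_part_def by (rule SUP_upper) auto

lemma positive_part_superadditive:
  assumes "A \<in> sets M" "B \<in> sets M" "A \<inter> B = {}"
  shows "positive_part A + positive_part B \<le> positive_part (A \<union> B)"
proof -
  have *: "ennreal (\<mu> C) + ennreal (\<mu> D) \<le> positive_part (A \<union> B)"
    if "C \<in> sets M" "C \<subseteq> A" "D \<in> sets M" "D \<subseteq> B" for C D
  proof -
    have "ennreal (\<mu> C) \<le> positive_part (A \<union> B)" "ennreal (\<mu> D) \<le> positive_part (A \<union> B)"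
      using that by (auto intro!: positive_part_upper)
    moreover have "ennreal (\<mu> C + \<mu> D) \<le> positive_part (A \<union> B)"

    proof -
      have "C \<inter> D = {}" "C \<union> D \<subseteq> A \<union> B" using that assms(3) by blast+
      then show ?thesis using union[of C D] that positive_part_upper[of "C \<union> D" "A \<union> B"] by simp
    qed
    ultimately show ?thesis
      by (cases "0 \<le> \<mu> C"; cases "0 \<le> \<mu> D") (auto simp: ennreal_neg ennreal_plus[symmetric] simp del: ennreal_plus)
  qed
  have ne: "{C \<in> sets M. C \<subseteq> A} \<noteq> {}" "{C \<in> sets M. C \<subseteq> B} \<noteq> {}" by auto
  have "ennreal (\<mu> C) + positive_part B \<le> positive_part (A \<union> B)" if "C \<in> sets M" "C \<subseteq> A" for C
    unfolding positive_part_def[of B] ennreal_SUP_add_right[OF ne(2)]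
    using * that by (intro SUP_least) auto
  then show ?thesis
    unfolding positive_part_def[of A] ennreal_SUP_add_left[OF ne(1), symmetric]
    by (intro SUP_least) auto
qed

lemma positive_part_countably_additive: "countably_additive (sets M) positive_part"
proof (rule countably_additiveI)
  fix A :: "nat \<Rightarrow> 'a set" assume A: "range A \<subseteq> sets M" "disjoint_family A" "(\<Union>n. A n) \<in> sets M"
  show "(\<Sum>i. positive_part (A i)) = positive_part (\<Union>i. A i)"
  proof (rule antisym)
    have fin: "(\<Sum>i<n. positive_part (A i)) \<le> positive_part (\<Union>i<n. A i)" for n
    proof (induction n)
      case 0 show ?case by simp
    next
      case (Suc n)
      have "(\<Sum>i<Suc n. positive_part (A i)) \<le> positive_part (\<Union>i<n. A i) + positive_part (A n)"
        using Suc by (simp add: add_right_mono)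
      also have "\<dots> \<le> positive_part ((\<Union>i<n. A i) \<union> A n)"
      proof (rule positive_part_superadditive)
        have "A i \<inter> A n = {}" if "i < n" for i
          using disjoint_family_onD[OF A(2), of i n] that by simp
        then show "(\<Union>i<n. A i) \<inter> A n = {}" by blast
      qed (use A in auto)
      finally show ?case unfolding lessThan_Suc by (simp only: UN_insert Un_commute)
    qed
    have "(\<Sum>i<n. positive_part (A i)) \<le> positive_part (\<Union>i. A i)" for n
      by (rule order_trans[OF fin]) (auto simp: positive_part_def intro!: SUP_subset_mono)
    then show "(\<Sum>i. positive_part (A i)) \<le> positive_part (\<Union>i. A i)"
      by (intro suminf_le_const) auto
    show "positive_part (\<Union>i. A i) \<le> (\<Sum>i. positive_part (A i))"
      unfolding positive_part_def[of "\<Union>i. A i"]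
    proof (rule SUP_least, clarify)
      fix B assume B: "B \<in> sets M" "B \<subseteq> (\<Union>i. A i)"
      have "(\<lambda>i. \<mu> (B \<inter> A i)) sums \<mu> (\<Union>i. B \<inter> A i)"
        using A B by (intro additive) (auto simp: disjoint_family_on_def)
      moreover have "(\<Union>i. B \<inter> A i) = B" using B by auto
      ultimately have lim: "(\<lambda>n. ennreal (\<Sum>i<n. \<mu> (B \<inter> A i))) \<longlonglongrightarrow> ennreal (\<mu> B)"
        unfolding sums_def by (auto intro: tendsto_ennrealI)
      have le: "ennreal (\<Sum>i<n. \<mu> (B \<inter> A i)) \<le> (\<Sum>i<n. positive_part (A i))" for n
      proof (induction n)
        case (Suc n)
        have sub: "ennreal (x + y) \<le> ennreal x + ennreal y" for x y
          by (cases "0 \<le> x"; cases "0 \<le> y")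
             (auto simp: ennreal_neg ennreal_plus[symmetric] simp del: ennreal_plus intro!: ennreal_leI)
        show ?case
          using A B unfolding sum.lessThan_Suc
          by (intro order_trans[OF sub] add_mono Suc positive_part_upper) auto
      qed simp
      have "ennreal (\<Sum>i<n. \<mu> (B \<inter> A i)) \<le> (\<Sum>i. positive_part (A i))" for n
        by (rule order_trans[OF le]) (auto intro!: sum_le_suminf)
      then show "ennreal (\<mu> B) \<le> (\<Sum>i. positive_part (A i))"
        by (intro LIMSEQ_le_const2[OF lim]) auto
    qed
  qed
qed

end

lemma density_of_nonneg_set_function:
  fixes q :: "'a set \<Rightarrow> real"
  assumes "finite_measure M" "signed_set_function M q" "\<And>A. A \<in> sets M \<Longrightarrow> 0 \<le> q A"
    and ac: "\<And>A. A \<in> sets M \<Longrightarrow> emeasure M A = 0 \<Longrightarrow> q A = 0"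
  obtains h :: "'a \<Rightarrow> real" where "integrable M h" "\<And>A. A \<in> sets M \<Longrightarrow> q A = (LINT t:A|M. h t)"
proof -
  interpret finite_measure M by fact
  interpret q: signed_set_function M q by fact
  define N where "N = measure_of (space M) (sets M) (\<lambda>A. ennreal (q A))"
  have sets: "sets N = sets M" by (simp add: N_def sets.sigma_sets_eq)
  have em: "emeasure N A = ennreal (q A)" if "A \<in> sets M" for A
  proof (rule emeasure_measure_of[OF N_def])
    show "countably_additive (Sigma_Algebra.sets N) (\<lambda>A. ennreal (q A))"
    proof (rule countably_additiveI)
      fix A :: "nat \<Rightarrow> 'a set" assume A: "range A \<subseteq> Sigma_Algebra.sets N" "disjoint_family A"
      show "(\<Sum>i. ennreal (q (A i))) = ennreal (q (\<Union> (range A)))"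
        using q.additive[of A] A assms(3) unfolding sets
        by (intro suminf_ennreal_eq) auto
    qed
  qed (use that sets assms(3) in \<open>auto simp: positive_def sets.space_closed\<close>)
  have "space N = space M" using sets by (rule sets_eq_imp_space_eq)
  then have fin: "finite_measure N" by (intro finite_measureI) (simp add: em)
  have "absolutely_continuous M N"
    unfolding absolutely_continuous_def null_sets_def using em ac sets by auto
  then obtain D where D: "D \<in> borel_measurable M" "AE x in M. RN_deriv M N x = ennreal (D x)" "\<And>x. 0 \<le> D x"
    using real_RN_deriv[OF fin _ sets] by metis
  have dens: "emeasure N A = (\<integral>\<^sup>+x. ennreal (D x) * indicator A x \<partial>M)" if "A \<in> Sigma_Algebra.sets M" for A
  proof -
    have "emeasure N A = emeasure (density M (RN_deriv M N)) A"
      using density_RN_deriv[OF \<open>absolutely_continuous M N\<close> sets] by simp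
    also have "\<dots> = (\<integral>\<^sup>+x. RN_deriv M N x * indicator A x \<partial>M)" using that by (intro emeasure_density) auto
    also have "\<dots> = (\<integral>\<^sup>+x. ennreal (D x) * indicator A x \<partial>M)"
      using D(2) by (intro nn_integral_cong_AE) auto
    finally show ?thesis .
  qed
  have int: "integrable M D"
  proof (rule integrableI_nonneg)
    have "(\<integral>\<^sup>+x. ennreal (D x) \<partial>M) = emeasure N (space M)"
      unfolding dens[OF sets.top] by (intro nn_integral_cong) auto
    then show "(\<integral>\<^sup>+x. ennreal (D x) \<partial>M) < \<infinity>" by (simp add: em)
  qed (use D in auto)
  show thesis
  proof (rule that[OF int])
    fix A assume A: "A \<in> Sigma_Algebra.sets M"
    have "ennreal (LINT t:A|M. D t) = (\<integral>\<^sup>+x. ennreal (indicator A x *\<^sub>R D x) \<partial>M)"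
      unfolding set_lebesgue_integral_def
      using int A D by (intro nn_integral_eq_integral[symmetric] integrable_mult_indicator) auto
    also have "\<dots> = ennreal (q A)"
      unfolding em[OF A, symmetric] dens[OF A] by (intro nn_integral_cong) (auto simp: indicator_def)
    finally have "ennreal (LINT t:A|M. D t) = ennreal (q A)" .
    moreover have "0 \<le> (LINT t:A|M. D t)" unfolding set_lebesgue_integral_def using D(3) by (intro Bochner_Integration.integral_nonneg) auto
    ultimately show "q A = (LINT t:A|M. D t)" using assms(3)[OF A] by simp
  qed
qed

text \<open>
  The positive part \<open>p\<close> and \<open>p - \<mu>\<close> are finite measures that vanish on null sets, and the
  Radon-Nikodym theorem applies to both.
\<close>

lemma density_of_signed_set_function:
  fixes \<mu> :: "'a set \<Rightarrow> real"
  assumes "finite_measure M" "signed_set_function M \<mu>"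
    and ac: "\<And>A. A \<in> sets M \<Longrightarrow> emeasure M A = 0 \<Longrightarrow> \<mu> A = 0"
  obtains h :: "'a \<Rightarrow> real" where "integrable M h" "\<And>A. A \<in> sets M \<Longrightarrow> \<mu> A = (LINT t:A|M. h t)"
proof -
  interpret finite_measure M by fact
  interpret signed_set_function M \<mu> by fact
  obtain C where C: "\<And>A. A \<in> sets M \<Longrightarrow> \<bar>\<mu> A\<bar> \<le> C" using bounded by blast
  have fin: "positive_part A \<noteq> \<infinity>" for A
  proof -
    have "positive_part A \<le> ennreal C"
      unfolding positive_part_def by (intro SUP_least ennreal_leI) (use C in force)
    then show ?thesis by (auto simp: top_unique)
  qed
  define p where "p A = enn2real (positive_part A)" for A
  have p: "positive_part A = ennreal (p A)" for A using fin[of A] by (simp add: p_def less_top)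
  have p0: "0 \<le> p A" for A by (simp add: p_def)
  have pmu: "\<mu> A \<le> p A" if "A \<in> sets M" for A
    using positive_part_upper[OF that order_refl] p0[of A] by (simp add: p ennreal_le_iff)
  have p_sums: "(\<lambda>n. p (A n)) sums p (\<Union>n. A n)" if "range A \<subseteq> sets M" "disjoint_family A" for A :: "nat \<Rightarrow> 'a set"
  proof -
    have "(\<Sum>i. ennreal (p (A i))) = ennreal (p (\<Union>i. A i))"
      using positive_part_countably_additive that unfolding countably_additive_def p by blast
    then have "(\<lambda>i. ennreal (p (A i))) sums ennreal (p (\<Union>i. A i))"
      by (metis summableI summable_sums)
    then show ?thesis using p0 by (simp add: sums_ennreal)
  qed
  have null: "p A = 0" if A: "A \<in> sets M" "emeasure M A = 0" for A
  proof -
    have "\<mu> B = 0" if "B \<in> sets M" "B \<subseteq> A" for B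
      using that A emeasure_mono[of B A M] by (intro ac) auto
    then have "positive_part A = 0" unfolding positive_part_def by (auto simp: bot_ennreal[symmetric] intro!: SUP_eq_const)
    then show ?thesis by (simp add: p_def)
  qed
  have sp: "signed_set_function M p" by unfold_locales (rule p_sums)
  have sq: "signed_set_function M (\<lambda>A. p A - \<mu> A)" by unfold_locales (intro sums_diff p_sums additive)
  obtain f where f: "integrable M f" "\<And>A. A \<in> sets M \<Longrightarrow> p A = (LINT t:A|M. f t)"
    using density_of_nonneg_set_function[OF assms(1) sp] p0 null by metis
  obtain g where g: "integrable M g" "\<And>A. A \<in> sets M \<Longrightarrow> p A - \<mu> A = (LINT t:A|M. g t)"
    using density_of_nonneg_set_function[OF assms(1) sq] pmu null ac by (metis diff_ge_0_iff_ge diff_self)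
  show thesis
  proof (rule that[of "\<lambda>t. f t - g t"])
    fix A assume A: "A \<in> sets M"
    have "set_integrable M A f" "set_integrable M A g"
      unfolding set_integrable_def using f(1) g(1) A by (blast intro: integrable_mult_indicator)+
    then have "(LINT t:A|M. f t - g t) = p A - (p A - \<mu> A)"
      unfolding f(2)[OF A, symmetric] g(2)[OF A] by (simp add: set_integral_diff f(2)[OF A])
    then show "\<mu> A = (LINT t:A|M. f t - g t)" by simp
  qed (use f g in auto)
qed

text \<open>
  For the lower bound, \<open>h\<close> is approximated in \<open>L\<^sup>1\<close> by a simple function \<open>s\<close>. On a level set of \<open>s\<close>
  the modulus of the integral of \<open>s\<close> is the integral of \<open>|s|\<close>, so the partition of \<open>A\<close> into level
  sets witnesses the total variation up to twice the distance of \<open>h\<close> and \<open>s\<close>.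
\<close>

lemma total_variation_density:
  fixes h :: "'g::topological_space \<Rightarrow> complex"
  assumes "sets m = sets borel" "integrable m h"
    and \<mu>: "\<And>A. A \<in> sets borel \<Longrightarrow> \<mu> A = (LINT t:A|m. h t)" and A: "A \<in> sets borel"
  shows "total_variation \<mu> A = emeasure (density m (\<lambda>t. ennreal (cmod (h t)))) A"
proof -
  note [measurable_cong] = assms(1)
  have h [measurable]: "h \<in> borel_measurable m" using assms(2) by auto
  define K where "K f = density m (\<lambda>t. ennreal (cmod (f t)))" for f
  have K: "emeasure (K f) E = (\<integral>\<^sup>+t. ennreal (cmod (f t)) * indicator E t \<partial>m)"
    if "E \<in> sets borel" "f \<in> borel_measurable m" for f E
    unfolding K_def using that assms(1) by (intro emeasure_density) auto
  have setsK: "sets (K f) = sets borel" for f by (simp add: K_def assms(1))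
  have sumK: "(\<Sum>E\<in>P. emeasure (K f) E) = emeasure (K f) A"
    if "finite P" "P \<subseteq> sets borel" "disjoint P" "\<Union>P = A" for P f
    using sum_emeasure[of "\<lambda>E. E" P "K f"] that setsK
    by (auto simp: disjoint_family_on_def disjoint_def)
  have \<mu>K: "ennreal (cmod (\<mu> E)) \<le> emeasure (K h) E" if E: "E \<in> sets borel" for E
  proof -
    have "ennreal (cmod (\<mu> E)) \<le> (\<integral>\<^sup>+t. norm (indicator E t *\<^sub>R h t) \<partial>m)"
      unfolding \<mu>[OF E] set_lebesgue_integral_def
      using assms E by (intro integral_norm_bound_ennreal integrable_mult_indicator) auto
    also have "\<dots> = emeasure (K h) E"
      unfolding K[OF E h] by (intro nn_integral_cong) (auto simp: indicator_def)
    finally show ?thesis .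
  qed
  have "total_variation \<mu> A \<le> emeasure (K h) A"
    unfolding total_variation_def
  proof (intro SUP_least)
    fix P assume P: "P \<in> {P. finite P \<and> P \<subseteq> sets borel \<and> disjoint P \<and> \<Union>P = A}"
    then have "(\<Sum>E\<in>P. ennreal (cmod (\<mu> E))) \<le> (\<Sum>E\<in>P. emeasure (K h) E)"
      by (intro sum_mono \<mu>K) auto
    also have "\<dots> = emeasure (K h) A" using P by (intro sumK) auto
    finally show "(\<Sum>E\<in>P. ennreal (cmod (\<mu> E))) \<le> emeasure (K h) A" .
  qed
  moreover have "emeasure (K h) A \<le> total_variation \<mu> A"
  proof -
    obtain s where s: "\<And>i. Bochner_Integration.simple_bochner_integrable m (s i)" "(\<lambda>i. \<integral>\<^sup>+x. norm (h x - s i x) \<partial>m) \<longlonglongrightarrow> 0"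
    proof -
      obtain x where "has_bochner_integral m h x" using assms(2) by (auto elim: integrable.cases)
      then show thesis by (cases rule: has_bochner_integral.cases) (use that in auto)
    qed
    have "emeasure (K h) A \<le> total_variation \<mu> A + 2 * (\<integral>\<^sup>+x. norm (h x - s i x) \<partial>m)" for i
    proof -
      let ?s = "s i"
      have si: "simple_function m ?s" using s(1)[of i] by (auto elim: Bochner_Integration.simple_bochner_integrable.cases)
      have sm [measurable]: "?s \<in> borel_measurable m" using si by (rule borel_measurable_simple_function)
      have int_s: "integrable m ?s" using s(1)[of i] has_bochner_integral_simple_bochner_integrable integrable.intros by blast
      have sp: "space m = UNIV" using sets_eq_imp_space_eq[OF assms(1)] by simp
      define E where "E y = A \<inter> ?s -` {y}" for y
      have Em: "E y \<in> sets borel" for y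
        using simple_functionD(2)[OF si, of "{y}"] A assms(1) sp by (auto simp: E_def)
      have fin: "finite (?s ` A)" using finite_subset[OF image_mono[OF subset_UNIV] simple_functionD(1)[OF si, unfolded sp]] .
      define P where "P = E ` ?s ` A"
      have inj: "inj_on E (?s ` A)" by (auto simp: inj_on_def E_def)
      have P: "finite P" "P \<subseteq> sets borel" "disjoint P" "\<Union>P = A"
        using fin Em by (auto simp: P_def disjoint_def E_def)
      \<comment> \<open>\<open>h\<close> is replaced by \<open>s\<close> under the integral of the modulus, and \<open>s\<close> by \<open>h\<close> under the modulus of
        the integral; each exchange costs the integral of \<open>|h - s|\<close>.\<close>
      have KE: "emeasure (K h) (E y) \<le> ennreal (cmod (\<mu> (E y))) + 2 * emeasure (K (\<lambda>t. h t - ?s t)) (E y)" for y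
      proof -
        have iE: "integrable m (\<lambda>t. indicator (E y) t *\<^sub>R f t)" if "integrable m f" for f :: "'g \<Rightarrow> complex"
          using Em that assms(1) by (intro integrable_mult_indicator) auto
        have 1: "emeasure (K h) (E y) \<le> emeasure (K ?s) (E y) + emeasure (K (\<lambda>t. h t - ?s t)) (E y)"
        proof -
          have "emeasure (K h) (E y) \<le> (\<integral>\<^sup>+t. ennreal (cmod (?s t)) * indicator (E y) t + ennreal (cmod (h t - ?s t)) * indicator (E y) t \<partial>m)"
            unfolding K[OF Em h]
          proof (intro nn_integral_mono)
            fix t show "ennreal (cmod (h t)) * indicator (E y) t \<le> ennreal (cmod (?s t)) * indicator (E y) t + ennreal (cmod (h t - ?s t)) * indicator (E y) t"
              using norm_triangle_ineq[of "?s t" "h t - ?s t"]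
              by (auto simp: indicator_def ennreal_plus[symmetric] simp del: ennreal_plus)
          qed
          also have "\<dots> = emeasure (K ?s) (E y) + emeasure (K (\<lambda>t. h t - ?s t)) (E y)"
          proof (subst nn_integral_add)
            have Em' [measurable]: "E y \<in> sets m" using Em assms(1) by simp
            show "(\<lambda>t. ennreal (cmod (?s t)) * indicator (E y) t) \<in> borel_measurable m"
              "(\<lambda>t. ennreal (cmod (h t - ?s t)) * indicator (E y) t) \<in> borel_measurable m" by measurable
            have "(\<lambda>t. h t - ?s t) \<in> borel_measurable m" by measurable
            then show "(\<integral>\<^sup>+t. ennreal (cmod (?s t)) * indicator (E y) t \<partial>m) + (\<integral>\<^sup>+t. ennreal (cmod (h t - ?s t)) * indicator (E y) t \<partial>m)
              = emeasure (K ?s) (E y) + emeasure (K (\<lambda>t. h t - ?s t)) (E y)" by (simp add: K Em sm)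
          qed
          finally show ?thesis .
        qed
        have "emeasure (K ?s) (E y) = ennreal (cmod (LINT t:E y|m. ?s t))"
        proof -
          have c: "indicator (E y) t *\<^sub>R ?s t = indicator (E y) t *\<^sub>R y" for t by (auto simp: indicator_def E_def)
          have "ennreal (cmod (LINT t:E y|m. ?s t)) = ennreal (LINT t|m. indicator (E y) t *\<^sub>R cmod y)"
          proof (cases "y = 0")
            case False
            have "integrable m (\<lambda>t. norm (indicator (E y) t *\<^sub>R ?s t))" by (rule integrable_norm[OF iE[OF int_s]])
            then have "integrable m (\<lambda>t. indicator (E y) t * cmod y)" by (simp add: c)
            then have "integrable m (\<lambda>t. indicator (E y) t * cmod y * (1 / cmod y))" by (rule integrable_mult_left)
            moreover have "(\<lambda>t. indicator (E y) t * cmod y * (1 / cmod y)) = (indicator (E y) :: 'g \<Rightarrow> real)" using False by auto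
            ultimately have fi: "integrable m (indicator (E y) :: 'g \<Rightarrow> real)" by metis
            show ?thesis unfolding set_lebesgue_integral_def c using fi by (simp add: norm_mult)
          next
            case True
            show ?thesis unfolding set_lebesgue_integral_def c by (simp add: True)
          qed
          also have "\<dots> = (\<integral>\<^sup>+t. ennreal (indicator (E y) t *\<^sub>R cmod y) \<partial>m)"
          proof (intro nn_integral_eq_integral[symmetric])
            have "integrable m (\<lambda>t. norm (indicator (E y) t *\<^sub>R ?s t))" using iE[OF int_s] by (rule integrable_norm)
            then show "integrable m (\<lambda>t. indicator (E y) t *\<^sub>R cmod y)" by (simp add: c)
          qed auto
          also have "\<dots> = emeasure (K ?s) (E y)"
            unfolding K[OF Em sm] by (intro nn_integral_cong) (auto simp: indicator_def E_def)
          finally show ?thesis by simp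
        qed
        also have "\<dots> \<le> ennreal (cmod (\<mu> (E y))) + ennreal (cmod (LINT t:E y|m. h t - ?s t))"
        proof -
          have "(LINT t:E y|m. ?s t) = \<mu> (E y) - (LINT t:E y|m. h t - ?s t)"
            unfolding \<mu>[OF Em] using iE[OF assms(2)] iE[OF int_s] by (simp add: set_integral_diff set_integrable_def)
          then show ?thesis
            using norm_triangle_ineq4[of "\<mu> (E y)" "LINT t:E y|m. h t - ?s t"]
            by (simp add: ennreal_plus[symmetric] del: ennreal_plus)
        qed
        also have "ennreal (cmod (LINT t:E y|m. h t - ?s t)) \<le> emeasure (K (\<lambda>t. h t - ?s t)) (E y)"
        proof -
          have "ennreal (cmod (LINT t:E y|m. h t - ?s t)) \<le> (\<integral>\<^sup>+t. norm (indicator (E y) t *\<^sub>R (h t - ?s t)) \<partial>m)"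
            unfolding set_lebesgue_integral_def using assms int_s
            by (intro integral_norm_bound_ennreal iE) auto
          also have "\<dots> = emeasure (K (\<lambda>t. h t - ?s t)) (E y)"
            using sm h by (subst K[OF Em]) (auto intro!: nn_integral_cong simp: indicator_def)
          finally show ?thesis .
        qed
        finally show ?thesis using 1 by (simp add: mult_2 add.assoc[symmetric]) (meson add_right_mono order_trans)
      qed
      have "emeasure (K h) A = (\<Sum>y\<in>?s ` A. emeasure (K h) (E y))"
        unfolding sumK[OF P, symmetric] unfolding P_def by (simp add: sum.reindex[OF inj])
      also have "\<dots> \<le> (\<Sum>y\<in>?s ` A. ennreal (cmod (\<mu> (E y))) + 2 * emeasure (K (\<lambda>t. h t - ?s t)) (E y))"
        by (intro sum_mono KE)
      also have "\<dots> = (\<Sum>E\<in>P. ennreal (cmod (\<mu> E))) + 2 * (\<Sum>E\<in>P. emeasure (K (\<lambda>t. h t - ?s t)) E)"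
        unfolding P_def by (simp add: sum.reindex[OF inj] sum.distrib sum_distrib_left)
      also have "\<dots> \<le> total_variation \<mu> A + 2 * (\<integral>\<^sup>+x. norm (h x - ?s x) \<partial>m)"
      proof (intro add_mono mult_left_mono)
        show "(\<Sum>E\<in>P. ennreal (cmod (\<mu> E))) \<le> total_variation \<mu> A"
          unfolding total_variation_def using P by (intro SUP_upper) auto
        show "(\<Sum>E\<in>P. emeasure (K (\<lambda>t. h t - ?s t)) E) \<le> (\<integral>\<^sup>+x. norm (h x - ?s x) \<partial>m)"
          unfolding sumK[OF P] using sm h A
          by (subst K) (auto intro!: nn_integral_mono simp: indicator_def)
      qed auto
      finally show ?thesis .
    qed
    moreover have "(\<lambda>i. total_variation \<mu> A + 2 * (\<integral>\<^sup>+x. norm (h x - s i x) \<partial>m)) \<longlonglongrightarrow> total_variation \<mu> A + 2 * 0"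
      by (intro tendsto_add tendsto_const ennreal_tendsto_cmult s(2)) auto
    ultimately show ?thesis by (intro LIMSEQ_le_const) auto
  qed
  ultimately show ?thesis unfolding K_def by (rule antisym)
qed

lemma variation_measure_density:
  fixes h :: "'g::topological_space \<Rightarrow> complex"
  assumes "sets m = sets borel" "integrable m h"
    and "\<And>A. A \<in> sets borel \<Longrightarrow> \<mu> A = (LINT t:A|m. h t)"
  shows "variation_measure \<mu> = density m (\<lambda>t. ennreal (cmod (h t)))" (is "_ = ?D")
proof -
  have sp: "space ?D = UNIV" using sets_eq_imp_space_eq[OF assms(1)] by simp
  have "variation_measure \<mu> = measure_of UNIV (sets borel) (emeasure ?D)"
    unfolding variation_measure_def
    by (intro measure_of_eq) (use total_variation_density[OF assms] sets.sigma_sets_eq[of borel] in auto)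
  also have "\<dots> = measure_of (space ?D) (sets ?D) (emeasure ?D)" using assms(1) sp by simp
  also have "\<dots> = ?D" by (rule measure_of_of_measure)
  finally show ?thesis .
qed

text \<open>
  The total variation of the zero set function is the integral of the modulus of any density of it.
\<close>

lemma AE_eq_if_set_integrals_eq:
  fixes h k :: "'g::topological_space \<Rightarrow> complex"
  assumes "sets m = sets borel" "integrable m h" "integrable m k"
    and eq: "\<And>A. A \<in> sets borel \<Longrightarrow> (LINT t:A|m. h t) = (LINT t:A|m. k t)"
  shows "AE t in m. h t = k t"
proof -
  have sp: "space m = UNIV" using sets_eq_imp_space_eq[OF assms(1)] by simp
  have "total_variation (\<lambda>A :: 'g set. 0) UNIV = emeasure (density m (\<lambda>t. ennreal (cmod (h t - k t)))) UNIV"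
  proof (rule total_variation_density[OF assms(1)])
    fix A :: "'g set" assume A: "A \<in> sets borel"
    then have "set_integrable m A h" "set_integrable m A k" unfolding set_integrable_def
      using assms by (auto intro!: integrable_mult_indicator)
    then show "0 = (LINT t:A|m. h t - k t)" by (simp add: set_integral_diff eq[OF A])
  qed (use assms in auto)
  moreover have "total_variation (\<lambda>A::'g set. 0) UNIV = 0"
    unfolding total_variation_def by (intro antisym SUP_least) auto
  moreover have "emeasure (density m (\<lambda>t. ennreal (cmod (h t - k t)))) UNIV = (\<integral>\<^sup>+t. ennreal (cmod (h t - k t)) \<partial>m)"
    using assms by (subst emeasure_density) auto
  ultimately have "AE t in m. ennreal (cmod (h t - k t)) = 0"
    using assms by (subst nn_integral_0_iff_AE[symmetric]) auto
  then show ?thesis by eventually_elim (simp add: ennreal_eq_0_iff)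
qed

text \<open>
  The function \<open>h / |h|\<close>, set to \<open>1\<close> where \<open>h\<close> vanishes, qualifies as a polar density, so the
  chosen polar density exists; by uniqueness of densities its product with \<open>|h|\<close> is \<open>h\<close> almost
  everywhere.
\<close>

lemma complex_integral_density:
  fixes h :: "'g::topological_space \<Rightarrow> complex"
  assumes sets: "sets m = sets borel" and h: "integrable m h"
    and \<mu>: "\<And>A. A \<in> sets borel \<Longrightarrow> \<mu> A = (LINT t:A|m. h t)"
    and A: "A \<in> sets borel" and f: "f \<in> borel_measurable borel"
  shows "complex_integral \<mu> A f = (LINT t:A|m. f t * h t)"
proof -
  have var: "variation_measure \<mu> = density m (\<lambda>t. ennreal (cmod (h t)))"
    by (rule variation_measure_density[OF sets h]) (rule \<mu>)
  have hm: "h \<in> borel_measurable borel" using borel_measurable_integrable[OF h] by (simp add: measurable_cong_sets[OF sets refl])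
  have dens: "(LINT t:B|variation_measure \<mu>. k t) = (LINT t:B|m. k t * cmod (h t))"
    if "k \<in> borel_measurable borel" "B \<in> sets borel" for k :: "'g \<Rightarrow> complex" and B
  proof -
    have "(\<lambda>t. indicator B t *\<^sub>R k t) \<in> borel_measurable m"
      using that sets by (subst measurable_cong_sets[OF sets refl]) auto
    moreover have "(\<lambda>t. cmod (h t)) \<in> borel_measurable m" using h by auto
    ultimately show ?thesis unfolding var set_lebesgue_integral_def
      by (subst integral_density) (auto simp: scaleR_conv_of_real mult_ac)
  qed
  define k0 where "k0 t = (if h t = 0 then 1 else sgn (h t))" for t
  have k0: "k0 t * cmod (h t) = h t" for t by (auto simp: k0_def sgn_eq)
  let ?Q = "\<lambda>k. k \<in> borel_measurable borel \<and> (\<forall>t. cmod (k t) = 1) \<and> (\<forall>A\<in>Sigma_Algebra.sets borel. \<mu> A = (LINT t:A|variation_measure \<mu>. k t))"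
  have k0m: "k0 \<in> borel_measurable borel" using hm unfolding k0_def sgn_eq by measurable
  have "?Q k0" using k0m \<mu> by (auto simp: dens k0) (auto simp: k0_def norm_sgn)
  then have "?Q (polar_density \<mu>)" unfolding polar_density_def by (rule someI[of ?Q])
  then have pm: "polar_density \<mu> \<in> borel_measurable borel" and p1: "\<And>t. cmod (polar_density \<mu> t) = 1"
    and p: "\<And>A. A \<in> Sigma_Algebra.sets borel \<Longrightarrow> (LINT t:A|m. h t) = (LINT t:A|m. polar_density \<mu> t * cmod (h t))"
    using \<mu> by (auto simp: dens)
  have pint: "integrable m (\<lambda>t. polar_density \<mu> t * cmod (h t))"
  proof (rule Bochner_Integration.integrable_bound[OF h])
    have "polar_density \<mu> \<in> borel_measurable m" using pm by (simp add: measurable_cong_sets[OF sets refl])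
    then show "(\<lambda>t. polar_density \<mu> t * cmod (h t)) \<in> borel_measurable m" using h by measurable
  qed (simp add: norm_mult p1)
  have ae: "AE t in m. h t = polar_density \<mu> t * cmod (h t)"
    by (rule AE_eq_if_set_integrals_eq[OF sets h pint p])
  have "complex_integral \<mu> A f = (LINT t:A|m. f t * (polar_density \<mu> t * cmod (h t)))"
    unfolding complex_integral_def using f pm A by (subst dens) (auto simp: mult_ac)
  also have "\<dots> = (LINT t:A|m. f t * h t)"
    unfolding set_lebesgue_integral_def
  proof (rule integral_cong_AE)
    show "(\<lambda>t. indicator A t *\<^sub>R (f t * (polar_density \<mu> t * cmod (h t)))) \<in> borel_measurable m"
      "(\<lambda>t. indicator A t *\<^sub>R (f t * h t)) \<in> borel_measurable m"
      unfolding measurable_cong_sets[OF sets refl] using A f hm pm by measurable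
    show "AE t in m. indicator A t *\<^sub>R (f t * (polar_density \<mu> t * cmod (h t))) = indicator A t *\<^sub>R (f t * h t)"
      using ae by eventually_elim simp
  qed
  finally show ?thesis .
qed

section \<open>The weak L1 norm of a vector measure\<close>

lemma dual_space_add: "x' \<in> dual_space \<Longrightarrow> y' \<in> dual_space \<Longrightarrow> (\<lambda>x. x' x + y' x) \<in> dual_space"
  unfolding dual_space_def by (auto intro: bounded_linear_add simp: algebra_simps)

lemma dual_space_mult: "x' \<in> dual_space \<Longrightarrow> (\<lambda>x. c * x' x) \<in> dual_space"
  unfolding dual_space_def
  by (auto intro!: bounded_linear_compose[OF bounded_linear_mult_right] simp: mult_ac)

lemma dual_space_normalize:
  fixes x' :: "'x::complex_normed_vector \<Rightarrow> complex"
  assumes "x' \<in> dual_space"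
  obtains u where "u \<in> dual_ball" "x' = (\<lambda>x. complex_of_real (onorm x') * u x)"
proof -
  have bl: "bounded_linear x'" using assms by (rule dual_space_linear)
  define u where "u x = complex_of_real (inverse (onorm x')) * x' x" for x
  have "x' x = complex_of_real (onorm x') * u x" for x
    using onorm_eq_0[OF bl] by (cases "onorm x' = 0") (auto simp: u_def)
  moreover have "u \<in> dual_ball"
  proof (rule dual_ballI)
    show "u (x + y) = u x + u y" for x y
      using bl by (simp add: u_def linear_simps algebra_simps)
    show "u (c *\<^sub>C x) = c * u x" for c x using dual_space_scaleC[OF assms] by (simp add: u_def)
    show "cmod (u x) \<le> norm x" for x
      using onorm[OF bl, of x] onorm_pos_le[OF bl]
      by (cases "onorm x' = 0") (auto simp: u_def norm_mult norm_inverse norm_divide field_simps)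
  qed
  ultimately show thesis using that[of u] by auto
qed

locale ac_vector_measure =
  fixes m :: "'g::topological_space measure" and \<nu> :: "'g set \<Rightarrow> 'x::complex_normed_vector"
  assumes sets_m: "sets m = sets borel" and prob_m: "emeasure m UNIV = 1" and ac: "\<nu> \<in> M_ac m"
begin

lemma space_m [simp]: "space m = UNIV"
  using sets_eq_imp_space_eq[OF sets_m] by simp

lemma measurable_m [simp]: "measurable m N = measurable borel N"
  by (rule measurable_cong_sets[OF sets_m refl])

lemma prob_space_m: "prob_space m"
  by (intro prob_spaceI) (simp add: prob_m)

lemma finite_m: "finite_measure m"
  using prob_space_m by (simp add: prob_space.finite_measure)

abbreviation dens :: "('x \<Rightarrow> complex) \<Rightarrow> 'g \<Rightarrow> complex" where
  "dens \<equiv> scalar_density m \<nu>"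

abbreviation adens :: "('x \<Rightarrow> complex) \<Rightarrow> 'g \<Rightarrow> ennreal" where
  "adens x' t \<equiv> ennreal (cmod (dens x' t))"

lemma sums_measure:
  "range A \<subseteq> sets borel \<Longrightarrow> disjoint_family A \<Longrightarrow> (\<lambda>n::nat. \<nu> (A n)) sums \<nu> (\<Union>n. A n)"
  using ac by (simp add: M_ac_def vector_measure_def)

lemma null_measure:
  assumes "A \<in> sets borel" "emeasure m A = 0" shows "\<nu> A = 0"
proof -
  have "norm (\<nu> A) < e" if "0 < e" for e
    using ac that assms by (force simp: M_ac_def)
  then show ?thesis by (metis less_irrefl zero_less_norm_iff)
qed

lemma dens_exists:
  assumes "x' \<in> dual_space"
  shows "\<exists>h. integrable m h \<and> (\<forall>A\<in>sets borel. scalar_measure \<nu> x' A = (LINT t:A|m. h t))"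
proof -
  have bl: "bounded_linear x'" using assms by (rule dual_space_linear)
  have sums: "(\<lambda>n::nat. x' (\<nu> (A n))) sums x' (\<nu> (\<Union>n. A n))"
    if "range A \<subseteq> sets m" "disjoint_family A" for A
    using that sets_m by (intro bounded_linear.sums[OF bl] sums_measure) auto
  have "signed_set_function m (\<lambda>A. Re (x' (\<nu> A)))" "signed_set_function m (\<lambda>A. Im (x' (\<nu> A)))"
    by (unfold_locales; intro sums_Re sums_Im sums; assumption)+
  note signed = this
  have "x' (\<nu> A) = 0" if "A \<in> sets m" "emeasure m A = 0" for A
    using null_measure[of A] that linear_simps(3)[OF bl] sets_m by simp
  then have null: "Re (x' (\<nu> A)) = 0" "Im (x' (\<nu> A)) = 0" if "A \<in> sets m" "emeasure m A = 0" for A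
    using that by simp_all
  obtain f where f: "integrable m f" "\<And>A. A \<in> sets m \<Longrightarrow> Re (x' (\<nu> A)) = (LINT t:A|m. f t)"
    using density_of_signed_set_function[OF finite_m signed(1) null(1)] by blast
  obtain g where g: "integrable m g" "\<And>A. A \<in> sets m \<Longrightarrow> Im (x' (\<nu> A)) = (LINT t:A|m. g t)"
    using density_of_signed_set_function[OF finite_m signed(2) null(2)] by blast
  define h where "h t = complex_of_real (f t) + \<i> * complex_of_real (g t)" for t
  have h: "integrable m h" unfolding h_def using f(1) g(1) by auto
  have "scalar_measure \<nu> x' A = (LINT t:A|m. h t)" if A: "A \<in> sets borel" for A
  proof -
    have A': "A \<in> sets m" using A sets_m by simp
    have int: "integrable m (\<lambda>t. indicator A t *\<^sub>R h t)" using A' h by (rule integrable_mult_indicator)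
    have "Re (LINT t:A|m. h t) = (LINT t:A|m. f t)" "Im (LINT t:A|m. h t) = (LINT t:A|m. g t)"
      unfolding set_lebesgue_integral_def using integral_Re[OF int] integral_Im[OF int]
      by (simp_all add: h_def)
    then show ?thesis using f(2)[OF A'] g(2)[OF A'] by (simp add: scalar_measure_def complex_eq_iff)
  qed
  then show ?thesis using h by blast
qed

lemma dens_integrable: "x' \<in> dual_space \<Longrightarrow> integrable m (dens x')"
  and dens_eq: "x' \<in> dual_space \<Longrightarrow> A \<in> sets borel \<Longrightarrow> x' (\<nu> A) = (LINT t:A|m. dens x' t)"
  using someI_ex[OF dens_exists, of x'] unfolding scalar_density_def scalar_measure_def by auto

lemma dens_borel: "x' \<in> dual_space \<Longrightarrow> dens x' \<in> borel_measurable borel"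
  using borel_measurable_integrable[OF dens_integrable] by simp

lemma dens_unique:
  assumes "x' \<in> dual_space" "integrable m h" "\<And>A. A \<in> sets borel \<Longrightarrow> x' (\<nu> A) = (LINT t:A|m. h t)"
  shows "AE t in m. dens x' t = h t"
  by (rule AE_eq_if_set_integrals_eq[OF sets_m dens_integrable]) (use assms dens_eq in auto)

lemma dens_add:
  assumes x: "x' \<in> dual_space" and y: "y' \<in> dual_space"
  shows "AE t in m. dens (\<lambda>x. x' x + y' x) t = dens x' t + dens y' t"
proof (rule dens_unique[OF dual_space_add[OF x y]])
  show "integrable m (\<lambda>t. dens x' t + dens y' t)" using dens_integrable x y by auto
  fix A :: "'g set" assume A: "A \<in> sets borel"
  then have "set_integrable m A (dens x')" "set_integrable m A (dens y')"
    unfolding set_integrable_def using sets_m dens_integrable x y by (auto intro!: integrable_mult_indicator simp del: scaleR_conv_of_real)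
  then show "x' (\<nu> A) + y' (\<nu> A) = (LINT t:A|m. dens x' t + dens y' t)"
    using dens_eq A x y by (simp add: set_integral_add)
qed

lemma dens_mult:
  assumes x: "x' \<in> dual_space"
  shows "AE t in m. dens (\<lambda>x. c * x' x) t = c * dens x' t"
  by (rule dens_unique[OF dual_space_mult[OF x]]) (use dens_integrable[OF x] dens_eq[OF x] in auto)

lemma scalar_variation: "x' \<in> dual_space \<Longrightarrow> scalar_variation \<nu> x' = density m (\<lambda>t. adens x' t)"
  by (rule variation_measure_density[OF sets_m dens_integrable]) (auto simp: scalar_measure_def dens_eq)

lemma total_variation_scalar:
  assumes "x' \<in> dual_space" "A \<in> sets borel"
  shows "total_variation (scalar_measure \<nu> x') A = (\<integral>\<^sup>+t. adens x' t * indicator A t \<partial>m)"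
proof -
  have "total_variation (scalar_measure \<nu> x') A = emeasure (density m (\<lambda>t. adens x' t)) A"
    by (rule total_variation_density[OF sets_m dens_integrable[OF assms(1)] _ assms(2)])
       (simp add: scalar_measure_def dens_eq[OF assms(1)])
  also have "\<dots> = (\<integral>\<^sup>+t. adens x' t * indicator A t \<partial>m)"
    using assms dens_borel[OF assms(1)] by (intro emeasure_density) (auto simp: sets_m)
  finally show ?thesis .
qed

lemma ae_vec_if_AE:
  assumes Z: "Z \<in> sets borel" "AE t in m. t \<notin> Z" and P: "\<And>t. t \<notin> Z \<Longrightarrow> P t"
  shows "ae_vec \<nu> P"
proof -
  have "total_variation (scalar_measure \<nu> x') Z = 0" if x': "x' \<in> dual_space" for x'
  proof -
    have "total_variation (scalar_measure \<nu> x') Z = (\<integral>\<^sup>+t. 0 \<partial>m)"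
      unfolding total_variation_scalar[OF x' Z(1)]
      using Z(2) by (intro nn_integral_cong_AE) (auto simp: indicator_def)
    then show ?thesis by simp
  qed
  then show ?thesis unfolding ae_vec_def using Z(1) P by (intro bexI[of _ Z]) auto
qed

lemma ae_vec_everywhere: "(\<And>t. P t) \<Longrightarrow> ae_vec \<nu> P"
  by (rule ae_vec_if_AE[of "{}"]) auto

lemma ae_vecD:
  assumes P: "ae_vec \<nu> P" and x': "x' \<in> dual_space"
  shows "AE t in m. dens x' t \<noteq> 0 \<longrightarrow> P t"
proof -
  obtain N where N: "N \<in> sets borel" "total_variation (scalar_measure \<nu> x') N = 0" "{t. \<not> P t} \<subseteq> N"
    using P x' unfolding ae_vec_def by blast
  have "(\<integral>\<^sup>+t. adens x' t * indicator N t \<partial>m) = 0"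
    using N(2) by (simp add: total_variation_scalar[OF x' N(1)])
  moreover have "(\<lambda>t. adens x' t * indicator N t) \<in> borel_measurable m"
    using N dens_borel[OF x'] by simp
  ultimately have "AE t in m. adens x' t * indicator N t = 0"
    by (simp add: nn_integral_0_iff_AE)
  then show ?thesis
    by eventually_elim (use N(3) in \<open>auto simp: indicator_def split: if_splits\<close>)
qed

lemma nn_integral_scalar_variation:
  assumes "x' \<in> dual_space" "W \<in> borel_measurable borel"
  shows "(\<integral>\<^sup>+t. W t \<partial>scalar_variation \<nu> x') = (\<integral>\<^sup>+t. W t * adens x' t \<partial>m)"
  unfolding scalar_variation[OF assms(1)] using assms dens_borel[OF assms(1)]
  by (subst nn_integral_density) (auto simp: mult.commute)

text \<open>
  The norm of \<open>L\<^sup>1\<^sub>w(\<nu>)\<close> on nonnegative functions, with extended values allowed so that it can be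
  applied to integrals that may diverge.
\<close>

definition wnorm :: "('g \<Rightarrow> ennreal) \<Rightarrow> ennreal" where
  "wnorm W = (SUP x'\<in>dual_ball. \<integral>\<^sup>+t. W t * adens x' t \<partial>m)"

abbreviation power_wnorm :: "real \<Rightarrow> ('g \<Rightarrow> complex) \<Rightarrow> ennreal" where
  "power_wnorm p f \<equiv> wnorm (\<lambda>t. ennreal (cmod (f t) powr p))"

lemma wnorm_upper: "x' \<in> dual_ball \<Longrightarrow> (\<integral>\<^sup>+t. W t * adens x' t \<partial>m) \<le> wnorm W"
  unfolding wnorm_def by (rule SUP_upper)

lemma wnorm_upper_dual:
  assumes x': "x' \<in> dual_space" and W: "W \<in> borel_measurable borel"
  shows "(\<integral>\<^sup>+t. W t * adens x' t \<partial>m) \<le> ennreal (onorm x') * wnorm W"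
proof -
  obtain u where u: "u \<in> dual_ball" "x' = (\<lambda>x. complex_of_real (onorm x') * u x)"
    using dual_space_normalize[OF x'] by blast
  have p: "0 \<le> onorm x'" using onorm_pos_le dual_space_linear[OF x'] by blast
  have "AE t in m. dens x' t = complex_of_real (onorm x') * dens u t"
    using dens_mult[OF dual_ball_in_dual[OF u(1)], of "complex_of_real (onorm x')"] u(2) by simp
  then have "(\<integral>\<^sup>+t. W t * adens x' t \<partial>m) = (\<integral>\<^sup>+t. ennreal (onorm x') * (W t * adens u t) \<partial>m)"
    by (intro nn_integral_cong_AE) (auto simp: norm_mult p ennreal_mult mult_ac)
  also have "\<dots> = ennreal (onorm x') * (\<integral>\<^sup>+t. W t * adens u t \<partial>m)"
    using W dens_borel[OF dual_ball_in_dual[OF u(1)]] by (intro nn_integral_cmult) auto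
  also have "\<dots> \<le> ennreal (onorm x') * wnorm W" by (intro mult_left_mono wnorm_upper u) auto
  finally show ?thesis .
qed

lemma wnorm_mono: "(\<And>t. V t \<le> W t) \<Longrightarrow> wnorm V \<le> wnorm W"
  unfolding wnorm_def by (intro SUP_mono' nn_integral_mono mult_right_mono) auto

lemma wnorm_least:
  "(\<And>x'. x' \<in> dual_ball \<Longrightarrow> (\<integral>\<^sup>+t. W t * adens x' t \<partial>m) \<le> c) \<Longrightarrow> wnorm W \<le> c"
  unfolding wnorm_def by (rule SUP_least)

lemma L1_norm_eq: "f \<in> borel_measurable borel \<Longrightarrow> L1_norm \<nu> f = wnorm (\<lambda>t. ennreal (cmod (f t)))"
  unfolding L1_norm_def wnorm_def
  by (intro SUP_cong refl nn_integral_scalar_variation dual_ball_in_dual) auto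

lemma L1w_iff:
  "f \<in> L1w \<nu> \<longleftrightarrow> f \<in> borel_measurable borel \<and>
     (\<forall>x'\<in>dual_space. (\<integral>\<^sup>+t. ennreal (cmod (f t)) * adens x' t \<partial>m) < \<infinity>)"
proof -
  have "integrable (scalar_variation \<nu> x') f \<longleftrightarrow> (\<integral>\<^sup>+t. ennreal (cmod (f t)) * adens x' t \<partial>m) < \<infinity>"
    if "f \<in> borel_measurable borel" "x' \<in> dual_space" for x'
  proof -
    have "f \<in> borel_measurable (scalar_variation \<nu> x')" using that by (simp add: scalar_variation)
    then show ?thesis
      using that nn_integral_scalar_variation[OF that(2), of "\<lambda>t. ennreal (cmod (f t))"]
      by (simp add: integrable_iff_bounded)
  qed
  then show ?thesis unfolding L1w_def by auto
qed

lemma L1w_integrable: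
  assumes "f \<in> L1w \<nu>" "x' \<in> dual_space"
  shows "integrable m (\<lambda>t. f t * dens x' t)"
proof (rule integrableI_bounded)
  show "(\<lambda>t. f t * dens x' t) \<in> borel_measurable m"
    using assms dens_borel[OF assms(2)] by (auto simp: L1w_iff)
  show "(\<integral>\<^sup>+t. ennreal (norm (f t * dens x' t)) \<partial>m) < \<infinity>"
    using assms by (auto simp: L1w_iff norm_mult ennreal_mult)
qed

lemma L1w_if_wnorm_finite:
  assumes "f \<in> borel_measurable borel" "wnorm (\<lambda>t. ennreal (cmod (f t))) < \<infinity>"
  shows "f \<in> L1w \<nu>"
  unfolding L1w_iff
proof (intro conjI ballI assms)
  fix x' :: "'x \<Rightarrow> complex" assume x': "x' \<in> dual_space"
  have "(\<integral>\<^sup>+t. ennreal (cmod (f t)) * adens x' t \<partial>m) \<le> ennreal (onorm x') * wnorm (\<lambda>t. ennreal (cmod (f t)))"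
    using assms x' by (intro wnorm_upper_dual) auto
  also have "\<dots> < \<infinity>" using assms by (auto simp: ennreal_mult_less_top)
  finally show "(\<integral>\<^sup>+t. ennreal (cmod (f t)) * adens x' t \<partial>m) < \<infinity>" .
qed

lemma simple_integrable:
  assumes \<phi>: "simple_function borel \<phi>" and x': "x' \<in> dual_space"
  shows "integrable m (\<lambda>t. \<phi> t * dens x' t)"
proof -
  have fin: "finite (range \<phi>)" using simple_functionD(1)[OF \<phi>] by simp
  have "cmod (\<phi> t) \<le> (\<Sum>y\<in>range \<phi>. cmod y)" for t
    using fin by (intro member_le_sum) auto
  then show ?thesis
    using borel_measurable_simple_function[OF \<phi>] dens_borel[OF x']
    by (intro Bochner_Integration.integrable_bound[OF integrable_mult_right[OF dens_integrable[OF x'], of "complex_of_real (\<Sum>y\<in>range \<phi>. cmod y)"]])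
       (auto simp: norm_mult sum_nonneg simp del: of_real_sum intro!: mult_right_mono)
qed

lemma simple_vector_measure_dual:
  assumes \<phi>: "simple_function borel \<phi>" and x': "x' \<in> dual_space" and A: "A \<in> sets borel"
  shows "x' (simple_vector_measure \<nu> \<phi> A) = (LINT t:A|m. \<phi> t * dens x' t)"
proof -
  have bl: "bounded_linear x'" using x' by (rule dual_space_linear)
  have fin: "finite (range \<phi>)" using simple_functionD(1)[OF \<phi>] by simp
  have meas: "A \<inter> \<phi> -` {y} \<in> sets borel" for y
    using simple_functionD(2)[OF \<phi>, of "{y}"] A by auto
  have int: "integrable m (\<lambda>t. indicator (A \<inter> \<phi> -` {y}) t *\<^sub>R dens x' t)" for y
    using meas sets_m by (intro integrable_mult_indicator dens_integrable x') auto
  have "x' (simple_vector_measure \<nu> \<phi> A) = (\<Sum>y\<in>range \<phi>. y * x' (\<nu> (A \<inter> \<phi> -` {y})))"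
    unfolding simple_vector_measure_def linear_sum[OF bounded_linear.linear[OF bl]]
    by (simp add: dual_space_scaleC[OF x'])
  also have "\<dots> = (\<Sum>y\<in>range \<phi>. (LINT t|m. y * (indicator (A \<inter> \<phi> -` {y}) t *\<^sub>R dens x' t)))"
    by (simp only: dens_eq[OF x' meas] set_lebesgue_integral_def integral_mult_right_zero)
  also have "\<dots> = (LINT t|m. (\<Sum>y\<in>range \<phi>. y * (indicator (A \<inter> \<phi> -` {y}) t *\<^sub>R dens x' t)))"
    using int by (intro Bochner_Integration.integral_sum[symmetric] integrable_mult_right)
  also have "\<dots> = (LINT t:A|m. \<phi> t * dens x' t)"
    unfolding set_lebesgue_integral_def
  proof (intro Bochner_Integration.integral_cong refl)
    fix t
    have "(\<Sum>y\<in>range \<phi>. y * (indicator (A \<inter> \<phi> -` {y}) t *\<^sub>R dens x' t))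
        = (\<Sum>y\<in>range \<phi>. if y = \<phi> t then y * (indicator A t *\<^sub>R dens x' t) else 0)"
      by (intro sum.cong) (auto simp: indicator_def)
    also have "\<dots> = indicator A t *\<^sub>R (\<phi> t * dens x' t)"
      using fin by (simp add: sum.delta')
    finally show "(\<Sum>y\<in>range \<phi>. y * (indicator (A \<inter> \<phi> -` {y}) t *\<^sub>R dens x' t)) = indicator A t *\<^sub>R (\<phi> t * dens x' t)" .
  qed
  finally show ?thesis .
qed

lemma simple_vector_measure_dual_UNIV:
  assumes \<phi>: "simple_function borel \<phi>" and x': "x' \<in> dual_space"
  shows "x' (simple_vector_measure \<nu> \<phi> UNIV) = (LINT t|m. \<phi> t * dens x' t)"
  using simple_vector_measure_dual[OF \<phi> x', of UNIV] by (simp add: set_lebesgue_integral_def)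

lemma semivariation_simple:
  assumes \<phi>: "simple_function borel \<phi>"
  shows "semivariation (simple_vector_measure \<nu> \<phi>) = wnorm (\<lambda>t. ennreal (cmod (\<phi> t)))"
  unfolding semivariation_def wnorm_def
proof (intro SUP_cong refl)
  fix x' :: "'x \<Rightarrow> complex" assume "x' \<in> dual_ball"
  then have x': "x' \<in> dual_space" by (rule dual_ball_in_dual)
  have "total_variation (scalar_measure (simple_vector_measure \<nu> \<phi>) x') UNIV
      = emeasure (density m (\<lambda>t. ennreal (cmod (\<phi> t * dens x' t)))) UNIV"
    by (rule total_variation_density[OF sets_m simple_integrable[OF \<phi> x']])
       (auto simp: scalar_measure_def simple_vector_measure_dual[OF \<phi> x'])
  also have "\<dots> = (\<integral>\<^sup>+t. ennreal (cmod (\<phi> t)) * adens x' t \<partial>m)"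
    using borel_measurable_simple_function[OF \<phi>] dens_borel[OF x'] sets_m
    by (subst emeasure_density) (auto simp: norm_mult ennreal_mult)
  finally show "total_variation (scalar_measure (simple_vector_measure \<nu> \<phi>) x') UNIV
      = (\<integral>\<^sup>+t. ennreal (cmod (\<phi> t)) * adens x' t \<partial>m)" .
qed

text \<open>
  Duality turns this into uniform boundedness in \<open>X\<close>. The integrals of the simple functions dominated
  by \<open>2 |f|\<close> form a set that is weakly bounded because \<open>f\<close> is integrable for every \<open>x'\<close>, hence
  bounded. On the other hand the integral of \<open>|f| |h_x'|\<close> is a limit of values of \<open>x'\<close> on this set.
\<close>

lemma wnorm_finite:
  assumes f: "f \<in> L1w \<nu>"
  shows "wnorm (\<lambda>t. ennreal (cmod (f t))) < \<infinity>"
proof -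
  have fb: "f \<in> borel_measurable borel" using f by (simp add: L1w_iff)
  define S where "S = {simple_vector_measure \<nu> \<phi> UNIV | \<phi>. simple_function borel \<phi> \<and> (\<forall>t. cmod (\<phi> t) \<le> 2 * cmod (f t))}"
  have "\<exists>C. \<forall>x\<in>S. cmod (x' x) \<le> C" if "x' \<in> dual_ball" for x'
  proof (intro exI ballI)
    fix x assume "x \<in> S"
    then obtain \<phi> where \<phi>: "simple_function borel \<phi>" "\<And>t. cmod (\<phi> t) \<le> 2 * cmod (f t)"
      and x: "x = simple_vector_measure \<nu> \<phi> UNIV" unfolding S_def by auto
    have x': "x' \<in> dual_space" using that by (rule dual_ball_in_dual)
    have "cmod (x' x) = cmod (LINT t|m. \<phi> t * dens x' t)"
      unfolding x simple_vector_measure_dual_UNIV[OF \<phi>(1) x'] ..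
    also have "\<dots> \<le> (LINT t|m. 2 * cmod (f t * dens x' t))"
    proof (rule order_trans[OF integral_norm_bound integral_mono])
      show "integrable m (\<lambda>t. cmod (\<phi> t * dens x' t))" by (rule integrable_norm[OF simple_integrable[OF \<phi>(1) x']])
      show "integrable m (\<lambda>t. 2 * cmod (f t * dens x' t))"
        by (rule integrable_mult_right[OF integrable_norm[OF L1w_integrable[OF f x']]])
      show "cmod (\<phi> t * dens x' t) \<le> 2 * cmod (f t * dens x' t)" for t
        using mult_right_mono[OF \<phi>(2)[of t], of "cmod (dens x' t)"] by (simp add: norm_mult mult.assoc)
    qed
    finally show "cmod (x' x) \<le> (LINT t|m. 2 * cmod (f t * dens x' t))" .
  qed
  then obtain C where C: "\<And>x. x \<in> S \<Longrightarrow> norm x \<le> C" using weakly_bounded_imp_bounded[of S] by blast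
  have "(\<integral>\<^sup>+t. ennreal (cmod (f t)) * adens x' t \<partial>m) \<le> ennreal C" if x'b: "x' \<in> dual_ball" for x'
  proof -
    have x': "x' \<in> dual_space" using x'b by (rule dual_ball_in_dual)
    \<comment> \<open>\<open>G h_x' = |f| |h_x'|\<close>; the simple approximations of \<open>G\<close> satisfy only \<open>|F i| \<le> 2 |G|\<close>, which is
      the reason for the factor \<open>2\<close> in \<open>S\<close>.\<close>
    define G where "G t = complex_of_real (cmod (f t)) * cnj (sgn (dens x' t))" for t
    have [measurable]: "cnj \<in> borel_measurable borel"
      by (rule borel_measurable_continuous_onI) (intro continuous_intros)
    have "G \<in> borel_measurable borel" unfolding G_def sgn_eq using fb dens_borel[OF x'] by measurable
    note Gm = this
    from borel_measurable_implies_sequence_metric[OF this, of 0]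
    obtain F where F': "\<And>i. simple_function borel (F i)"
        "\<And>t. t \<in> space borel \<Longrightarrow> (\<lambda>i. F i t) \<longlonglongrightarrow> G t"
        "\<And>i t. t \<in> space borel \<Longrightarrow> norm (F i t) \<le> 2 * norm (G t)"
      unfolding norm_conv_dist by blast
    then have F: "\<And>i. simple_function borel (F i)" "\<And>t. (\<lambda>i. F i t) \<longlonglongrightarrow> G t"
        "\<And>i t. norm (F i t) \<le> 2 * norm (G t)" by simp_all
    have Gf: "cmod (G t) \<le> cmod (f t)" for t by (simp add: G_def norm_mult norm_sgn)
    have Gd: "G t * dens x' t = complex_of_real (cmod (f t) * cmod (dens x' t))" for t
    proof (cases "dens x' t = 0")
      case False
      then show ?thesis using complex_norm_square[of "dens x' t"]
        by (simp add: G_def sgn_eq field_simps power2_eq_square)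
    qed simp
    have int: "integrable m (\<lambda>t. cmod (f t) * cmod (dens x' t))"
      using integrable_norm[OF L1w_integrable[OF f x']] by (simp add: norm_mult)
    have lim: "(\<lambda>i. LINT t|m. F i t * dens x' t) \<longlonglongrightarrow> (LINT t|m. G t * dens x' t)"
    proof (rule integral_dominated_convergence[where w = "\<lambda>t. 2 * (cmod (f t) * cmod (dens x' t))"])
      show "AE t in m. (\<lambda>i. F i t * dens x' t) \<longlonglongrightarrow> G t * dens x' t"
        using F(2) by (intro AE_I2 tendsto_intros)
      show "AE t in m. norm (F i t * dens x' t) \<le> 2 * (cmod (f t) * cmod (dens x' t))" for i
      proof (rule AE_I2)
        fix t
        have "norm (F i t) \<le> 2 * cmod (f t)" using F(3)[of i t] Gf[of t] by simp
        then have "norm (F i t) * cmod (dens x' t) \<le> 2 * cmod (f t) * cmod (dens x' t)" by (intro mult_right_mono) auto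
        then show "norm (F i t * dens x' t) \<le> 2 * (cmod (f t) * cmod (dens x' t))" by (simp add: norm_mult mult.assoc)
      qed
    qed (use int borel_measurable_integrable[OF simple_integrable[OF F(1) x']] Gm dens_borel[OF x'] in \<open>auto\<close>)
    have "cmod (LINT t|m. F i t * dens x' t) \<le> C" for i
    proof -
      have "simple_vector_measure \<nu> (F i) UNIV \<in> S"
        using F(1) order_trans[OF F(3) mult_left_mono[OF Gf]] unfolding S_def by auto
      then have "cmod (x' (simple_vector_measure \<nu> (F i) UNIV)) \<le> C"
        using C dual_ball_le[OF x'b] order_trans by blast
      then show ?thesis
        unfolding simple_vector_measure_dual_UNIV[OF F(1) x'] .
    qed
    then have "cmod (LINT t|m. G t * dens x' t) \<le> C"
      by (intro LIMSEQ_le_const2[OF tendsto_norm[OF lim]]) auto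
    moreover have "(LINT t|m. G t * dens x' t) = complex_of_real (LINT t|m. cmod (f t) * cmod (dens x' t))"
      unfolding Gd by (rule integral_complex_of_real)
    ultimately have "(LINT t|m. cmod (f t) * cmod (dens x' t)) \<le> C" by simp
    then show ?thesis
      using nn_integral_eq_integral[OF int] by (simp add: ennreal_mult ennreal_leI)
  qed
  then have "wnorm (\<lambda>t. ennreal (cmod (f t))) \<le> ennreal C" by (rule wnorm_least)
  then show ?thesis by (simp add: order_le_less_trans)
qed

lemma wnorm_monotone_convergence:
  assumes "incseq V" "\<And>i. V i \<in> borel_measurable borel" "\<And>t. (SUP i. V i t) = W t"
  shows "wnorm W = (SUP i. wnorm (V i))"
proof -
  have "(\<integral>\<^sup>+t. W t * adens x' t \<partial>m) = (SUP i. \<integral>\<^sup>+t. V i t * adens x' t \<partial>m)"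
    if "x' \<in> dual_ball" for x'
  proof -
    have "(\<integral>\<^sup>+t. W t * adens x' t \<partial>m) = (\<integral>\<^sup>+t. (SUP i. V i t * adens x' t) \<partial>m)"
      by (intro nn_integral_cong) (simp add: assms(3)[symmetric] SUP_mult_right_ennreal)
    also have "\<dots> = (SUP i. \<integral>\<^sup>+t. V i t * adens x' t \<partial>m)"
      using assms dens_borel[OF dual_ball_in_dual[OF that]]
      by (intro nn_integral_monotone_convergence_SUP) (auto simp: incseq_def le_fun_def mult_right_mono)
    finally show ?thesis .
  qed
  then have "wnorm W = (SUP x'\<in>dual_ball. SUP i. \<integral>\<^sup>+t. V i t * adens x' t \<partial>m)"
    unfolding wnorm_def by (intro SUP_cong) auto
  also have "\<dots> = (SUP i. wnorm (V i))" unfolding wnorm_def by (rule SUP_commute)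
  finally show ?thesis .
qed

end

text \<open>
  Images under a Borel isomorphism permute the finite Borel partitions of the space.
\<close>

lemma total_variation_image:
  fixes \<tau> \<sigma> :: "'g::topological_space \<Rightarrow> 'g"
  assumes "\<tau> \<in> borel_measurable borel" "\<sigma> \<in> borel_measurable borel"
    and inv: "\<And>t. \<tau> (\<sigma> t) = t" "\<And>t. \<sigma> (\<tau> t) = t"
  shows "total_variation (\<lambda>A. \<mu> (\<tau> ` A)) UNIV = total_variation \<mu> UNIV"
proof -
  have img: "\<tau> ` A = \<sigma> -` A" "\<sigma> ` A = \<tau> -` A" for A
    by (rule set_eqI, metis (no_types) image_iff vimage_eq inv)+
  have meas: "\<tau> ` A \<in> sets borel" "\<sigma> ` A \<in> sets borel" if "A \<in> sets borel" for A
    unfolding img using measurable_sets[OF assms(1) that] measurable_sets[OF assms(2) that] by auto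
  have le: "total_variation (\<lambda>A. \<mu> (\<tau> ` A)) UNIV \<le> total_variation \<mu> UNIV"
    if "inj \<tau>" "surj \<tau>" "\<And>A. A \<in> sets borel \<Longrightarrow> \<tau> ` A \<in> sets borel" for \<tau> :: "'g \<Rightarrow> 'g" and \<mu> :: "'g set \<Rightarrow> complex"
    unfolding total_variation_def
  proof (intro SUP_least)
    fix P assume P: "P \<in> {P. finite P \<and> P \<subseteq> sets borel \<and> disjoint P \<and> \<Union> P = (UNIV :: 'g set)}"
    have "inj_on ((`) \<tau>) P" using that(1) by (auto simp: inj_on_def inj_image_eq_iff)
    then have "(\<Sum>E\<in>P. ennreal (cmod (\<mu> (\<tau> ` E)))) = (\<Sum>E\<in>(`) \<tau> ` P. ennreal (cmod (\<mu> E)))"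
      by (simp add: sum.reindex)
    also have "\<dots> \<le> (SUP P\<in>{P. finite P \<and> P \<subseteq> sets borel \<and> disjoint P \<and> \<Union> P = UNIV}. \<Sum>E\<in>P. ennreal (cmod (\<mu> E)))"
    proof (intro SUP_upper, clarsimp, intro conjI)
      show "finite ((`) \<tau> ` P)" "(`) \<tau> ` P \<subseteq> sets borel" using P that(3) by auto
      show "disjoint ((`) \<tau> ` P)"
        using P that(1) unfolding disjoint_def by clarsimp (metis image_Int image_empty)
      show "(\<Union>E\<in>P. \<tau> ` E) = UNIV" using P that(2) by (simp add: image_Union[symmetric])
    qed
    finally show "(\<Sum>E\<in>P. ennreal (cmod (\<mu> (\<tau> ` E)))) \<le> (SUP P\<in>{P. finite P \<and> P \<subseteq> sets borel \<and> disjoint P \<and> \<Union> P = UNIV}. \<Sum>E\<in>P. ennreal (cmod (\<mu> E)))" .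
  qed
  have "inj \<tau>" "inj \<sigma>" "surj \<tau>" "surj \<sigma>" using inv by (metis injI, metis injI, metis surjI, metis surjI)
  then have "total_variation (\<lambda>A. \<mu> (\<tau> ` A)) UNIV \<le> total_variation \<mu> UNIV"
    "total_variation (\<lambda>A. \<mu> (\<tau> ` \<sigma> ` A)) UNIV \<le> total_variation (\<lambda>A. \<mu> (\<tau> ` A)) UNIV"
    using le[of \<tau> \<mu>] le[of \<sigma> "\<lambda>A. \<mu> (\<tau> ` A)"] meas by auto
  moreover have "\<tau> ` \<sigma> ` A = A" for A using inv by (simp add: image_comp comp_def)
  ultimately show ?thesis by (simp add: antisym)
qed

context ac_vector_measure
begin

text \<open>
  For a simple function \<open>\<phi>\<close> the measure \<open>(\<nu>_\<tau>)_\<phi>\<close> is the image of \<open>\<nu>_{\<phi> \<circ> \<sigma>}\<close>, where \<open>\<sigma>\<close> is the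
  inverse of \<open>\<tau>\<close>, and its semivariation is a value of \<open>wnorm\<close>. Monotone convergence does the rest.
\<close>

lemma wnorm_invariant:
  fixes \<tau> \<sigma> :: "'g \<Rightarrow> 'g"
  assumes invar: "semivariation_invariant \<tau> \<nu>"
    and meas: "\<tau> \<in> borel_measurable borel" "\<sigma> \<in> borel_measurable borel"
    and inv: "\<And>t. \<tau> (\<sigma> t) = t" "\<And>t. \<sigma> (\<tau> t) = t"
    and W: "W \<in> borel_measurable borel"
  shows "wnorm (\<lambda>t. W (\<sigma> t)) = wnorm W"
proof -
  have simple: "wnorm (\<lambda>t. ennreal (cmod (\<phi> (\<sigma> t)))) = wnorm (\<lambda>t. ennreal (cmod (\<phi> t)))"
    if \<phi>: "simple_function borel \<phi>" for \<phi> :: "'g \<Rightarrow> complex"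
  proof -
    have \<phi>\<sigma>: "simple_function borel (\<lambda>t. \<phi> (\<sigma> t))"
      using simple_function_comp[OF meas(2) \<phi>] by (simp add: comp_def)
    have "surj \<sigma>" using inv by (metis surjI)
    then have rng: "range (\<lambda>t. \<phi> (\<sigma> t)) = range \<phi>" by (metis image_image)
    have "\<tau> ` (A \<inter> \<phi> -` {y}) = \<tau> ` A \<inter> (\<lambda>t. \<phi> (\<sigma> t)) -` {y}" for A y using inv by force
    then have eq: "simple_vector_measure (\<lambda>A. \<nu> (\<tau> ` A)) \<phi> A = simple_vector_measure \<nu> (\<lambda>t. \<phi> (\<sigma> t)) (\<tau> ` A)" for A
      unfolding simple_vector_measure_def rng by simp
    have "wnorm (\<lambda>t. ennreal (cmod (\<phi> (\<sigma> t)))) = semivariation (simple_vector_measure \<nu> (\<lambda>t. \<phi> (\<sigma> t)))"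
      by (rule semivariation_simple[OF \<phi>\<sigma>, symmetric])
    also have "\<dots> = semivariation (simple_vector_measure (\<lambda>A. \<nu> (\<tau> ` A)) \<phi>)"
      unfolding semivariation_def scalar_measure_def eq
      by (intro SUP_cong refl total_variation_image[OF meas inv, symmetric])
    also have "\<dots> = semivariation (simple_vector_measure \<nu> \<phi>)"
      using invar \<phi> by (auto simp: semivariation_invariant_def)
    also have "\<dots> = wnorm (\<lambda>t. ennreal (cmod (\<phi> t)))" by (rule semivariation_simple[OF \<phi>])
    finally show ?thesis .
  qed
  obtain f where f: "\<And>i. simple_function borel (f i)" "incseq f" "\<And>i t. f i t < top" "\<And>t. (SUP i. f i t) = W t"
    using borel_measurable_implies_simple_function_sequence'[OF W] by blast
  have fb: "f i \<in> borel_measurable borel" for i using f(1) by (rule borel_measurable_simple_function)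
  have *: "wnorm (\<lambda>t. f i (\<sigma> t)) = wnorm (f i)" for i
  proof -
    have "simple_function borel (\<lambda>t. complex_of_real (enn2real (f i t)))"
      using simple_function_compose[OF f(1), of "\<lambda>y. complex_of_real (enn2real y)" i] by (simp add: comp_def)
    from simple[OF this] show ?thesis using f(3) by simp
  qed
  have "wnorm (\<lambda>t. W (\<sigma> t)) = (SUP i. wnorm (\<lambda>t. f i (\<sigma> t)))"
    by (rule wnorm_monotone_convergence) (use f meas(2) fb in \<open>auto simp: incseq_def le_fun_def\<close>)
  also have "\<dots> = (SUP i. wnorm (f i))" using * by simp
  also have "\<dots> = wnorm W"
    by (rule wnorm_monotone_convergence[symmetric]) (use f fb in auto)
  finally show ?thesis .
qed

end

locale translation_invariant_measure = ac_vector_measure m \<nu>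
  for m :: "'g::topological_group_add measure" and \<nu> :: "'g set \<Rightarrow> 'x::complex_normed_vector" +
  assumes transl: "semivariation_translation_invariant \<nu>" and inver: "semivariation_inversion_invariant \<nu>"
begin

lemma borel_group [measurable]:
  "(\<lambda>s::'g. s + t) \<in> borel_measurable borel" "(\<lambda>s::'g. t + s) \<in> borel_measurable borel"
  "(\<lambda>s::'g. - s) \<in> borel_measurable borel"
  "(\<lambda>s::'g. s - t) \<in> borel_measurable borel" "(\<lambda>s::'g. t - s) \<in> borel_measurable borel"
  by (intro borel_measurable_continuous_onI continuous_intros)+

lemma wnorm_translate:
  assumes W: "W \<in> borel_measurable borel"
  shows "wnorm (\<lambda>s. W (s - t)) = wnorm W"
  by (rule wnorm_invariant[of "\<lambda>s. s + t" "\<lambda>s. s - t", OF _ borel_group(1,4) _ _ W])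
     (use transl in \<open>auto simp: semivariation_translation_invariant_def\<close>)

lemma wnorm_reflect:
  assumes W [measurable]: "W \<in> borel_measurable borel"
  shows "wnorm (\<lambda>s. W (t - s)) = wnorm W"
proof -
  have "wnorm (\<lambda>s. W (t - s)) = wnorm (\<lambda>s. (\<lambda>u. W (- u)) (s - t))" by simp
  also have "\<dots> = wnorm (\<lambda>u. W (- u))" by (rule wnorm_translate) measurable
  also have "\<dots> = wnorm W"
    by (rule wnorm_invariant[OF _ borel_group(3,3) _ _ W])
       (use inver in \<open>auto simp: semivariation_inversion_invariant_def\<close>)
  finally show ?thesis .
qed

end

section \<open>Fubini's theorem for Borel functions and Radon measures\<close>

locale radon_prob =
  fixes m :: "'a::t2_space measure"
  assumes sets_borel: "sets m = sets borel" and total: "emeasure m UNIV = 1"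
    and inner: "\<And>A. A \<in> sets borel \<Longrightarrow> emeasure m A = (SUP K\<in>{K. compact K \<and> K \<subseteq> A}. emeasure m K)"
begin

lemma space_UNIV [simp]: "space m = UNIV"
  using sets_eq_imp_space_eq[OF sets_borel] by simp

lemma measurable_eq_borel [simp]: "measurable m N = measurable borel N"
  by (rule measurable_cong_sets[OF sets_borel refl])

sublocale prob_space m
  by (intro prob_spaceI) (simp add: total)

lemma inner_compact:
  assumes "A \<in> sets borel" "c < emeasure m A"
  obtains K where "compact K" "K \<subseteq> A" "c < emeasure m K"
  using assms(2) unfolding inner[OF assms(1)] less_SUP_iff by auto

end

lemma open_section: "open U \<Longrightarrow> open (Pair t -` U)" "open U \<Longrightarrow> open ((\<lambda>t. (t, s)) -` U)"
  by (intro open_vimage continuous_intros; simp)+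

text \<open>
  Inner regularity gives a compact part of the section, and by the tube lemma its product with a
  neighbourhood of \<open>t\<close> stays inside \<open>U\<close>. In particular the measure of the sections of an open set is
  lower semicontinuous.
\<close>

lemma (in radon_prob) open_section_neighbourhood:
  fixes U :: "('b::topological_space \<times> 'a) set"
  assumes "open U" "c < emeasure m (Pair t -` U)"
  obtains X K where "open X" "t \<in> X" "K \<in> sets borel" "X \<times> K \<subseteq> U" "c < emeasure m K"
proof -
  have "Pair t -` U \<in> sets borel" using open_section[OF assms(1)] by auto
  then obtain K where K: "compact K" "K \<subseteq> Pair t -` U" "c < emeasure m K"
    using inner_compact[OF _ assms(2)] by blast
  then have "{t} \<times> K \<subseteq> U" by auto
  from Elementary_Topology.tube_lemma[OF K(1) assms(1) this] show thesis
    using that[OF _ _ borel_compact[OF K(1)] _ K(3)] by blast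
qed

lemma (in radon_prob) borel_measurable_open_section:
  fixes U :: "('b::topological_space \<times> 'a) set"
  assumes "open U"
  shows "(\<lambda>t. emeasure m (Pair t -` U)) \<in> borel_measurable borel"
proof (rule borel_measurableI_greater)
  fix c
  have "open {t. c < emeasure m (Pair t -` U)}"
  proof (subst open_subopen, clarify)
    fix t assume "c < emeasure m (Pair t -` U)"
    then obtain X W where XW: "open X" "t \<in> X" "W \<in> sets borel" "X \<times> W \<subseteq> U" "c < emeasure m W"
      using open_section_neighbourhood[OF assms] by blast
    have "c < emeasure m (Pair u -` U)" if "u \<in> X" for u
      by (rule less_le_trans[OF XW(5) emeasure_mono])
         (use XW that open_section(1)[OF assms, of u] in \<open>auto simp: sets_borel\<close>)
    then show "\<exists>T. open T \<and> t \<in> T \<and> T \<subseteq> {t. c < emeasure m (Pair t -` U)}" using XW by blast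
  qed
  then show "{t \<in> space borel. c < emeasure m (Pair t -` U)} \<in> sets borel" by simp
qed

locale radon_prob_pair = M1: radon_prob m1 + M2: radon_prob m2
  for m1 :: "'a::t2_space measure" and m2 :: "'b::t2_space measure"
begin

lemma section_in_pair_sets: "V \<in> sets (m1 \<Otimes>\<^sub>M m2) \<Longrightarrow> Pair t -` V \<in> sets borel"
  using sets_Pair1[of V m1 m2 t] by (simp add: M2.sets_borel)

text \<open>
  Among the subsets of \<open>U\<close> in the product \<open>\<sigma>\<close>-algebra there is one, \<open>V\<close>, of maximal product
  measure. If \<open>V\<close> missed a part of \<open>U\<close>, then for some constant \<open>c\<close> the section of \<open>V\<close> would have
  measure below \<open>c\<close> and that of \<open>U\<close> above \<open>c\<close> on a compact set \<open>K\<close> of positive measure. Finitely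
  many rectangles inside \<open>U\<close> cover \<open>K\<close> with sections of measure above \<open>c\<close>, and adding them to \<open>V\<close>
  would increase its measure.
\<close>

lemma open_product_approx:
  fixes U :: "('a \<times> 'b) set"
  assumes U: "open U"
  obtains V where "V \<subseteq> U" "V \<in> sets (m1 \<Otimes>\<^sub>M m2)"
    "AE t in m1. emeasure m2 (Pair t -` V) = emeasure m2 (Pair t -` U)"
proof -
  interpret pair_sigma_finite m1 m2 by unfold_locales
  let ?M = "m1 \<Otimes>\<^sub>M m2"
  interpret P: pair_prob_space m1 m2 by unfold_locales
  define F where "F = {V. V \<subseteq> U \<and> V \<in> sets ?M}"
  have ne: "emeasure ?M ` F \<noteq> {}" by (auto simp: F_def)
  obtain f :: "nat \<Rightarrow> ennreal" where f: "range f \<subseteq> emeasure ?M ` F" "(SUP V\<in>F. emeasure ?M V) = Sup (range f)"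
    by (rule exE[OF ennreal_Sup_countable_SUP[OF ne]]) (elim conjE, rule that)
  then have "\<forall>n. \<exists>V\<in>F. f n = emeasure ?M V" by (auto simp: image_iff image_subset_iff)
  then obtain W where W: "\<And>n::nat. W n \<in> F" "\<And>n. f n = emeasure ?M (W n)" by metis
  define V where "V = (\<Union>n. W n)"
  have V: "V \<in> F" "V \<subseteq> U" "V \<in> sets ?M" using W(1) by (auto simp: F_def V_def)
  have max: "emeasure ?M A \<le> emeasure ?M V" if "A \<in> F" for A
  proof -
    have "emeasure ?M A \<le> Sup (range f)" unfolding f(2)[symmetric] using that by (rule SUP_upper)
    also have "\<dots> \<le> emeasure ?M V"
      unfolding W(2) using V(3) by (intro SUP_least emeasure_mono) (auto simp: V_def)
    finally show ?thesis .
  qed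
  have [measurable]: "(\<lambda>t. emeasure m2 (Pair t -` V)) \<in> borel_measurable m1"
    using V(3) by (rule M2.measurable_emeasure_Pair)
  have [measurable]: "(\<lambda>t. emeasure m2 (Pair t -` U)) \<in> borel_measurable m1"
    using M2.borel_measurable_open_section[OF U] by simp
  have level: "{t. emeasure m2 (Pair t -` V) < c \<and> c < emeasure m2 (Pair t -` U)} \<in> null_sets m1" (is "?E \<in> _") for c
  proof -
    have Em: "?E \<in> sets borel"
    proof -
      have "{t\<in>space m1. emeasure m2 (Pair t -` V) < c \<and> c < emeasure m2 (Pair t -` U)} \<in> sets m1" by measurable
      then show ?thesis by (simp add: M1.sets_borel)
    qed
    have "emeasure m1 K = 0" if K: "compact K" "K \<subseteq> ?E" for K
    proof -
      have "\<forall>t\<in>K. \<exists>X L. open X \<and> t \<in> X \<and> L \<in> sets borel \<and> X \<times> L \<subseteq> U \<and> c < emeasure m2 L"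
      proof
        fix t assume "t \<in> K"
        then have "c < emeasure m2 (Pair t -` U)" using K(2) by auto
        from M2.open_section_neighbourhood[OF U this]
        show "\<exists>X L. open X \<and> t \<in> X \<and> L \<in> sets borel \<and> X \<times> L \<subseteq> U \<and> c < emeasure m2 L" by metis
      qed
      then obtain X L where XL: "\<And>t. t \<in> K \<Longrightarrow> open (X t) \<and> t \<in> X t \<and> L t \<in> sets borel \<and> X t \<times> L t \<subseteq> U \<and> c < emeasure m2 (L t)"
        by metis
      obtain D where D: "D \<subseteq> K" "finite D" "K \<subseteq> (\<Union>t\<in>D. X t)"
      proof (rule compactE_image[OF K(1), of K X])
        show "open (X t)" if "t \<in> K" for t using XL[OF that] by blast
        show "K \<subseteq> (\<Union>t\<in>K. X t)" using XL by blast
      qed blast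
      define R where "R = (\<Union>t\<in>D. X t \<times> L t)"
      have Rm: "R \<in> sets ?M" unfolding R_def
      proof (intro sets.finite_UN D(2) pair_measureI)
        show "X t \<in> sets m1" "L t \<in> sets m2" if "t \<in> D" for t
          using XL[of t] that D(1) by (auto simp: M1.sets_borel M2.sets_borel)
      qed
      have RU: "R \<subseteq> U" using XL D(1) unfolding R_def by blast
      have "emeasure ?M V + emeasure ?M (R - V) = emeasure ?M (V \<union> R)"
      proof -
        have "V \<union> (R - V) = V \<union> R" "V \<inter> (R - V) = {}" by auto
        then show ?thesis using plus_emeasure[of V ?M "R - V"] V(3) Rm by auto
      qed
      also have "\<dots> \<le> emeasure ?M V" using V Rm RU by (intro max) (auto simp: F_def)
      finally have "emeasure ?M (R - V) = 0"
        using P.emeasure_finite[of V] by (metis add.right_neutral ennreal_add_left_cancel_le le_zero_eq infinity_ennreal_def)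
      then have "(\<integral>\<^sup>+t. emeasure m2 (Pair t -` (R - V)) \<partial>m1) = 0"
        using Rm V(3) by (subst M2.emeasure_pair_measure_alt[symmetric]) auto
      moreover have "(\<lambda>t. emeasure m2 (Pair t -` (R - V))) \<in> borel_measurable m1"
        using Rm V(3) by (intro M2.measurable_emeasure_Pair) auto
      ultimately have ae: "AE t in m1. emeasure m2 (Pair t -` (R - V)) = 0"
        by (simp add: nn_integral_0_iff_AE)
      have "AE t in m1. t \<notin> K"
        using ae
      proof eventually_elim
        fix t assume z: "emeasure m2 (Pair t -` (R - V)) = 0"
        show "t \<notin> K"
        proof
          assume t: "t \<in> K"
          then obtain u where u: "u \<in> D" "t \<in> X u" using D(3) by auto
          have "c < emeasure m2 (L u)" using XL u D(1) by blast
          also have "\<dots> \<le> emeasure m2 (Pair t -` V \<union> Pair t -` (R - V))"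
            using u V(3) Rm by (intro emeasure_mono) (auto simp: R_def M2.sets_borel intro!: sets.Un section_in_pair_sets)
          also have "\<dots> \<le> emeasure m2 (Pair t -` V) + emeasure m2 (Pair t -` (R - V))"
            using V(3) Rm by (intro emeasure_subadditive) (auto simp: M2.sets_borel intro!: section_in_pair_sets)
          also have "\<dots> < c" using t K(2) z by auto
          finally show False .
        qed
      qed
      then show ?thesis
        using borel_compact[OF K(1)] by (subst (asm) AE_iff_measurable[of K]) (auto simp: M1.sets_borel)
    qed
    then have "emeasure m1 ?E = 0"
      unfolding M1.inner[OF Em] by (intro antisym SUP_least) auto
    then show ?thesis using Em by (auto simp: M1.sets_borel)
  qed
  have le: "emeasure m2 (Pair t -` V) \<le> emeasure m2 (Pair t -` U)" for t
    using V(2) open_section(1)[OF U, of t] by (intro emeasure_mono) (auto simp: M2.sets_borel)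
  have "AE t in m1. \<forall>c\<in>range (\<lambda>q::rat. ennreal (of_rat q)). \<not> (emeasure m2 (Pair t -` V) < c \<and> c < emeasure m2 (Pair t -` U))"
    by (subst AE_ball_countable) (auto intro!: AE_I'[OF level])
  then have "AE t in m1. emeasure m2 (Pair t -` V) = emeasure m2 (Pair t -` U)"
  proof eventually_elim
    fix t assume nogap: "\<forall>c\<in>range (\<lambda>q::rat. ennreal (of_rat q)). \<not> (emeasure m2 (Pair t -` V) < c \<and> c < emeasure m2 (Pair t -` U))"
    show "emeasure m2 (Pair t -` V) = emeasure m2 (Pair t -` U)"
    proof (rule ccontr)
      assume "\<not> ?thesis"
      then have less: "emeasure m2 (Pair t -` V) < emeasure m2 (Pair t -` U)" using le[of t] by simp
      have "measure m2 (Pair t -` V) < measure m2 (Pair t -` U)"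
        using less by (simp add: M2.emeasure_eq_measure ennreal_less_iff)
      then obtain q where q: "measure m2 (Pair t -` V) < of_rat q" "of_rat q < measure m2 (Pair t -` U)"
        using of_rat_dense by blast
      have "0 \<le> (of_rat q :: real)" using q(1) measure_nonneg[of m2 "Pair t -` V"] by linarith
      then have "emeasure m2 (Pair t -` V) < ennreal (of_rat q) \<and> ennreal (of_rat q) < emeasure m2 (Pair t -` U)"
        using q by (auto simp: M2.emeasure_eq_measure ennreal_less_iff)
      then show False using nogap by blast
    qed
  qed
  then show thesis using that V by blast
qed

text \<open>
  Fubini's theorem for the product \<open>\<sigma>\<close>-algebra is applied to the set that approximates \<open>U\<close> from
  inside. The reverse inequality is the same statement with the factors exchanged.
\<close>

lemma open_fubini_le:
  fixes U :: "('a \<times> 'b) set"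
  assumes U: "open U"
  shows "(\<integral>\<^sup>+t. emeasure m2 (Pair t -` U) \<partial>m1) \<le> (\<integral>\<^sup>+s. emeasure m1 ((\<lambda>t. (t, s)) -` U) \<partial>m2)"
proof -
  interpret pair_sigma_finite m1 m2 by unfold_locales
  obtain V where V: "V \<subseteq> U" "V \<in> sets (m1 \<Otimes>\<^sub>M m2)"
    "AE t in m1. emeasure m2 (Pair t -` V) = emeasure m2 (Pair t -` U)"
    using open_product_approx[OF U] by blast
  have "(\<integral>\<^sup>+t. emeasure m2 (Pair t -` U) \<partial>m1) = (\<integral>\<^sup>+t. emeasure m2 (Pair t -` V) \<partial>m1)"
    using V(3) by (intro nn_integral_cong_AE) auto
  also have "\<dots> = emeasure (m1 \<Otimes>\<^sub>M m2) V" by (rule M2.emeasure_pair_measure_alt[OF V(2), symmetric])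
  also have "\<dots> = (\<integral>\<^sup>+s. emeasure m1 ((\<lambda>t. (t, s)) -` V) \<partial>m2)"
    by (rule emeasure_pair_measure_alt2[OF V(2)])
  also have "\<dots> \<le> (\<integral>\<^sup>+s. emeasure m1 ((\<lambda>t. (t, s)) -` U) \<partial>m2)"
    using V(1) open_section[OF U] by (intro nn_integral_mono emeasure_mono) (auto simp: M1.sets_borel)
  finally show ?thesis .
qed

end

lemma (in radon_prob_pair) open_fubini:
  fixes U :: "('a \<times> 'b) set"
  assumes U: "open U"
  shows "(\<integral>\<^sup>+t. emeasure m2 (Pair t -` U) \<partial>m1) = (\<integral>\<^sup>+s. emeasure m1 ((\<lambda>t. (t, s)) -` U) \<partial>m2)"
proof (rule antisym[OF open_fubini_le[OF U]])
  interpret S: radon_prob_pair m2 m1 by unfold_locales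
  have "open (prod.swap -` U)" using U by (intro open_vimage continuous_on_swap) auto
  from S.open_fubini_le[OF this]
  show "(\<integral>\<^sup>+s. emeasure m1 ((\<lambda>t. (t, s)) -` U) \<partial>m2) \<le> (\<integral>\<^sup>+t. emeasure m2 (Pair t -` U) \<partial>m1)"
    by (simp add: vimage_def)
qed

text \<open>
  Measurability of all section integrals is expressed by saying that \<open>t \<mapsto> \<delta>_t \<times> m\<close>, as a measure
  on the Borel sets of the product, is a probability kernel; for this the generator of open sets
  suffices.
\<close>

lemma (in radon_prob) borel_kernel:
  "(\<lambda>t::'b::topological_space. distr m borel (Pair t)) \<in> measurable borel (prob_algebra borel)"
proof (rule measurable_prob_algebra_generated)
  show "sets borel = sigma_sets UNIV {U::('b \<times> 'a) set. open U}" by (simp add: borel_def)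
  show "Int_stable {U::('b \<times> 'a) set. open U}" by (auto simp: Int_stable_def)
  have meas: "Pair t \<in> measurable m borel" for t :: 'b
    by (auto intro!: borel_measurable_continuous_onI continuous_intros)
  show "prob_space (distr m borel (Pair t))" for t :: 'b by (rule prob_space_distr[OF meas])
  show "(\<lambda>t. emeasure (distr m borel (Pair t)) U) \<in> borel_measurable borel" if "U \<in> {U::('b \<times> 'a) set. open U}" for U
    using borel_measurable_open_section[of U] that by (subst emeasure_distr[OF meas]) auto
qed auto

lemma (in radon_prob) borel_kernel_swap:
  "(\<lambda>s::'b::topological_space. distr m borel (\<lambda>t. (t, s))) \<in> measurable borel (subprob_algebra borel)"
proof -
  have swap: "(prod.swap :: 'b \<times> 'a \<Rightarrow> _) \<in> measurable borel borel"
    by (intro borel_measurable_continuous_onI continuous_on_swap)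
  have "(\<lambda>s::'b. distr (distr m borel (Pair s)) borel prod.swap) \<in> measurable borel (subprob_algebra borel)"
    by (rule measurable_compose[OF measurable_prob_algebraD[OF borel_kernel] measurable_distr[OF swap]])
  moreover have "distr (distr m borel (Pair s)) borel prod.swap = distr m borel (\<lambda>t. (t, s))" for s :: 'b
    using swap by (subst distr_distr) (auto intro!: borel_measurable_continuous_onI continuous_intros simp: comp_def)
  ultimately show ?thesis by simp
qed

lemma (in radon_prob) borel_measurable_nn_integral_section:
  fixes f :: "'b::topological_space \<times> 'a \<Rightarrow> ennreal"
  assumes f: "f \<in> borel_measurable borel"
  shows "(\<lambda>t. \<integral>\<^sup>+s. f (t, s) \<partial>m) \<in> borel_measurable borel"
proof -
  have "(\<lambda>t::'b. integral\<^sup>N (distr m borel (Pair t)) f) \<in> borel_measurable borel"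
    by (rule measurable_compose[OF measurable_prob_algebraD[OF borel_kernel] nn_integral_measurable_subprob_algebra[OF f]])
  moreover have "integral\<^sup>N (distr m borel (Pair t)) f = (\<integral>\<^sup>+s. f (t, s) \<partial>m)" for t :: 'b
    using f by (intro nn_integral_distr) (auto intro!: borel_measurable_continuous_onI continuous_intros)
  ultimately show ?thesis by simp
qed

lemma (in radon_prob) borel_measurable_integral_section:
  fixes f :: "'b::topological_space \<times> 'a \<Rightarrow> complex"
  assumes f: "f \<in> borel_measurable borel"
  shows "(\<lambda>t. LINT s|m. f (t, s)) \<in> borel_measurable borel"
proof -
  have "(\<lambda>t::'b. integral\<^sup>L (distr m borel (Pair t)) f) \<in> borel_measurable borel"
    by (rule measurable_compose[OF measurable_prob_algebraD[OF borel_kernel] integral_measurable_subprob_algebra[OF f]])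
  moreover have "integral\<^sup>L (distr m borel (Pair t)) f = (LINT s|m. f (t, s))" for t :: 'b
    using f by (intro integral_distr) (auto intro!: borel_measurable_continuous_onI continuous_intros)
  ultimately show ?thesis by simp
qed

text \<open>
  Both iterated integrals are integrals against Borel measures on the product, and these measures
  agree on open sets.
\<close>

theorem (in radon_prob_pair) borel_fubini:
  fixes f :: "'a \<times> 'b \<Rightarrow> ennreal"
  assumes f: "f \<in> borel_measurable borel"
  shows "(\<integral>\<^sup>+t. \<integral>\<^sup>+s. f (t, s) \<partial>m2 \<partial>m1) = (\<integral>\<^sup>+s. \<integral>\<^sup>+t. f (t, s) \<partial>m1 \<partial>m2)"
proof -
  let ?K1 = "\<lambda>t::'a. distr m2 borel (Pair t)" and ?K2 = "\<lambda>s::'b. distr m1 borel (\<lambda>t. (t, s))"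
  have K1: "?K1 \<in> measurable m1 (subprob_algebra borel)" and K2: "?K2 \<in> measurable m2 (subprob_algebra borel)"
    using measurable_prob_algebraD[OF M2.borel_kernel] M1.borel_kernel_swap by simp_all
  have p1: "Pair t \<in> measurable m2 borel" for t :: 'a
    by (auto intro!: borel_measurable_continuous_onI continuous_intros)
  have p2: "(\<lambda>t. (t, s)) \<in> measurable m1 borel" for s :: 'b
    by (auto intro!: borel_measurable_continuous_onI continuous_intros)
  have "(m1 \<bind> ?K1) = (m2 \<bind> ?K2)"
  proof (rule measure_eqI_generator_eq)
    show "Int_stable {U::('a \<times> 'b) set. open U}" by (auto simp: Int_stable_def)
    show "{U::('a \<times> 'b) set. open U} \<subseteq> Pow UNIV" by auto
    have em: "emeasure (m1 \<bind> ?K1) U = (\<integral>\<^sup>+t. emeasure m2 (Pair t -` U) \<partial>m1)"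
      "emeasure (m2 \<bind> ?K2) U = (\<integral>\<^sup>+s. emeasure m1 ((\<lambda>t. (t, s)) -` U) \<partial>m2)"
      if "U \<in> sets borel" for U
      using that by (auto simp: emeasure_bind[OF _ K1] emeasure_bind[OF _ K2] emeasure_distr[OF p1] emeasure_distr[OF p2])
    show "emeasure (m1 \<bind> ?K1) U = emeasure (m2 \<bind> ?K2) U" if "U \<in> {U. open U}" for U
      using that open_fubini[of U] em[of U] by simp
    have sb: "sets (m1 \<bind> ?K1) = sets borel" "sets (m2 \<bind> ?K2) = sets borel"
      by (simp_all add: sets_bind)
    show "sets (m1 \<bind> ?K1) = sigma_sets UNIV {U. open U}" "sets (m2 \<bind> ?K2) = sigma_sets UNIV {U. open U}"
      unfolding sb by (simp_all add: borel_def)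
    show "range (\<lambda>_::nat. UNIV :: ('a \<times> 'b) set) \<subseteq> {U. open U}" "(\<Union>i::nat. UNIV) = (UNIV :: ('a \<times> 'b) set)"
      by auto
    show "emeasure (m1 \<bind> ?K1) UNIV \<noteq> \<infinity>"
      using M1.emeasure_space_1 M2.emeasure_space_1 by (simp add: em)
  qed
  then have "(\<integral>\<^sup>+x. f x \<partial>(m1 \<bind> ?K1)) = (\<integral>\<^sup>+x. f x \<partial>(m2 \<bind> ?K2))" by simp
  then show ?thesis
    using f by (simp add: nn_integral_bind[OF f K1] nn_integral_bind[OF f K2] nn_integral_distr[OF p1] nn_integral_distr[OF p2])
qed

section \<open>Hoelder's inequality with three exponents\<close>

lemma cmod_le_one_plus_powr:
  assumes "1 \<le> p"
  shows "ennreal (cmod z) \<le> 1 + ennreal (cmod z powr p)"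
proof (cases "cmod z \<le> 1")
  case True
  then have "ennreal (cmod z) \<le> 1" by simp
  then show ?thesis by (rule order_trans) simp
next
  case False
  then have "cmod z powr 1 \<le> cmod z powr p" using assms by (intro powr_mono) auto
  then have "ennreal (cmod z) \<le> ennreal (cmod z powr p)" using False by (intro ennreal_leI) simp
  then show ?thesis by (rule order_trans) simp
qed

lemma exponents_real:
  assumes p: "1 \<le> p" and q: "1 \<le> q" and r: "0 < r" "r \<noteq> \<infinity>"
    and eq: "inverse (ennreal p) + inverse (ennreal q) = 1 + inverse r"
  shows "r = ennreal (enn2real r)" "0 < enn2real r" "1 / p + 1 / q = 1 + 1 / enn2real r"
proof -
  show rR: "r = ennreal (enn2real r)" using r(2) by (simp add: less_top)
  then show R: "0 < enn2real r" using r(1) by (metis enn2real_nonneg ennreal_0 less_irrefl order_le_less)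
  have "inverse r = ennreal (1 / enn2real r)" using R by (subst rR) (simp add: inverse_ennreal inverse_eq_divide)
  then have "ennreal (1 / p + 1 / q) = ennreal (1 + 1 / enn2real r)"
    using eq R p q by (simp add: ennreal_plus inverse_ennreal inverse_eq_divide)
  moreover have "0 \<le> 1 / p + 1 / q" "0 \<le> 1 + 1 / enn2real r" using p q by auto
  ultimately show "1 / p + 1 / q = 1 + 1 / enn2real r" by (simp only: ennreal_inj)
qed

text \<open>
  From \<open>a \<ge> G * (1 + ln (a / G))\<close> for the geometric mean \<open>G\<close>: the logarithms cancel in the weighted
  sum.
\<close>

lemma weighted_am_gm3:
  fixes u v w x y z :: real
  assumes w: "0 \<le> u" "0 \<le> v" "0 \<le> w" "u + v + w = 1" and pos: "0 < x" "0 < y" "0 < z"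
  shows "x powr u * y powr v * z powr w \<le> u * x + v * y + w * z"
proof -
  define G where "G = x powr u * y powr v * z powr w"
  have G: "0 < G" using pos by (simp add: G_def)
  have lnG: "ln G = u * ln x + v * ln y + w * ln z"
    using pos by (simp add: G_def ln_mult ln_powr)
  have t: "G * (1 + (ln a - ln G)) \<le> a" if "0 < a" for a
  proof -
    have "ln (a / G) \<le> a / G - 1" using that G by (intro ln_le_minus_one) simp
    then show ?thesis using that G by (simp add: ln_div field_simps)
  qed
  have "G = u * (G * (1 + (ln x - ln G))) + v * (G * (1 + (ln y - ln G))) + w * (G * (1 + (ln z - ln G)))"
  proof -
    have "u * (G * (1 + (ln x - ln G))) + v * (G * (1 + (ln y - ln G))) + w * (G * (1 + (ln z - ln G)))
      = G * ((u + v + w) * (1 - ln G) + (u * ln x + v * ln y + w * ln z))" by (simp add: algebra_simps)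
    also have "\<dots> = G" unfolding w(4) lnG[symmetric] by simp
    finally show ?thesis by simp
  qed
  also have "\<dots> \<le> u * x + v * y + w * z" using w t pos by (intro add_mono mult_left_mono) auto
  finally show ?thesis by (simp add: G_def)
qed

text \<open>
  The weighted inequality between arithmetic and geometric mean with weights \<open>\<rho>\<close>, \<open>1/p - \<rho>\<close>,
  \<open>1/q - \<rho>\<close>, which add up to \<open>1\<close>, applied to \<open>a\<^sup>p b\<^sup>q / \<delta>\<close>, \<open>a\<^sup>p / \<alpha>\<close> and \<open>b\<^sup>q / \<beta>\<close>.
\<close>

lemma young_pointwise:
  fixes a b p q \<rho> \<alpha> \<beta> \<delta> :: real
  assumes ab: "0 \<le> a" "0 \<le> b" and p: "1 \<le> p" and q: "1 \<le> q" and \<rho>: "0 \<le> \<rho>" "1 / p + 1 / q = 1 + \<rho>"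
    and pos: "0 < \<alpha>" "0 < \<beta>" "0 < \<delta>"
  shows "a * b \<le> (\<delta> powr \<rho> * \<alpha> powr (1 / p - \<rho>) * \<beta> powr (1 / q - \<rho>)) *
      (\<rho> / \<delta> * (a powr p * b powr q) + (1 / p - \<rho>) / \<alpha> * a powr p + (1 / q - \<rho>) / \<beta> * b powr q)"
    (is "_ \<le> ?K * ?R")
proof (cases "a = 0 \<or> b = 0")
  case True
  have "1 / p \<le> 1" "1 / q \<le> 1" using p q by simp_all
  then have "\<rho> \<le> 1 / p" "\<rho> \<le> 1 / q" using \<rho> by linarith+
  then have "0 \<le> ?R" using \<rho>(1) pos by (intro add_nonneg_nonneg mult_nonneg_nonneg divide_nonneg_nonneg) auto
  moreover have "0 \<le> ?K" by simp
  ultimately have "0 \<le> ?K * ?R" by simp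
  moreover have "a * b = 0" using True by auto
  ultimately show ?thesis by (simp only:)
next
  case False
  then have ab0: "0 < a" "0 < b" using ab by auto
  have "1 / p \<le> 1" "1 / q \<le> 1" using p q by simp_all
  then have w: "0 \<le> 1 / p - \<rho>" "0 \<le> 1 / q - \<rho>" using \<rho> by linarith+
  let ?x = "a powr p * b powr q / \<delta>" and ?y = "a powr p / \<alpha>" and ?z = "b powr q / \<beta>"
  have "?x powr \<rho> * ?y powr (1 / p - \<rho>) * ?z powr (1 / q - \<rho>) \<le> \<rho> * ?x + (1 / p - \<rho>) * ?y + (1 / q - \<rho>) * ?z"
    by (rule weighted_am_gm3) (use w \<rho> ab0 pos in auto)
  moreover have "?x powr \<rho> * ?y powr (1 / p - \<rho>) * ?z powr (1 / q - \<rho>) = a * b / ?K"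
  proof -
    have pz: "p * (1 / p - \<rho>) = 1 - p * \<rho>" "q * (1 / q - \<rho>) = 1 - q * \<rho>" using p q by (simp_all add: right_diff_distrib)
    have "a powr (p * \<rho>) * a powr (1 - p * \<rho>) = a" "b powr (q * \<rho>) * b powr (1 - q * \<rho>) = b"
      using ab0 by (simp_all add: powr_add[symmetric])
    moreover have "?x powr \<rho> * ?y powr (1 / p - \<rho>) * ?z powr (1 / q - \<rho>)
      = (a powr (p * \<rho>) * a powr (1 - p * \<rho>)) * (b powr (q * \<rho>) * b powr (1 - q * \<rho>)) / ?K"
      using ab0 pos by (simp add: powr_divide powr_mult powr_powr pz)
    ultimately show ?thesis by simp
  qed
  moreover have "0 < ?K" using pos by simp
  ultimately have "a * b \<le> ?K * (\<rho> * ?x + (1 / p - \<rho>) * ?y + (1 / q - \<rho>) * ?z)"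
    by (simp add: divide_le_eq mult.commute)
  then show ?thesis by simp
qed

text \<open>
  Integration of the pointwise inequality, where \<open>\<alpha>\<close>, \<open>\<beta>\<close>, \<open>\<delta>\<close> are upper bounds for the three
  integrals, so that the right-hand side sums to \<open>1\<close>. Bounds in place of the exact values
  avoid division by \<open>0\<close>. The case \<open>\<rho> = 0\<close> is Hoelder's inequality, where the third integral may
  diverge.
\<close>

lemma hoelder_young:
  fixes u v :: "'a \<Rightarrow> real" and w :: "'a \<Rightarrow> ennreal"
  assumes meas [measurable]: "u \<in> borel_measurable M" "v \<in> borel_measurable M" "w \<in> borel_measurable M"
    and nn: "\<And>s. 0 \<le> u s" "\<And>s. 0 \<le> v s"
    and p: "1 \<le> p" and q: "1 \<le> q" and \<rho>: "0 \<le> \<rho>" "1 / p + 1 / q = 1 + \<rho>"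
    and pos: "0 < \<alpha>" "0 < \<beta>" "0 < \<delta>"
    and A: "(\<integral>\<^sup>+s. ennreal (u s powr p) * w s \<partial>M) \<le> ennreal \<alpha>"
    and B: "(\<integral>\<^sup>+s. ennreal (v s powr q) * w s \<partial>M) \<le> ennreal \<beta>"
    and D: "\<rho> = 0 \<or> (\<integral>\<^sup>+s. ennreal (u s powr p) * ennreal (v s powr q) * w s \<partial>M) \<le> ennreal \<delta>"
  shows "(\<integral>\<^sup>+s. ennreal (u s) * ennreal (v s) * w s \<partial>M)
    \<le> ennreal (\<delta> powr \<rho> * \<alpha> powr (1 / p - \<rho>) * \<beta> powr (1 / q - \<rho>))"
proof -
  define K where "K = \<delta> powr \<rho> * \<alpha> powr (1 / p - \<rho>) * \<beta> powr (1 / q - \<rho>)"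
  define c1 c2 c3 where c_def: "c1 = \<rho> / \<delta>" "c2 = (1 / p - \<rho>) / \<alpha>" "c3 = (1 / q - \<rho>) / \<beta>"
  have "1 / p \<le> 1" "1 / q \<le> 1" using p q by simp_all
  then have "\<rho> \<le> 1 / p" "\<rho> \<le> 1 / q" using \<rho> by linarith+
  then have c: "0 \<le> c1" "0 \<le> c2" "0 \<le> c3" using \<rho>(1) pos by (auto simp: c_def)
  have K: "0 \<le> K" by (simp add: K_def)
  have "(\<integral>\<^sup>+s. ennreal (u s) * ennreal (v s) * w s \<partial>M)
    \<le> (\<integral>\<^sup>+s. ennreal K * (ennreal c1 * (ennreal (u s powr p) * ennreal (v s powr q) * w s)
        + ennreal c2 * (ennreal (u s powr p) * w s) + ennreal c3 * (ennreal (v s powr q) * w s)) \<partial>M)"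
  proof (intro nn_integral_mono)
    fix s
    have "u s * v s \<le> K * (c1 * (u s powr p * v s powr q) + c2 * u s powr p + c3 * v s powr q)"
      using young_pointwise[OF nn p q \<rho> pos] by (simp add: K_def c_def)
    then have "ennreal (u s * v s) \<le> ennreal (K * (c1 * (u s powr p * v s powr q) + c2 * u s powr p + c3 * v s powr q))"
      by (rule ennreal_leI)
    then have "ennreal (u s) * ennreal (v s) \<le> ennreal K * (ennreal c1 * (ennreal (u s powr p) * ennreal (v s powr q))
        + ennreal c2 * ennreal (u s powr p) + ennreal c3 * ennreal (v s powr q))"
      using K c nn by (simp add: ennreal_mult)
    from mult_right_mono[OF this, of "w s"]
    show "ennreal (u s) * ennreal (v s) * w s \<le> ennreal K * (ennreal c1 * (ennreal (u s powr p) * ennreal (v s powr q) * w s)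
        + ennreal c2 * (ennreal (u s powr p) * w s) + ennreal c3 * (ennreal (v s powr q) * w s))"
      by (simp add: distrib_right mult.assoc)
  qed
  also have "\<dots> = ennreal K * (ennreal c1 * (\<integral>\<^sup>+s. ennreal (u s powr p) * ennreal (v s powr q) * w s \<partial>M)
      + ennreal c2 * (\<integral>\<^sup>+s. ennreal (u s powr p) * w s \<partial>M) + ennreal c3 * (\<integral>\<^sup>+s. ennreal (v s powr q) * w s \<partial>M))"
    by (simp add: nn_integral_cmult nn_integral_add)
  also have "\<dots> \<le> ennreal K * (ennreal \<rho> + ennreal (1 / p - \<rho>) + ennreal (1 / q - \<rho>))"
  proof (intro mult_left_mono add_mono)
    show "ennreal c1 * (\<integral>\<^sup>+s. ennreal (u s powr p) * ennreal (v s powr q) * w s \<partial>M) \<le> ennreal \<rho>"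
    proof (cases "\<rho> = 0")
      case False
      then have "ennreal c1 * (\<integral>\<^sup>+s. ennreal (u s powr p) * ennreal (v s powr q) * w s \<partial>M) \<le> ennreal c1 * ennreal \<delta>"
        using D by (intro mult_left_mono) auto
      also have "\<dots> = ennreal \<rho>" using c pos by (simp add: ennreal_mult[symmetric] c_def)
      finally show ?thesis .
    qed (simp add: c_def)
    have "ennreal c2 * (\<integral>\<^sup>+s. ennreal (u s powr p) * w s \<partial>M) \<le> ennreal c2 * ennreal \<alpha>"
      by (intro mult_left_mono A) auto
    then show "ennreal c2 * (\<integral>\<^sup>+s. ennreal (u s powr p) * w s \<partial>M) \<le> ennreal (1 / p - \<rho>)"
      using c pos by (simp add: ennreal_mult[symmetric] c_def)
    have "ennreal c3 * (\<integral>\<^sup>+s. ennreal (v s powr q) * w s \<partial>M) \<le> ennreal c3 * ennreal \<beta>"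
      by (intro mult_left_mono B) auto
    then show "ennreal c3 * (\<integral>\<^sup>+s. ennreal (v s powr q) * w s \<partial>M) \<le> ennreal (1 / q - \<rho>)"
      using c pos by (simp add: ennreal_mult[symmetric] c_def)
  qed auto
  also have "ennreal \<rho> + ennreal (1 / p - \<rho>) + ennreal (1 / q - \<rho>) = 1"
  proof -
    have "ennreal ((\<rho> + (1 / p - \<rho>)) + (1 / q - \<rho>)) = ennreal \<rho> + ennreal (1 / p - \<rho>) + ennreal (1 / q - \<rho>)"
      using \<rho>(1) \<open>\<rho> \<le> 1 / p\<close> \<open>\<rho> \<le> 1 / q\<close> by (simp only: ennreal_plus add_nonneg_nonneg diff_ge_0_iff_ge)
    moreover have "(\<rho> + (1 / p - \<rho>)) + (1 / q - \<rho>) = 1" using \<rho>(2) by simp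
    ultimately show ?thesis by simp
  qed
  finally show ?thesis by (simp add: K_def)
qed

section \<open>Integrable functions as limits of simple functions\<close>

context ac_vector_measure
begin

lemma wnorm_add:
  assumes "V \<in> borel_measurable borel" "W \<in> borel_measurable borel"
  shows "wnorm (\<lambda>t. V t + W t) \<le> wnorm V + wnorm W"
proof (rule wnorm_least)
  fix x' :: "'x \<Rightarrow> complex" assume x': "x' \<in> dual_ball"
  have "(\<integral>\<^sup>+t. (V t + W t) * adens x' t \<partial>m)
    = (\<integral>\<^sup>+t. V t * adens x' t \<partial>m) + (\<integral>\<^sup>+t. W t * adens x' t \<partial>m)"
    using assms dens_borel[OF dual_ball_in_dual[OF x']] unfolding distrib_right
    by (intro nn_integral_add) auto
  also have "\<dots> \<le> wnorm V + wnorm W" by (intro add_mono wnorm_upper x')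
  finally show "(\<integral>\<^sup>+t. (V t + W t) * adens x' t \<partial>m) \<le> wnorm V + wnorm W" .
qed

lemma wnorm_cmult:
  assumes "W \<in> borel_measurable borel"
  shows "wnorm (\<lambda>t. c * W t) \<le> c * wnorm W"
proof (rule wnorm_least)
  fix x' :: "'x \<Rightarrow> complex" assume x': "x' \<in> dual_ball"
  have "(\<integral>\<^sup>+t. c * W t * adens x' t \<partial>m) = c * (\<integral>\<^sup>+t. W t * adens x' t \<partial>m)"
    using assms dens_borel[OF dual_ball_in_dual[OF x']] unfolding mult.assoc
    by (intro nn_integral_cmult) auto
  also have "\<dots> \<le> c * wnorm W" by (intro mult_left_mono wnorm_upper x') auto
  finally show "(\<integral>\<^sup>+t. c * W t * adens x' t \<partial>m) \<le> c * wnorm W" .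
qed

lemma wnorm_1_finite: "wnorm (\<lambda>t. 1) < \<infinity>"
proof -
  have "(\<lambda>t. 1) \<in> L1w \<nu>"
    unfolding L1w_iff using dens_integrable by (auto simp: integrable_iff_bounded)
  from wnorm_finite[OF this] show ?thesis by simp
qed

lemma bounded_simple_approx:
  fixes V :: "'g \<Rightarrow> real"
  assumes V: "V \<in> borel_measurable borel" "\<And>t. 0 \<le> V t" "\<And>t. V t \<le> c" and e: "0 < e"
  obtains \<phi> where "simple_function borel \<phi>" "wnorm (\<lambda>t. ennreal (cmod (complex_of_real (V t) - \<phi> t))) \<le> ennreal e"
proof -
  obtain C where C: "0 \<le> C" "wnorm (\<lambda>t. 1) = ennreal C"
    using wnorm_1_finite by (cases "wnorm (\<lambda>t. 1)") auto
  obtain N :: nat where N: "C / e < N" using reals_Archimedean2 by blast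
  have "0 \<le> C / e" using C e by simp
  then have N0: "0 < N" using N by (metis of_nat_0_less_iff le_less_trans)
  define \<phi> where "\<phi> t = complex_of_real (real_of_int \<lfloor>V t * N\<rfloor> / N)" for t
  have "\<phi> t \<in> (\<lambda>k. complex_of_real (real_of_int k / N)) ` {0..\<lfloor>c * N\<rfloor>}" for t
    unfolding \<phi>_def using V(2,3)[of t] by (intro imageI) (auto intro!: floor_mono mult_right_mono)
  then have "finite (range \<phi>)" by (intro finite_subset[of "range \<phi>" "(\<lambda>k. complex_of_real (real_of_int k / N)) ` {0..\<lfloor>c * N\<rfloor>}"]) auto
  moreover have "\<phi> \<in> borel_measurable borel" unfolding \<phi>_def using V(1) by measurable
  ultimately have simple: "simple_function borel \<phi>" by (intro simple_function_borel_measurable) auto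
  have close: "cmod (complex_of_real (V t) - \<phi> t) \<le> 1 / N" for t
  proof -
    have "\<bar>V t * N - real_of_int \<lfloor>V t * N\<rfloor>\<bar> \<le> 1" by linarith
    moreover have "V t - real_of_int \<lfloor>V t * N\<rfloor> / N = (V t * N - real_of_int \<lfloor>V t * N\<rfloor>) / N"
      using N0 by (simp add: field_simps)
    ultimately have "\<bar>V t - real_of_int \<lfloor>V t * N\<rfloor> / N\<bar> \<le> 1 / N"
      using N0 by (simp add: abs_divide divide_right_mono)
    then show ?thesis by (simp add: \<phi>_def flip: of_real_diff of_real_divide)
  qed
  have "wnorm (\<lambda>t. ennreal (cmod (complex_of_real (V t) - \<phi> t))) \<le> wnorm (\<lambda>t. ennreal (1 / N) * 1)"
    using close by (intro wnorm_mono) (simp add: ennreal_leI)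
  also have "\<dots> \<le> ennreal (1 / N) * wnorm (\<lambda>t. 1)" by (rule wnorm_cmult) auto
  also have "\<dots> = ennreal (C / N)" using C N0 by (simp add: ennreal_mult[symmetric])
  also have "\<dots> \<le> ennreal e" using N N0 e by (intro ennreal_leI) (simp add: field_simps)
  finally show thesis using that[OF simple] by blast
qed

lemma set_integral_wnorm_le:
  assumes x': "x' \<in> dual_space" and F: "F \<in> borel_measurable borel" "integrable m (\<lambda>t. F t * dens x' t)"
    and A: "A \<in> sets borel" and e: "0 \<le> e" "wnorm (\<lambda>t. ennreal (cmod (F t))) \<le> ennreal e"
  shows "cmod (LINT t:A|m. F t * dens x' t) \<le> onorm x' * e"
proof -
  have p: "0 \<le> onorm x'" using onorm_pos_le dual_space_linear[OF x'] by blast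
  have "ennreal (cmod (LINT t:A|m. F t * dens x' t)) \<le> (\<integral>\<^sup>+t. norm (indicator A t *\<^sub>R (F t * dens x' t)) \<partial>m)"
    unfolding set_lebesgue_integral_def using F A sets_m
    by (intro integral_norm_bound_ennreal integrable_mult_indicator) auto
  also have "\<dots> \<le> (\<integral>\<^sup>+t. ennreal (cmod (F t)) * adens x' t \<partial>m)"
    by (intro nn_integral_mono) (auto simp: norm_mult ennreal_mult indicator_def)
  also have "\<dots> \<le> ennreal (onorm x') * wnorm (\<lambda>t. ennreal (cmod (F t)))"
    using F by (intro wnorm_upper_dual x') auto
  also have "\<dots> \<le> ennreal (onorm x') * ennreal e" by (intro mult_left_mono e) auto
  also have "\<dots> = ennreal (onorm x' * e)" using p e by (simp add: ennreal_mult)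
  finally show ?thesis using p e by (simp add: ennreal_le_iff)
qed

end

text \<open>
  The integrals \<open>x n\<close> of the approximating simple functions over \<open>A\<close> form a Cauchy sequence: the dual
  ball norms \<open>X\<close>, and \<open>x'\<close> applied to \<open>x n - x k\<close> is controlled by \<open>wnorm\<close> uniformly in the ball. The
  limit is the integral of \<open>f\<close>, and it is unique because the dual separates points.
\<close>

lemma L1_if_simple_approx:
  fixes \<nu> :: "'g::topological_space set \<Rightarrow> 'x::{complex_normed_vector,banach}"
  assumes "ac_vector_measure m \<nu>" and f: "f \<in> L1w \<nu>"
    and approx: "\<And>e. 0 < e \<Longrightarrow> \<exists>\<phi>. simple_function borel \<phi> \<and>
      ac_vector_measure.wnorm m \<nu> (\<lambda>t. ennreal (cmod (f t - \<phi> t))) \<le> ennreal e"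
  shows "f \<in> L1 \<nu>"
proof -
  interpret ac_vector_measure m \<nu> by fact
  have fb: "f \<in> borel_measurable borel" using f by (simp add: L1w_iff)
  have "\<forall>n::nat. \<exists>\<phi>. simple_function borel \<phi> \<and> wnorm (\<lambda>t. ennreal (cmod (f t - \<phi> t))) \<le> ennreal (1 / Suc n)"
    using approx by simp
  then obtain \<phi> where \<phi>: "\<And>n::nat. simple_function borel (\<phi> n)"
    "\<And>n. wnorm (\<lambda>t. ennreal (cmod (f t - \<phi> n t))) \<le> ennreal (1 / Suc n)" by metis
  have \<phi>b: "\<phi> n \<in> borel_measurable borel" for n by (rule borel_measurable_simple_function[OF \<phi>(1)])
  have ex: "\<exists>x. \<forall>x'\<in>dual_space. x' x = (LINT t:A|m. f t * dens x' t)" if A: "A \<in> sets borel" for A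
  proof -
    define x where "x n = simple_vector_measure \<nu> (\<phi> n) A" for n
    have diff: "cmod ((LINT t:A|m. f t * dens x' t) - x' (x n)) \<le> onorm x' * (1 / Suc n)" if x': "x' \<in> dual_space" for x' n
    proof -
      have int: "integrable m (\<lambda>t. f t * dens x' t)" "integrable m (\<lambda>t. \<phi> n t * dens x' t)"
        using L1w_integrable[OF f x'] simple_integrable[OF \<phi>(1) x'] by auto
      have set_int: "set_integrable m A (\<lambda>t. f t * dens x' t)" "set_integrable m A (\<lambda>t. \<phi> n t * dens x' t)"
        unfolding set_integrable_def using int A sets_m by (intro integrable_mult_indicator; simp)+
      have "integrable m (\<lambda>t. (f t - \<phi> n t) * dens x' t)"
        using Bochner_Integration.integrable_diff[OF int] by (simp add: left_diff_distrib)
      then have "cmod (LINT t:A|m. (f t - \<phi> n t) * dens x' t) \<le> onorm x' * (1 / Suc n)"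
        using fb \<phi>b by (intro set_integral_wnorm_le x' A \<phi>(2)) auto
      then show ?thesis
        using set_int by (simp add: left_diff_distrib set_integral_diff x_def simple_vector_measure_dual[OF \<phi>(1) x' A])
    qed
    have dist: "norm (x n - x k) \<le> 1 / Suc n + 1 / Suc k" for n k
    proof (rule norm_le_if_dual_ball_le)
      fix x' :: "'x \<Rightarrow> complex" assume x': "x' \<in> dual_ball"
      then have x'd: "x' \<in> dual_space" and le1: "onorm x' \<le> 1" by (auto simp: dual_ball_def)
      let ?I = "LINT t:A|m. f t * dens x' t"
      have *: "cmod (?I - x' (x n)) \<le> 1 / Suc n" for n
        using diff[OF x'd, of n] mult_right_mono[OF le1, of "1 / Suc n"] by simp
      have "x' (x n - x k) = (?I - x' (x k)) - (?I - x' (x n))"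
        using linear_simps(2)[OF dual_space_linear[OF x'd]] by simp
      then have "cmod (x' (x n - x k)) \<le> cmod (?I - x' (x k)) + cmod (?I - x' (x n))"
        by (simp only: norm_triangle_ineq4)
      then show "cmod (x' (x n - x k)) \<le> 1 / Suc n + 1 / Suc k" using *[of n] *[of k] by linarith
    qed
    have "Cauchy x"
    proof (rule metric_CauchyI)
      fix e :: real assume e: "0 < e"
      obtain M where M: "1 / Suc M < e / 2" using nat_approx_posE[of "e / 2"] e by auto
      have "dist (x n) (x k) < e" if "M \<le> n" "M \<le> k" for n k
      proof -
        have "1 / Suc n \<le> 1 / Suc M" "1 / Suc k \<le> 1 / Suc M" using that by (simp_all add: frac_le)
        then show ?thesis using dist[of n k] M by (simp add: dist_norm)
      qed
      then show "\<exists>M. \<forall>m\<ge>M. \<forall>n\<ge>M. dist (x m) (x n) < e" by blast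
    qed
    then obtain y where y: "x \<longlonglongrightarrow> y" using Cauchy_convergent convergent_def by blast
    have "x' y = (LINT t:A|m. f t * dens x' t)" if x': "x' \<in> dual_space" for x'
    proof (rule LIMSEQ_unique)
      show "(\<lambda>n. x' (x n)) \<longlonglongrightarrow> x' y" by (rule bounded_linear.tendsto[OF dual_space_linear[OF x'] y])
      have "(\<lambda>n. (LINT t:A|m. f t * dens x' t) - x' (x n)) \<longlonglongrightarrow> 0"
      proof (rule Lim_null_comparison)
        show "\<forall>\<^sub>F n in sequentially. cmod ((LINT t:A|m. f t * dens x' t) - x' (x n)) \<le> onorm x' * (1 / Suc n)"
          using diff[OF x'] by simp
        show "(\<lambda>n. onorm x' * (1 / Suc n)) \<longlonglongrightarrow> 0"
          using tendsto_mult[OF tendsto_const LIMSEQ_inverse_real_of_nat, of "onorm x'"] by (simp add: inverse_eq_divide)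
      qed
      from tendsto_diff[OF tendsto_const this, of "LINT t:A|m. f t * dens x' t"]
      show "(\<lambda>n. x' (x n)) \<longlonglongrightarrow> (LINT t:A|m. f t * dens x' t)" by simp
    qed
    then show ?thesis by blast
  qed
  have ci: "complex_integral (scalar_measure \<nu> x') A f = (LINT t:A|m. f t * dens x' t)"
    if "x' \<in> dual_space" "A \<in> sets borel" for x' A
    by (rule complex_integral_density[OF sets_m dens_integrable[OF that(1)] _ that(2) fb])
       (simp add: scalar_measure_def dens_eq[OF that(1)])
  have uniq: "x = y" if "\<forall>x'\<in>dual_space. x' x = x' (y::'x)" for x y
  proof -
    have "norm (x - y) \<le> 0"
    proof (rule norm_le_if_dual_ball_le)
      fix x' :: "'x \<Rightarrow> complex" assume "x' \<in> dual_ball"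
      then have x': "x' \<in> dual_space" by (rule dual_ball_in_dual)
      then show "cmod (x' (x - y)) \<le> 0"
        using that linear_simps(2)[OF dual_space_linear[OF x']] by simp
    qed
    then show ?thesis by simp
  qed
  show ?thesis
    unfolding L1_def
  proof (clarify, intro conjI f ballI)
    fix A :: "'g set" assume A: "A \<in> sets borel"
    obtain x where x: "\<forall>x'\<in>dual_space. x' x = (LINT t:A|m. f t * dens x' t)" using ex[OF A] by blast
    show "\<exists>!x. \<forall>x'\<in>dual_space. x' x = complex_integral (scalar_measure \<nu> x') A f"
    proof (rule ex1I[of _ x])
      show "\<forall>x'\<in>dual_space. x' x = complex_integral (scalar_measure \<nu> x') A f" using x ci A by simp
      show "y = x" if "\<forall>x'\<in>dual_space. x' y = complex_integral (scalar_measure \<nu> x') A f" for y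
        using that x ci A by (intro uniq) simp
    qed
  qed
qed

text \<open>
  The truncations are bounded, and bounded functions are uniform limits of simple functions.
\<close>

lemma L1_if_truncations_converge:
  fixes \<nu> :: "'g::topological_space set \<Rightarrow> 'x::{complex_normed_vector,banach}"
  assumes acm: "ac_vector_measure m \<nu>"
    and W: "W \<in> borel_measurable borel" "\<And>t. 0 \<le> W t"
    and fin: "ac_vector_measure.wnorm m \<nu> (\<lambda>t. ennreal (W t)) < \<infinity>"
    and approx: "\<And>e. 0 < e \<Longrightarrow> \<exists>c\<ge>0. ac_vector_measure.wnorm m \<nu> (\<lambda>t. ennreal (W t - min (W t) c)) \<le> ennreal e"
  shows "(\<lambda>t. complex_of_real (W t)) \<in> L1 \<nu>"
proof -
  interpret ac_vector_measure m \<nu> by fact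
  show ?thesis
  proof (rule L1_if_simple_approx[OF acm])
    show "(\<lambda>t. complex_of_real (W t)) \<in> L1w \<nu>"
      using W fin by (intro L1w_if_wnorm_finite) auto
    fix e :: real assume e: "0 < e"
    obtain c where c: "0 \<le> c" "wnorm (\<lambda>t. ennreal (W t - min (W t) c)) \<le> ennreal (e / 2)"
      using approx[of "e / 2"] e by auto
    obtain \<phi> where \<phi>: "simple_function borel \<phi>"
      "wnorm (\<lambda>t. ennreal (cmod (complex_of_real (min (W t) c) - \<phi> t))) \<le> ennreal (e / 2)"
      using bounded_simple_approx[of "\<lambda>t. min (W t) c" c "e / 2"] W c(1) e by auto
    have \<phi>b: "\<phi> \<in> borel_measurable borel" by (rule borel_measurable_simple_function[OF \<phi>(1)])
    have minb: "(\<lambda>t. min (W t) c) \<in> borel_measurable borel" using W(1) by (intro borel_measurable_min) auto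
    have "wnorm (\<lambda>t. ennreal (cmod (complex_of_real (W t) - \<phi> t)))
      \<le> wnorm (\<lambda>t. ennreal (W t - min (W t) c) + ennreal (cmod (complex_of_real (min (W t) c) - \<phi> t)))"
    proof (rule wnorm_mono)
      fix t
      have "complex_of_real (W t) - \<phi> t = complex_of_real (W t - min (W t) c) + (complex_of_real (min (W t) c) - \<phi> t)" by simp
      then have "cmod (complex_of_real (W t) - \<phi> t) \<le> cmod (complex_of_real (W t - min (W t) c)) + cmod (complex_of_real (min (W t) c) - \<phi> t)"
        by (simp only: norm_triangle_ineq)
      also have "cmod (complex_of_real (W t - min (W t) c)) = W t - min (W t) c"
        unfolding norm_of_real by simp
      finally show "ennreal (cmod (complex_of_real (W t) - \<phi> t)) \<le> ennreal (W t - min (W t) c) + ennreal (cmod (complex_of_real (min (W t) c) - \<phi> t))"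
        by (simp add: ennreal_plus[symmetric] ennreal_leI del: ennreal_plus)
    qed
    also have "\<dots> \<le> wnorm (\<lambda>t. ennreal (W t - min (W t) c)) + wnorm (\<lambda>t. ennreal (cmod (complex_of_real (min (W t) c) - \<phi> t)))"
      using W(1) \<phi>b minb by (intro wnorm_add) auto
    also have "\<dots> \<le> ennreal (e / 2) + ennreal (e / 2)" by (intro add_mono c \<phi>)
    also have "\<dots> = ennreal e" using e by (simp add: ennreal_plus[symmetric] del: ennreal_plus)
    finally show "\<exists>\<phi>. simple_function borel \<phi> \<and> wnorm (\<lambda>t. ennreal (cmod (complex_of_real (W t) - \<phi> t))) \<le> ennreal e"
      using \<phi>(1) by blast
  qed
qed

section \<open>Convolution with respect to an invariant vector measure\<close>

locale haar_vector_measure = translation_invariant_measure m \<nu> + radon_prob m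
  for m :: "'g::{topological_group_add,t2_space} measure" and \<nu> :: "'g set \<Rightarrow> 'x::complex_normed_vector" +
  assumes left_invariant: "\<And>a A. A \<in> sets borel \<Longrightarrow> emeasure m ((\<lambda>s. a + s) ` A) = emeasure m A"
    and nonzero: "\<nu> UNIV \<noteq> 0"
begin

sublocale self: radon_prob_pair m m
  by unfold_locales

lemma nn_integral_left_translate:
  assumes W: "W \<in> borel_measurable borel"
  shows "(\<integral>\<^sup>+s. W (t + s) \<partial>m) = (\<integral>\<^sup>+s. W s \<partial>m)"
proof -
  have meas: "(\<lambda>s. t + s) \<in> measurable m borel" by simp
  have "distr m borel (\<lambda>s. t + s) = m"
  proof (rule measure_eqI)
    show "sets (distr m borel (\<lambda>s. t + s)) = sets m" by (simp add: sets_m)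
    fix A assume "A \<in> sets (distr m borel (\<lambda>s. t + s))"
    then have A: "A \<in> sets borel" by simp
    have "(\<lambda>s. t + s) -` A = (\<lambda>s. - t + s) ` A"
      by (auto simp: image_iff add.assoc[symmetric] intro!: bexI[of _ "t + _"])
    then show "emeasure (distr m borel (\<lambda>s. t + s)) A = emeasure m A"
      using left_invariant[OF A, of "- t"] A by (simp add: emeasure_distr[OF meas])
  qed
  then have "(\<integral>\<^sup>+s. W s \<partial>m) = (\<integral>\<^sup>+s. W s \<partial>distr m borel (\<lambda>s. t + s))" by simp
  also have "\<dots> = (\<integral>\<^sup>+s. W (t + s) \<partial>m)" by (rule nn_integral_distr[OF meas]) (simp add: W)
  finally show ?thesis by simp
qed

lemma borel_pair [measurable]:
  "(\<lambda>x::'g \<times> 'g. fst x + snd x) \<in> borel_measurable borel"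
  "(\<lambda>x::'g \<times> 'g. fst x - snd x) \<in> borel_measurable borel"
  "(fst :: 'g \<times> 'g \<Rightarrow> 'g) \<in> borel_measurable borel"
  "(snd :: 'g \<times> 'g \<Rightarrow> 'g) \<in> borel_measurable borel"
  by (intro borel_measurable_continuous_onI continuous_intros)+

text \<open>
  Averaging over translations: the double integral of \<open>W (t + s) |h_x' t|\<close> is at most \<open>wnorm W\<close> if one
  integrates in \<open>t\<close> first, by invariance of \<open>wnorm\<close> under right translation, and it factors if one
  integrates in \<open>s\<close> first, by left invariance of Haar measure.
\<close>

lemma mass_times_integral_le_wnorm:
  assumes W [measurable]: "W \<in> borel_measurable borel" and x': "x' \<in> dual_ball"
  shows "(\<integral>\<^sup>+t. adens x' t \<partial>m) * (\<integral>\<^sup>+s. W s \<partial>m) \<le> wnorm W"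
proof -
  have d [measurable]: "dens x' \<in> borel_measurable borel" by (rule dens_borel[OF dual_ball_in_dual[OF x']])
  have "(\<lambda>x. W (fst x + snd x) * ennreal (cmod (dens x' (fst x)))) \<in> borel_measurable borel" by measurable
  from self.borel_fubini[OF this]
  have "(\<integral>\<^sup>+t. \<integral>\<^sup>+s. W (t + s) * adens x' t \<partial>m \<partial>m) = (\<integral>\<^sup>+s. \<integral>\<^sup>+t. W (t + s) * adens x' t \<partial>m \<partial>m)"
    by simp
  also have "\<dots> \<le> (\<integral>\<^sup>+s. wnorm W \<partial>m)"
  proof (intro nn_integral_mono)
    fix s
    have "(\<integral>\<^sup>+t. W (t + s) * adens x' t \<partial>m) \<le> wnorm (\<lambda>t. W (t - - s))"
      using wnorm_upper[OF x', of "\<lambda>t. W (t + s)"] by simp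
    also have "\<dots> = wnorm W" by (rule wnorm_translate[OF W])
    finally show "(\<integral>\<^sup>+t. W (t + s) * adens x' t \<partial>m) \<le> wnorm W" .
  qed
  also have "\<dots> = wnorm W" by (simp add: total)
  also have "(\<integral>\<^sup>+t. \<integral>\<^sup>+s. W (t + s) * adens x' t \<partial>m \<partial>m) = (\<integral>\<^sup>+t. adens x' t * (\<integral>\<^sup>+s. W s \<partial>m) \<partial>m)"
  proof (intro nn_integral_cong)
    fix t
    have "(\<integral>\<^sup>+s. W (t + s) * adens x' t \<partial>m) = (\<integral>\<^sup>+s. W (t + s) \<partial>m) * adens x' t"
      by (rule nn_integral_multc) simp
    then show "(\<integral>\<^sup>+s. W (t + s) * adens x' t \<partial>m) = adens x' t * (\<integral>\<^sup>+s. W s \<partial>m)"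
      by (simp add: nn_integral_left_translate[OF W] mult.commute)
  qed
  also have "\<dots> = (\<integral>\<^sup>+t. adens x' t \<partial>m) * (\<integral>\<^sup>+s. W s \<partial>m)"
    by (rule nn_integral_multc) simp
  finally show ?thesis .
qed

text \<open>
  A functional norming \<open>\<nu> UNIV\<close> has variation of mass at least \<open>norm (\<nu> UNIV)\<close>, which serves as the
  constant.
\<close>

lemma wnorm_dominates_integral:
  obtains \<kappa> :: real where "0 < \<kappa>"
    "\<And>W. W \<in> borel_measurable borel \<Longrightarrow> ennreal \<kappa> * (\<integral>\<^sup>+s. W s \<partial>m) \<le> wnorm W"
proof -
  obtain u where u: "u \<in> dual_ball" "norm (\<nu> UNIV) \<le> cmod (u (\<nu> UNIV))" by (rule norming_functional)
  have ud: "u \<in> dual_space" by (rule dual_ball_in_dual[OF u(1)])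
  have "u (\<nu> UNIV) = (LINT t|m. dens u t)"
    using dens_eq[OF ud, of UNIV] by (simp add: set_lebesgue_integral_def)
  then have "ennreal (norm (\<nu> UNIV)) \<le> (\<integral>\<^sup>+t. adens u t \<partial>m)"
    using u(2) integral_norm_bound_ennreal[OF dens_integrable[OF ud]] by (metis ennreal_leI order_trans)
  then have "ennreal (norm (\<nu> UNIV)) * (\<integral>\<^sup>+s. W s \<partial>m) \<le> wnorm W" if "W \<in> borel_measurable borel" for W
    using mass_times_integral_le_wnorm[OF that u(1)] by (meson mult_right_mono order_trans zero_le)
  then show thesis using that[of "norm (\<nu> UNIV)"] nonzero by simp
qed

text \<open>
  The convolution of the absolute values. It dominates the convolution everywhere: where it is
  infinite the Bochner integral takes the value \<open>0\<close>.
\<close>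

definition abs_convolution :: "('g \<Rightarrow> complex) \<Rightarrow> ('g \<Rightarrow> complex) \<Rightarrow> ('x \<Rightarrow> complex) \<Rightarrow> 'g \<Rightarrow> ennreal" where
  "abs_convolution f g x' t = (\<integral>\<^sup>+s. ennreal (cmod (f (t - s))) * ennreal (cmod (g s)) * adens x' s \<partial>m)"

lemma borel_measurable_abs_convolution:
  assumes [measurable]: "f \<in> borel_measurable borel" "g \<in> borel_measurable borel" and x': "x' \<in> dual_space"
  shows "abs_convolution f g x' \<in> borel_measurable borel"
proof -
  note [measurable] = dens_borel[OF x']
  have "(\<lambda>x. ennreal (cmod (f (fst x - snd x))) * ennreal (cmod (g (snd x))) * ennreal (cmod (dens x' (snd x)))) \<in> borel_measurable borel"
    by measurable
  from borel_measurable_nn_integral_section[OF this] show ?thesis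
    unfolding abs_convolution_def[abs_def] by simp
qed

lemma borel_measurable_vec_convolution:
  assumes [measurable]: "f \<in> borel_measurable borel" "g \<in> borel_measurable borel" and x': "x' \<in> dual_space"
  shows "vec_convolution m \<nu> f g x' \<in> borel_measurable borel"
proof -
  note [measurable] = dens_borel[OF x']
  have "(\<lambda>x. f (fst x - snd x) * (g (snd x) * dens x' (snd x))) \<in> borel_measurable borel"
    by measurable
  from borel_measurable_integral_section[OF this] show ?thesis
    unfolding vec_convolution_def Defs.convolution_def by simp
qed

lemma integrable_convolution:
  assumes [measurable]: "f \<in> borel_measurable borel" "g \<in> borel_measurable borel" and x': "x' \<in> dual_space"
    and fin: "abs_convolution f g x' t < \<infinity>"
  shows "integrable m (\<lambda>s. f (t - s) * (g s * dens x' s))"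
proof (rule integrableI_bounded)
  note [measurable] = dens_borel[OF x']
  show "(\<lambda>s. f (t - s) * (g s * dens x' s)) \<in> borel_measurable m" by simp
  show "(\<integral>\<^sup>+s. ennreal (norm (f (t - s) * (g s * dens x' s))) \<partial>m) < \<infinity>"
    using fin by (simp add: abs_convolution_def norm_mult ennreal_mult mult.assoc)
qed

lemma vec_convolution_le_abs:
  assumes [measurable]: "f \<in> borel_measurable borel" "g \<in> borel_measurable borel" and x': "x' \<in> dual_space"
  shows "ennreal (cmod (vec_convolution m \<nu> f g x' t)) \<le> abs_convolution f g x' t"
proof (cases "abs_convolution f g x' t < \<infinity>")
  case True
  have "ennreal (norm (LINT s|m. f (t - s) * (g s * dens x' s))) \<le> (\<integral>\<^sup>+s. ennreal (norm (f (t - s) * (g s * dens x' s))) \<partial>m)"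
    by (rule integral_norm_bound_ennreal[OF integrable_convolution[OF assms True]])
  then show ?thesis
    by (simp add: vec_convolution_def Defs.convolution_def abs_convolution_def norm_mult ennreal_mult mult.assoc)
qed (simp add: not_less top_unique)

text \<open>
  Invariance of \<open>wnorm\<close> makes the bound by the embedding into \<open>L\<^sup>1(G)\<close> uniform in the fixed variable, and \<open>|z| \<le> 1 + |z|\<^sup>p\<close> reduces the
  first power to the \<open>p\<close>-th.
\<close>

lemma integral_reflect_bounded:
  assumes [measurable]: "f \<in> borel_measurable borel" and p: "1 \<le> p"
    and fin: "power_wnorm p f < \<infinity>"
  obtains C :: real where "0 \<le> C" "\<And>t. (\<integral>\<^sup>+s. ennreal (cmod (f (t - s))) \<partial>m) \<le> ennreal C"
    "\<And>s. (\<integral>\<^sup>+t. ennreal (cmod (f (t - s))) \<partial>m) \<le> ennreal C"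
proof -
  obtain \<kappa> where \<kappa>: "0 < \<kappa>" "\<And>W. W \<in> borel_measurable borel \<Longrightarrow> ennreal \<kappa> * (\<integral>\<^sup>+s. W s \<partial>m) \<le> wnorm W"
    by (rule wnorm_dominates_integral) blast
  define W where "W s = ennreal (cmod (f s) powr p)" for s
  have W [measurable]: "W \<in> borel_measurable borel" unfolding W_def by measurable
  obtain N where N: "0 \<le> N" "wnorm W = ennreal N" using fin unfolding W_def[symmetric] by (cases "wnorm W") auto
  have *: "(\<integral>\<^sup>+s. V s \<partial>m) \<le> ennreal (N / \<kappa>)" if V: "V \<in> borel_measurable borel" "wnorm V = wnorm W" for V
  proof -
    have "ennreal \<kappa> * (\<integral>\<^sup>+s. V s \<partial>m) \<le> ennreal N" using \<kappa>(2)[OF V(1)] V(2) N by simp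
    then have "ennreal (1 / \<kappa>) * (ennreal \<kappa> * (\<integral>\<^sup>+s. V s \<partial>m)) \<le> ennreal (1 / \<kappa>) * ennreal N" by (rule mult_left_mono) simp
    moreover have "ennreal (1 / \<kappa>) * ennreal \<kappa> = 1" using \<kappa>(1) by (simp add: ennreal_mult[symmetric])
    moreover have "ennreal (1 / \<kappa>) * ennreal N = ennreal (N / \<kappa>)" using \<kappa>(1) N by (simp add: ennreal_mult[symmetric])
    ultimately show ?thesis by (simp add: mult.assoc[symmetric])
  qed
  have bound: "(\<integral>\<^sup>+s. ennreal (cmod (f (\<tau> s))) \<partial>m) \<le> ennreal (1 + N / \<kappa>)"
    if [measurable]: "\<tau> \<in> borel_measurable borel" and inv: "wnorm (\<lambda>s. W (\<tau> s)) = wnorm W" for \<tau>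
  proof -
    have "(\<integral>\<^sup>+s. ennreal (cmod (f (\<tau> s))) \<partial>m) \<le> (\<integral>\<^sup>+s. 1 + W (\<tau> s) \<partial>m)"
      unfolding W_def by (intro nn_integral_mono cmod_le_one_plus_powr p)
    also have "\<dots> = 1 + (\<integral>\<^sup>+s. W (\<tau> s) \<partial>m)" by (subst nn_integral_add) (simp_all add: total)
    also have "\<dots> \<le> 1 + ennreal (N / \<kappa>)" by (intro add_left_mono * inv) measurable
    also have "\<dots> = ennreal (1 + N / \<kappa>)" using N \<kappa> by simp
    finally show ?thesis .
  qed
  show thesis
  proof (rule that[of "1 + N / \<kappa>"])
    show "0 \<le> 1 + N / \<kappa>" using N \<kappa> by simp
    show "(\<integral>\<^sup>+s. ennreal (cmod (f (t - s))) \<partial>m) \<le> ennreal (1 + N / \<kappa>)" for t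
      by (rule bound[OF _ wnorm_reflect[OF W]]) simp
    show "(\<integral>\<^sup>+t. ennreal (cmod (f (t - s))) \<partial>m) \<le> ennreal (1 + N / \<kappa>)" for s
      by (rule bound[OF _ wnorm_translate[OF W]]) simp
  qed
qed

lemma abs_convolution_finite_AE:
  assumes [measurable]: "f \<in> borel_measurable borel" and p: "1 \<le> p"
    and fin: "power_wnorm p f < \<infinity>"
    and g: "g \<in> L1w \<nu>" and x': "x' \<in> dual_space"
  shows "AE t in m. abs_convolution f g x' t < \<infinity>"
proof -
  have [measurable]: "g \<in> borel_measurable borel" using g by (simp add: L1w_iff)
  note [measurable] = dens_borel[OF x']
  obtain C where C: "0 \<le> C" "\<And>s. (\<integral>\<^sup>+t. ennreal (cmod (f (t - s))) \<partial>m) \<le> ennreal C"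
    by (rule integral_reflect_bounded[OF assms(1) p fin]) blast
  have "(\<lambda>x. ennreal (cmod (f (fst x - snd x))) * ennreal (cmod (g (snd x))) * ennreal (cmod (dens x' (snd x)))) \<in> borel_measurable borel"
    by measurable
  from self.borel_fubini[OF this]
  have "(\<integral>\<^sup>+t. abs_convolution f g x' t \<partial>m) = (\<integral>\<^sup>+s. \<integral>\<^sup>+t. ennreal (cmod (f (t - s))) * ennreal (cmod (g s)) * adens x' s \<partial>m \<partial>m)"
    by (simp add: abs_convolution_def)
  also have "\<dots> = (\<integral>\<^sup>+s. (\<integral>\<^sup>+t. ennreal (cmod (f (t - s))) \<partial>m) * (ennreal (cmod (g s)) * adens x' s) \<partial>m)"
    unfolding mult.assoc by (intro nn_integral_cong nn_integral_multc) simp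
  also have "\<dots> \<le> (\<integral>\<^sup>+s. ennreal C * (ennreal (cmod (g s)) * adens x' s) \<partial>m)"
    by (intro nn_integral_mono mult_right_mono C(2)) simp
  also have "\<dots> = ennreal C * (\<integral>\<^sup>+s. ennreal (cmod (g s)) * adens x' s \<partial>m)"
    by (rule nn_integral_cmult) simp
  also have "\<dots> < \<infinity>" using g x' by (auto simp: L1w_iff ennreal_mult_less_top)
  finally have "(\<integral>\<^sup>+t. abs_convolution f g x' t \<partial>m) \<noteq> \<infinity>" by simp
  then have "AE t in m. abs_convolution f g x' t \<noteq> \<infinity>"
    by (rule nn_integral_PInf_AE[rotated]) (simp add: borel_measurable_abs_convolution x')
  then show ?thesis by eventually_elim (simp add: less_top)
qed

text \<open>
  Equality can fail only where one of the two convolutions does not converge absolutely, and this is a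
  null set by Fubini's theorem.
\<close>

lemma vec_convolution_add:
  assumes f: "f \<in> borel_measurable borel" and p: "1 \<le> p"
    and fin: "power_wnorm p f < \<infinity>"
    and g: "g \<in> L1w \<nu>" and x': "x' \<in> dual_space" and y': "y' \<in> dual_space"
  shows "ae_vec \<nu> (\<lambda>t. vec_convolution m \<nu> f g (\<lambda>x. x' x + y' x) t
     = vec_convolution m \<nu> f g x' t + vec_convolution m \<nu> f g y' t)"
proof (rule ae_vec_if_AE)
  have gb: "g \<in> borel_measurable borel" using g by (simp add: L1w_iff)
  let ?Z = "{t. abs_convolution f g x' t = \<infinity> \<or> abs_convolution f g y' t = \<infinity>}"
  note [measurable] = borel_measurable_abs_convolution[OF f gb x'] borel_measurable_abs_convolution[OF f gb y']
  have "{t\<in>space borel. abs_convolution f g x' t = \<infinity> \<or> abs_convolution f g y' t = \<infinity>} \<in> sets borel" by measurable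
  then show "?Z \<in> sets borel" by simp
  show "AE t in m. t \<notin> ?Z"
    using abs_convolution_finite_AE[OF f p fin g x'] abs_convolution_finite_AE[OF f p fin g y']
    by eventually_elim auto
  fix t assume "t \<notin> ?Z"
  then have int: "integrable m (\<lambda>s. f (t - s) * (g s * dens x' s))" "integrable m (\<lambda>s. f (t - s) * (g s * dens y' s))"
    using integrable_convolution[OF f gb] x' y' by (auto simp: less_top)
  have "(LINT s|m. f (t - s) * (g s * dens (\<lambda>x. x' x + y' x) s))
    = (LINT s|m. f (t - s) * (g s * dens x' s) + f (t - s) * (g s * dens y' s))"
  proof (rule integral_cong_AE)
    show "AE s in m. f (t - s) * (g s * dens (\<lambda>x. x' x + y' x) s) = f (t - s) * (g s * dens x' s) + f (t - s) * (g s * dens y' s)"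
      using dens_add[OF x' y'] by eventually_elim (simp add: algebra_simps)
    note [measurable] = f gb dens_borel[OF x'] dens_borel[OF y'] dens_borel[OF dual_space_add[OF x' y']]
    show "(\<lambda>s. f (t - s) * (g s * dens (\<lambda>x. x' x + y' x) s)) \<in> borel_measurable m"
      "(\<lambda>s. f (t - s) * (g s * dens x' s) + f (t - s) * (g s * dens y' s)) \<in> borel_measurable m" by simp_all
  qed
  then show "vec_convolution m \<nu> f g (\<lambda>x. x' x + y' x) t = vec_convolution m \<nu> f g x' t + vec_convolution m \<nu> f g y' t"
    using int by (simp add: vec_convolution_def Defs.convolution_def)
qed

lemma vec_convolution_mult:
  assumes f: "f \<in> borel_measurable borel" and gb: "g \<in> borel_measurable borel" and x': "x' \<in> dual_space"
  shows "vec_convolution m \<nu> f g (\<lambda>x. c * x' x) t = c * vec_convolution m \<nu> f g x' t"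
proof -
  have "(LINT s|m. f (t - s) * (g s * dens (\<lambda>x. c * x' x) s)) = (LINT s|m. c * (f (t - s) * (g s * dens x' s)))"
  proof (rule integral_cong_AE)
    show "AE s in m. f (t - s) * (g s * dens (\<lambda>x. c * x' x) s) = c * (f (t - s) * (g s * dens x' s))"
      using dens_mult[OF x', of c] by eventually_elim simp
    note [measurable] = f gb dens_borel[OF x'] dens_borel[OF dual_space_mult[OF x', of c]]
    show "(\<lambda>s. f (t - s) * (g s * dens (\<lambda>x. c * x' x) s)) \<in> borel_measurable m"
      "(\<lambda>s. c * (f (t - s) * (g s * dens x' s))) \<in> borel_measurable m" by simp_all
  qed
  then show ?thesis by (simp add: vec_convolution_def Defs.convolution_def)
qed

lemma young_pointwise_abs_convolution:
  assumes f [measurable]: "f \<in> borel_measurable borel" and g [measurable]: "g \<in> borel_measurable borel"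
    and x': "x' \<in> dual_ball"
    and p: "1 \<le> p" and q: "1 \<le> q" and \<rho>: "0 \<le> \<rho>" "1 / p + 1 / q = 1 + \<rho>"
    and pos: "0 < \<alpha>" "0 < \<beta>" "0 < \<delta>"
    and A: "power_wnorm p f \<le> ennreal \<alpha>"
    and B: "(\<integral>\<^sup>+s. ennreal (cmod (g s) powr q) * adens x' s \<partial>m) \<le> ennreal \<beta>"
    and D: "\<rho> = 0 \<or> (\<integral>\<^sup>+s. ennreal (cmod (f (t - s)) powr p) * ennreal (cmod (g s) powr q) * adens x' s \<partial>m) \<le> ennreal \<delta>"
  shows "abs_convolution f g x' t \<le> ennreal (\<delta> powr \<rho> * \<alpha> powr (1 / p - \<rho>) * \<beta> powr (1 / q - \<rho>))"
  unfolding abs_convolution_def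
proof (rule hoelder_young[OF _ _ _ _ _ p q \<rho> pos _ B D])
  note [measurable] = dens_borel[OF dual_ball_in_dual[OF x']]
  show "(\<lambda>s. cmod (f (t - s))) \<in> borel_measurable m" "(\<lambda>s. cmod (g s)) \<in> borel_measurable m"
    "(\<lambda>s. adens x' s) \<in> borel_measurable m" by simp_all
  have "(\<integral>\<^sup>+s. ennreal (cmod (f (t - s)) powr p) * adens x' s \<partial>m)
    \<le> wnorm (\<lambda>s. ennreal (cmod (f (t - s)) powr p))" by (rule wnorm_upper[OF x'])
  also have "\<dots> = power_wnorm p f"
    by (rule wnorm_reflect[of "\<lambda>s. ennreal (cmod (f s) powr p)"]) simp
  finally show "(\<integral>\<^sup>+s. ennreal (cmod (f (t - s)) powr p) * adens x' s \<partial>m) \<le> ennreal \<alpha>"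
    using A by simp
qed auto

text \<open>
  Young's inequality. The function \<open>h\<close> stands for anything real-valued below the convolution of the
  absolute values: it is taken to be the modulus of the convolution itself, and later the excess of this
  modulus over a constant.
\<close>

lemma young_convolution:
  assumes f [measurable]: "f \<in> borel_measurable borel" and g [measurable]: "g \<in> borel_measurable borel"
    and x': "x' \<in> dual_ball"
    and p: "1 \<le> p" and q: "1 \<le> q" and r: "0 < r" "1 / p + 1 / q = 1 + 1 / r"
    and pos: "0 < \<alpha>" "0 < \<beta>"
    and A: "power_wnorm p f \<le> ennreal \<alpha>"
    and B: "(\<integral>\<^sup>+s. ennreal (cmod (g s) powr q) * adens x' s \<partial>m) \<le> ennreal \<beta>"
    and h: "\<And>t. 0 \<le> h t" "\<And>t. ennreal (h t) \<le> abs_convolution f g x' t"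
  shows "wnorm (\<lambda>t. ennreal (h t powr r)) \<le> ennreal (\<alpha> powr (r / p) * \<beta> powr (r / q))"
proof (rule wnorm_least)
  fix y' :: "'x \<Rightarrow> complex" assume y': "y' \<in> dual_ball"
  note [measurable] = dens_borel[OF dual_ball_in_dual[OF x']] dens_borel[OF dual_ball_in_dual[OF y']]
  define D where "D t = (\<integral>\<^sup>+s. ennreal (cmod (f (t - s)) powr p) * ennreal (cmod (g s) powr q) * adens x' s \<partial>m)" for t
  define K where "K = \<alpha> powr (1 / p - 1 / r) * \<beta> powr (1 / q - 1 / r)"
  have K: "0 < K" using pos by (simp add: K_def)
  have Km: "(\<lambda>x. ennreal (cmod (f (fst x - snd x)) powr p) * ennreal (cmod (g (snd x)) powr q) * ennreal (cmod (dens x' (snd x)))) \<in> borel_measurable borel"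
    by measurable
  have [measurable]: "D \<in> borel_measurable borel"
    using borel_measurable_nn_integral_section[OF Km] by (simp add: D_def[abs_def])
  \<comment> \<open>The bound \<open>h \<le> \<delta> powr (1 / r) * K\<close> is available for positive \<open>\<delta>\<close> only, so \<open>D t\<close> is
    exceeded by an arbitrarily small amount, which also covers \<open>D t = 0\<close>.\<close>
  have pt: "ennreal (h t powr r) \<le> ennreal (K powr r) * D t" for t
  proof (cases "D t")
    case top
    then show ?thesis using K by (simp add: ennreal_mult_top)
  next
    case (real d)
    have "h t powr r \<le> K powr r * d"
    proof (rule field_le_epsilon)
      fix e :: real assume e: "0 < e"
      define \<delta> where "\<delta> = d + e / K powr r"
      have \<delta>: "0 < \<delta>" using real(1) e K by (simp add: \<delta>_def add_nonneg_pos)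
      have "D t \<le> ennreal \<delta>" unfolding real(2) using e K by (intro ennreal_leI) (simp add: \<delta>_def)
      then have "abs_convolution f g x' t \<le> ennreal (\<delta> powr (1 / r) * \<alpha> powr (1 / p - 1 / r) * \<beta> powr (1 / q - 1 / r))"
        using r by (intro young_pointwise_abs_convolution[OF f g x' p q _ r(2) pos \<delta> A B]) (auto simp: D_def)
      from order_trans[OF h(2)[of t] this] have "ennreal (h t) \<le> ennreal (\<delta> powr (1 / r) * K)"
        by (simp only: K_def mult.assoc)
      moreover have "0 \<le> \<delta> powr (1 / r) * K" using K by simp
      ultimately have "h t \<le> \<delta> powr (1 / r) * K" using ennreal_le_iff by blast
      then have "h t powr r \<le> (\<delta> powr (1 / r) * K) powr r" using h(1) r(1) by (intro powr_mono2) auto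
      also have "\<dots> = \<delta> * K powr r" using \<delta> K r(1) by (simp add: powr_mult powr_powr)
      also have "\<dots> = K powr r * d + e" using K by (simp add: \<delta>_def algebra_simps)
      finally show "h t powr r \<le> K powr r * d + e" .
    qed
    then show ?thesis using real K by (simp add: ennreal_mult[symmetric] ennreal_leI)
  qed
  have "(\<integral>\<^sup>+t. ennreal (h t powr r) * adens y' t \<partial>m) \<le> (\<integral>\<^sup>+t. ennreal (K powr r) * (D t * adens y' t) \<partial>m)"
    unfolding mult.assoc[symmetric] by (intro nn_integral_mono mult_right_mono pt) simp
  also have "\<dots> = ennreal (K powr r) * (\<integral>\<^sup>+t. D t * adens y' t \<partial>m)"
    by (rule nn_integral_cmult) simp
  also have "(\<integral>\<^sup>+t. D t * adens y' t \<partial>m) \<le> ennreal (\<alpha> * \<beta>)"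
  proof -
    have "(\<integral>\<^sup>+t. D t * adens y' t \<partial>m)
      = (\<integral>\<^sup>+t. \<integral>\<^sup>+s. ennreal (cmod (f (t - s)) powr p) * ennreal (cmod (g s) powr q) * adens x' s * adens y' t \<partial>m \<partial>m)"
      unfolding D_def by (intro nn_integral_cong nn_integral_multc[symmetric]) simp
    also have "\<dots> = (\<integral>\<^sup>+s. \<integral>\<^sup>+t. ennreal (cmod (f (t - s)) powr p) * ennreal (cmod (g s) powr q) * adens x' s * adens y' t \<partial>m \<partial>m)"
    proof -
      have "(\<lambda>x. ennreal (cmod (f (fst x - snd x)) powr p) * ennreal (cmod (g (snd x)) powr q) * ennreal (cmod (dens x' (snd x))) * ennreal (cmod (dens y' (fst x)))) \<in> borel_measurable borel"
        by measurable
      from self.borel_fubini[OF this] show ?thesis by simp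
    qed
    also have "\<dots> \<le> (\<integral>\<^sup>+s. ennreal \<alpha> * (ennreal (cmod (g s) powr q) * adens x' s) \<partial>m)"
    proof (rule nn_integral_mono)
      fix s
      have "(\<integral>\<^sup>+t. ennreal (cmod (f (t - s)) powr p) * ennreal (cmod (g s) powr q) * adens x' s * adens y' t \<partial>m)
        = (\<integral>\<^sup>+t. (ennreal (cmod (f (t - s)) powr p) * adens y' t) * (ennreal (cmod (g s) powr q) * adens x' s) \<partial>m)"
        by (simp add: mult_ac)
      also have "\<dots> = (\<integral>\<^sup>+t. ennreal (cmod (f (t - s)) powr p) * adens y' t \<partial>m) * (ennreal (cmod (g s) powr q) * adens x' s)"
        by (rule nn_integral_multc) simp
      also have "\<dots> \<le> ennreal \<alpha> * (ennreal (cmod (g s) powr q) * adens x' s)"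
      proof (rule mult_right_mono)
        have "(\<integral>\<^sup>+t. ennreal (cmod (f (t - s)) powr p) * adens y' t \<partial>m) \<le> wnorm (\<lambda>t. ennreal (cmod (f (t - s)) powr p))"
          by (rule wnorm_upper[OF y'])
        also have "\<dots> = power_wnorm p f"
          by (rule wnorm_translate[of "\<lambda>s. ennreal (cmod (f s) powr p)"]) simp
        finally show "(\<integral>\<^sup>+t. ennreal (cmod (f (t - s)) powr p) * adens y' t \<partial>m) \<le> ennreal \<alpha>" using A by simp
      qed simp
      finally show "(\<integral>\<^sup>+t. ennreal (cmod (f (t - s)) powr p) * ennreal (cmod (g s) powr q) * adens x' s * adens y' t \<partial>m)
        \<le> ennreal \<alpha> * (ennreal (cmod (g s) powr q) * adens x' s)" .
    qed
    also have "\<dots> = ennreal \<alpha> * (\<integral>\<^sup>+s. ennreal (cmod (g s) powr q) * adens x' s \<partial>m)"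
      by (rule nn_integral_cmult) simp
    also have "\<dots> \<le> ennreal \<alpha> * ennreal \<beta>" by (intro mult_left_mono B) simp
    finally show ?thesis using pos by (simp add: ennreal_mult)
  qed
  also have "ennreal (K powr r) * ennreal (\<alpha> * \<beta>) = ennreal (\<alpha> powr (r / p) * \<beta> powr (r / q))"
  proof -
    have e: "(1 / p - 1 / r) * r = r / p - 1" "(1 / q - 1 / r) * r = r / q - 1" using r(1) by (simp_all add: field_simps)
    have "\<alpha> powr (r / p - 1) * \<alpha> = \<alpha> powr (r / p)" "\<beta> powr (r / q - 1) * \<beta> = \<beta> powr (r / q)"
      using pos by (simp_all add: powr_diff)
    moreover have "K powr r * (\<alpha> * \<beta>) = (\<alpha> powr (r / p - 1) * \<alpha>) * (\<beta> powr (r / q - 1) * \<beta>)"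
      using pos by (simp add: K_def powr_mult powr_powr e)
    ultimately show ?thesis using pos by (simp add: ennreal_mult[symmetric])
  qed
  finally show "(\<integral>\<^sup>+t. ennreal (h t powr r) * adens y' t \<partial>m) \<le> ennreal (\<alpha> powr (r / p) * \<beta> powr (r / q))"
    by (simp add: mult_left_mono)
qed

end

section \<open>Norms of the spaces Lp\<close>

text \<open>
  Used to pass from positive upper bounds of two norms to the norms themselves, which may vanish.
\<close>

lemma ennreal_le_powr_limit:
  fixes X :: ennreal
  assumes ab: "0 \<le> a" "0 \<le> b" and xy: "0 < x" "0 < y"
    and le: "\<And>\<alpha> \<beta>. a < \<alpha> \<Longrightarrow> b < \<beta> \<Longrightarrow> X \<le> ennreal (\<alpha> powr x * \<beta> powr y)"
  shows "X \<le> ennreal (a powr x * b powr y)"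
proof -
  have lim: "(\<lambda>n. (c + 1 / Suc n) powr z) \<longlonglongrightarrow> c powr z" if "0 \<le> c" "0 < z" for c z :: real
  proof (rule tendsto_powr')
    show "(\<lambda>n. c + 1 / Suc n) \<longlonglongrightarrow> c"
      using tendsto_add[OF tendsto_const LIMSEQ_inverse_real_of_nat, of c] by (simp add: inverse_eq_divide)
    show "(\<lambda>n. z) \<longlonglongrightarrow> z" by simp
    show "c \<noteq> 0 \<or> 0 < z \<and> (\<forall>\<^sub>F n in sequentially. 0 \<le> c + 1 / real (Suc n))" using that by simp
  qed
  have "(\<lambda>n. ennreal ((a + 1 / Suc n) powr x * (b + 1 / Suc n) powr y)) \<longlonglongrightarrow> ennreal (a powr x * b powr y)"
    by (intro tendsto_ennrealI tendsto_mult lim ab xy)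
  then show ?thesis by (rule LIMSEQ_le_const) (use le in auto)
qed

context ac_vector_measure
begin

lemma abs_powr_borel: "f \<in> borel_measurable borel \<Longrightarrow> abs_powr f P \<in> borel_measurable borel"
  unfolding abs_powr_def[abs_def] by measurable

lemma cmod_abs_powr: "cmod (abs_powr f P t) = cmod (f t) powr P"
  by (simp add: abs_powr_def)

lemma Lpw_finite_D:
  assumes "f \<in> Lpw \<nu> (ennreal P)" "0 \<le> P"
  shows "f \<in> borel_measurable borel" "power_wnorm P f < \<infinity>"
proof -
  have f: "f \<in> borel_measurable borel" "abs_powr f P \<in> L1w \<nu>" using assms by (auto simp: Lpw_def)
  then show "f \<in> borel_measurable borel" by simp
  show "power_wnorm P f < \<infinity>"
    using wnorm_finite[OF f(2)] by (simp add: cmod_abs_powr)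
qed

lemma Lp_norm_finite_exponent:
  assumes "f \<in> borel_measurable borel" "0 \<le> P"
  shows "Lp_norm \<nu> (ennreal P) f = ennreal_powr (power_wnorm P f) (1 / P)"
  using assms by (simp add: Lp_norm_def L1_norm_eq[OF abs_powr_borel[OF assms(1)]] cmod_abs_powr)

lemma L1w_if_Lpw:
  assumes g: "g \<in> Lpw \<nu> (ennreal q)" and q: "1 \<le> q"
  shows "g \<in> L1w \<nu>"
proof (rule L1w_if_wnorm_finite)
  have q0: "0 \<le> q" using q by simp
  note gD = Lpw_finite_D[OF g q0]
  show "g \<in> borel_measurable borel" by (rule gD)
  have "wnorm (\<lambda>t. ennreal (cmod (g t))) \<le> wnorm (\<lambda>t. 1 + ennreal (cmod (g t) powr q))"
    by (intro wnorm_mono cmod_le_one_plus_powr q)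
  also have "\<dots> \<le> wnorm (\<lambda>t. 1) + power_wnorm q g"
    using gD(1) by (intro wnorm_add) auto
  also have "\<dots> < \<infinity>" using wnorm_1_finite gD(2) by (simp add: ennreal_add_less_top)
  finally show "wnorm (\<lambda>t. ennreal (cmod (g t))) < \<infinity>" .
qed

text \<open>
  The infimum that defines the essential supremum is attained, since a countable union of
  \<open>\<nu>\<close>-null sets is \<open>\<nu>\<close>-null.
\<close>

lemma Linf_norm:
  assumes g: "g \<in> Linf \<nu>"
  obtains c where "0 \<le> c" "Lp_norm \<nu> \<infinity> g = ennreal c" "ae_vec \<nu> (\<lambda>t. cmod (g t) \<le> c)"
proof -
  let ?S = "{C. ae_vec \<nu> (\<lambda>t. ennreal (cmod (g t)) \<le> C)}"
  obtain C0 where C0: "ae_vec \<nu> (\<lambda>t. cmod (g t) \<le> C0)" using g by (auto simp: Linf_def)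
  have mono: "ae_vec \<nu> Q" if "ae_vec \<nu> P" "\<And>t. P t \<Longrightarrow> Q t" for P Q
    using that unfolding ae_vec_def by blast
  have C0S: "ennreal C0 \<in> ?S" using mono[OF C0] by (simp add: ennreal_leI)
  then have "?S \<noteq> {}" by blast
  from ennreal_Inf_countable_INF[OF this]
  obtain C :: "nat \<Rightarrow> ennreal" where C: "range C \<subseteq> ?S" "Inf ?S = (INF i. C i)" by blast
  then have "\<forall>i. \<exists>N\<in>sets borel. (\<forall>x'\<in>dual_space. total_variation (scalar_measure \<nu> x') N = 0) \<and> {t. \<not> ennreal (cmod (g t)) \<le> C i} \<subseteq> N"
    unfolding ae_vec_def by blast
  then obtain N where N: "\<And>i. N i \<in> sets borel" "\<And>i x'. x' \<in> dual_space \<Longrightarrow> total_variation (scalar_measure \<nu> x') (N i) = 0"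
    "\<And>i. {t. \<not> ennreal (cmod (g t)) \<le> C i} \<subseteq> N i" by metis
  define I where "I = Inf ?S"
  have inf: "ae_vec \<nu> (\<lambda>t. ennreal (cmod (g t)) \<le> I)"
    unfolding ae_vec_def
  proof (intro bexI[of _ "\<Union>i. N i"] conjI ballI)
    show U: "(\<Union>i. N i) \<in> sets borel" using N(1) by auto
    fix x' :: "'x \<Rightarrow> complex" assume x': "x' \<in> dual_space"
    let ?D = "density m (\<lambda>t. adens x' t)"
    have tv: "total_variation (scalar_measure \<nu> x') A = emeasure ?D A" if "A \<in> sets borel" for A
      using that dens_borel[OF x']
      by (subst total_variation_scalar[OF x' that]) (auto simp: emeasure_density sets_m)
    have "emeasure ?D (\<Union>i. N i) = 0"
      using N(1) N(2)[OF x'] by (intro emeasure_UN_eq_0) (auto simp: tv sets_m)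
    then show "total_variation (scalar_measure \<nu> x') (\<Union>i. N i) = 0" by (simp add: tv U)
  next
    show "{t. \<not> ennreal (cmod (g t)) \<le> I} \<subseteq> (\<Union>i. N i)"
    proof
      fix t assume "t \<in> {t. \<not> ennreal (cmod (g t)) \<le> I}"
      then obtain i where "\<not> ennreal (cmod (g t)) \<le> C i" unfolding I_def C(2) by (auto simp: le_INF_iff)
      then show "t \<in> (\<Union>i. N i)" using N(3) by blast
    qed
  qed
  have "I \<le> ennreal C0" unfolding I_def by (rule Inf_lower[OF C0S])
  then have "I < \<infinity>" by (simp add: order_le_less_trans)
  then obtain c where c: "0 \<le> c" "I = ennreal c" by (cases I) auto
  show thesis
  proof (rule that[OF c(1)])
    show "Lp_norm \<nu> \<infinity> g = ennreal c" using c by (simp add: Lp_norm_def I_def)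
    show "ae_vec \<nu> (\<lambda>t. cmod (g t) \<le> c)" using mono[OF inf] c by simp
  qed
qed

text \<open>
  For real \<open>b \<ge> 0\<close> and \<open>r > 0\<close> this gives membership in \<open>L\<^sup>r\<^sub>w(\<nu>)\<close> with norm at most \<open>b\<close>. Stated without roots,
  it scales well and treats \<open>r = \<infinity>\<close>, where the bound holds everywhere, on the same footing.
\<close>

definition norm_bound :: "ennreal \<Rightarrow> real \<Rightarrow> ('g \<Rightarrow> complex) \<Rightarrow> bool" where
  "norm_bound r b F \<longleftrightarrow> F \<in> borel_measurable borel \<and>
     (if r = \<infinity> then \<forall>t. cmod (F t) \<le> b
      else wnorm (\<lambda>t. ennreal (cmod (F t) powr enn2real r)) \<le> ennreal (b powr enn2real r))"

lemma norm_bound_mult: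
  assumes F: "norm_bound r b F" and c: "0 \<le> c" "0 \<le> b"
  shows "norm_bound r (c * b) (\<lambda>t. complex_of_real c * F t)"
proof (cases "r = \<infinity>")
  case True
  then show ?thesis using F c by (auto simp: norm_bound_def norm_mult mult_left_mono)
next
  case False
  have [measurable]: "F \<in> borel_measurable borel" using F by (simp add: norm_bound_def)
  have "wnorm (\<lambda>t. ennreal (cmod (complex_of_real c * F t) powr enn2real r))
    = wnorm (\<lambda>t. ennreal (c powr enn2real r) * ennreal (cmod (F t) powr enn2real r))"
    using c by (simp add: norm_mult powr_mult ennreal_mult)
  also have "\<dots> \<le> ennreal (c powr enn2real r) * wnorm (\<lambda>t. ennreal (cmod (F t) powr enn2real r))"
    by (rule wnorm_cmult) measurable
  also have "\<dots> \<le> ennreal (c powr enn2real r) * ennreal (b powr enn2real r)"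
    using F False by (intro mult_left_mono) (auto simp: norm_bound_def)
  also have "\<dots> = ennreal ((c * b) powr enn2real r)" using c by (simp add: powr_mult ennreal_mult)
  finally show ?thesis using False by (simp add: norm_bound_def)
qed

lemma norm_bound_Lpw:
  assumes F: "norm_bound r b F"
  shows "F \<in> Lpw \<nu> r"
proof (cases "r = \<infinity>")
  case True
  have "ae_vec \<nu> (\<lambda>t. cmod (F t) \<le> b)" using F True
    by (intro ae_vec_everywhere) (simp add: norm_bound_def)
  then have "\<exists>C. ae_vec \<nu> (\<lambda>t. cmod (F t) \<le> C)" by blast
  then show ?thesis using F True by (simp add: Lpw_def Linf_def norm_bound_def)
next
  case False
  have fb: "F \<in> borel_measurable borel" using F by (simp add: norm_bound_def)
  have "wnorm (\<lambda>t. ennreal (cmod (F t) powr enn2real r)) < \<infinity>"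
    using F False by (auto simp: norm_bound_def intro: order_le_less_trans)
  then have "abs_powr F (enn2real r) \<in> L1w \<nu>"
    by (intro L1w_if_wnorm_finite abs_powr_borel fb) (simp add: cmod_abs_powr)
  then show ?thesis using False fb by (simp add: Lpw_def)
qed

lemma norm_bound_Lp_norm:
  assumes F: "norm_bound r b F" and b: "0 \<le> b" and r: "0 < r"
  shows "Lp_norm \<nu> r F \<le> ennreal b"
proof (cases "r = \<infinity>")
  case True
  have "ae_vec \<nu> (\<lambda>t. ennreal (cmod (F t)) \<le> ennreal b)" using F True
    by (intro ae_vec_everywhere) (simp add: norm_bound_def ennreal_leI)
  then show ?thesis using True by (auto simp: Lp_norm_def intro: Inf_lower)
next
  case False
  define R where "R = enn2real r"
  have rR: "r = ennreal R" "0 \<le> R" using False by (auto simp: R_def less_top)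
  then have R: "0 < R" using r by (cases "R = 0") auto
  have fb: "F \<in> borel_measurable borel" using F by (simp add: norm_bound_def)
  obtain N where N: "0 \<le> N" "power_wnorm R F = ennreal N" "N \<le> b powr R"
    using F False unfolding norm_bound_def R_def[symmetric]
    by (cases "power_wnorm R F") (auto simp: top_unique)
  have "Lp_norm \<nu> r F = ennreal (N powr (1 / R))"
    unfolding rR(1) Lp_norm_finite_exponent[OF fb rR(2)] N(2) using N(1) by (simp add: ennreal_powr_def)
  also have "\<dots> \<le> ennreal ((b powr R) powr (1 / R))" using N R by (intro ennreal_leI powr_mono2) auto
  also have "\<dots> = ennreal b" using R b by (simp add: powr_powr)
  finally show ?thesis .
qed

end

section \<open>Approximation by bounded functions\<close>

context haar_vector_measure
begin

lemma tail_integral_tendsto_0: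
  assumes g [measurable]: "g \<in> borel_measurable borel" and x': "x' \<in> dual_space"
    and fin: "(\<integral>\<^sup>+s. ennreal (cmod (g s) powr q) * adens x' s \<partial>m) < \<infinity>"
  shows "(\<lambda>n::nat. \<integral>\<^sup>+s. ennreal (cmod (if n < cmod (g s * dens x' s) then g s else 0) powr q) * adens x' s \<partial>m) \<longlonglongrightarrow> 0"
proof -
  note [measurable] = dens_borel[OF x']
  have "(\<lambda>n::nat. \<integral>\<^sup>+s. ennreal (cmod (if n < cmod (g s * dens x' s) then g s else 0) powr q) * adens x' s \<partial>m)
    \<longlonglongrightarrow> (\<integral>\<^sup>+s. 0 \<partial>m)"
  proof (rule nn_integral_dominated_convergence[where w = "\<lambda>s. ennreal (cmod (g s) powr q) * adens x' s"])
    show "AE s in m. (\<lambda>n::nat. ennreal (cmod (if n < cmod (g s * dens x' s) then g s else 0) powr q) * adens x' s) \<longlonglongrightarrow> 0"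
    proof (rule AE_I2)
      fix s
      obtain N :: nat where "cmod (g s * dens x' s) \<le> N" using real_arch_simple by blast
      then have "\<forall>n\<ge>N. ennreal (cmod (if n < cmod (g s * dens x' s) then g s else 0) powr q) * adens x' s = 0"
        by auto
      then show "(\<lambda>n::nat. ennreal (cmod (if n < cmod (g s * dens x' s) then g s else 0) powr q) * adens x' s) \<longlonglongrightarrow> 0"
        by (intro tendsto_eventually eventually_sequentiallyI) auto
    qed
  qed (use fin in auto)
  then show ?thesis by simp
qed

text \<open>
  Cutting the kernel \<open>g h_x'\<close> at height \<open>n\<close> splits the convolution into a part bounded by a constant \<open>C\<close>
  and the convolution with the remaining part of \<open>g\<close>, called \<open>gn n\<close>. The excess of the modulus over
  \<open>C\<close> is dominated by the latter, to which Young's inequality applies with a small bound \<open>\<beta>\<close>.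
\<close>

lemma truncated_vec_convolution_small:
  assumes f [measurable]: "f \<in> borel_measurable borel" and g [measurable]: "g \<in> borel_measurable borel"
    and x': "x' \<in> dual_ball"
    and p: "1 \<le> p" and q: "1 \<le> q" and r: "0 < r" "1 / p + 1 / q = 1 + 1 / r"
    and A: "power_wnorm p f < \<infinity>"
    and B: "(\<integral>\<^sup>+s. ennreal (cmod (g s) powr q) * adens x' s \<partial>m) < \<infinity>"
    and e: "0 < e"
  obtains C where "0 \<le> C"
    "wnorm (\<lambda>t. ennreal (max 0 (cmod (vec_convolution m \<nu> f g x' t) - C) powr r)) \<le> ennreal e"
proof -
  have x'd: "x' \<in> dual_space" by (rule dual_ball_in_dual[OF x'])
  note [measurable] = dens_borel[OF x'd]
  obtain a where a: "0 \<le> a" "power_wnorm p f = ennreal a"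
    using A by (cases "power_wnorm p f") auto
  define \<alpha> where "\<alpha> = a + 1"
  define \<beta> where "\<beta> = (e / \<alpha> powr (r / p)) powr (q / r)"
  have \<alpha>: "0 < \<alpha>" and \<beta>: "0 < \<beta>" using a e by (auto simp: \<alpha>_def \<beta>_def)
  \<comment> \<open>\<open>\<beta>\<close> solves this equation.\<close>
  have \<alpha>\<beta>: "\<alpha> powr (r / p) * \<beta> powr (r / q) = e"
    using \<alpha> e q r by (simp add: \<beta>_def powr_powr)
  define gn where "gn n s = (if real n < cmod (g s * dens x' s) then g s else 0)" for n :: nat and s
  have gnb [measurable]: "gn n \<in> borel_measurable borel" for n unfolding gn_def by measurable
  have "eventually (\<lambda>n. (\<integral>\<^sup>+s. ennreal (cmod (gn n s) powr q) * adens x' s \<partial>m) < ennreal \<beta>) sequentially"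
    using tail_integral_tendsto_0[OF g x'd B] \<beta> unfolding gn_def
    by (intro order_tendstoD(2)[where y = 0]) auto
  then obtain n where n: "(\<integral>\<^sup>+s. ennreal (cmod (gn n s) powr q) * adens x' s \<partial>m) \<le> ennreal \<beta>"
    using eventually_happens'[OF sequentially_bot] less_imp_le by blast
  obtain C1 where C1: "0 \<le> C1" "\<And>t. (\<integral>\<^sup>+s. ennreal (cmod (f (t - s))) \<partial>m) \<le> ennreal C1"
    by (rule integral_reflect_bounded[OF f p A]) blast
  define C where "C = real n * C1"
  have C: "0 \<le> C" using C1 by (simp add: C_def)
  have split: "abs_convolution f g x' t \<le> ennreal C + abs_convolution f (gn n) x' t" for t
  proof -
    have "abs_convolution f g x' t \<le> (\<integral>\<^sup>+s. ennreal n * ennreal (cmod (f (t - s)))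
        + ennreal (cmod (f (t - s))) * ennreal (cmod (gn n s)) * adens x' s \<partial>m)"
      unfolding abs_convolution_def
    proof (rule nn_integral_mono)
      fix s
      show "ennreal (cmod (f (t - s))) * ennreal (cmod (g s)) * adens x' s
        \<le> ennreal n * ennreal (cmod (f (t - s))) + ennreal (cmod (f (t - s))) * ennreal (cmod (gn n s)) * adens x' s"
      proof (cases "real n < cmod (g s * dens x' s)")
        case True then show ?thesis by (simp add: gn_def)
      next
        case False
        then have "cmod (f (t - s)) * (cmod (g s) * cmod (dens x' s)) \<le> cmod (f (t - s)) * n"
          by (intro mult_left_mono) (auto simp: norm_mult)
        then have "ennreal (cmod (f (t - s)) * (cmod (g s) * cmod (dens x' s))) \<le> ennreal (cmod (f (t - s)) * n)" by (rule ennreal_leI)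
        then show ?thesis using False by (simp add: gn_def ennreal_mult mult_ac)
      qed
    qed
    also have "\<dots> = ennreal n * (\<integral>\<^sup>+s. ennreal (cmod (f (t - s))) \<partial>m) + abs_convolution f (gn n) x' t"
      unfolding abs_convolution_def by (subst nn_integral_add) (simp_all add: nn_integral_cmult)
    also have "\<dots> \<le> ennreal n * ennreal C1 + abs_convolution f (gn n) x' t"
      by (intro add_right_mono mult_left_mono C1) simp
    also have "ennreal n * ennreal C1 = ennreal C" using C1 by (simp add: C_def ennreal_mult)
    finally show ?thesis .
  qed
  define h where "h t = max 0 (cmod (vec_convolution m \<nu> f g x' t) - C)" for t
  have h: "ennreal (h t) \<le> abs_convolution f (gn n) x' t" for t
  proof (cases "cmod (vec_convolution m \<nu> f g x' t) \<le> C")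
    case False
    then have "ennreal C + ennreal (h t) = ennreal (cmod (vec_convolution m \<nu> f g x' t))"
      using C by (simp add: h_def ennreal_plus[symmetric] del: ennreal_plus)
    also have "\<dots> \<le> ennreal C + abs_convolution f (gn n) x' t"
      using vec_convolution_le_abs[OF f g x'd] split by (rule order_trans)
    finally show ?thesis by (simp add: ennreal_add_left_cancel_le)
  qed (simp add: h_def max_def)
  have "wnorm (\<lambda>t. ennreal (h t powr r)) \<le> ennreal (\<alpha> powr (r / p) * \<beta> powr (r / q))"
    by (rule young_convolution[OF f gnb x' p q r \<alpha> \<beta> _ n _ h]) (auto simp: a \<alpha>_def h_def ennreal_leI)
  then show thesis using that[OF C] by (simp add: \<alpha>\<beta> h_def)
qed

end

text \<open>
  If \<open>h\<close> is the excess of \<open>F\<close> over \<open>C\<close>, then \<open>F \<le> 2 max C h\<close>. So \<open>F\<^sup>r\<close> exceeds the constant \<open>(2 C)\<^sup>r\<close> by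
  at most \<open>2\<^sup>r h\<^sup>r\<close>. The factor \<open>c\<close> is there because the estimates hold for functionals \<open>u\<close> in the
  dual ball, and a general functional is a multiple of such.
\<close>

lemma vec_convolution_Lr:
  fixes \<nu> :: "'g::{topological_group_add,t2_space} set \<Rightarrow> 'x::{complex_normed_vector,banach}"
  assumes haar: "haar_vector_measure m \<nu>"
    and f: "f \<in> borel_measurable borel" and g: "g \<in> borel_measurable borel" and u: "u \<in> dual_ball" and c: "0 \<le> c"
    and p: "1 \<le> p" and q: "1 \<le> q" and r: "0 < r" "1 / p + 1 / q = 1 + 1 / r"
    and A: "ac_vector_measure.wnorm m \<nu> (\<lambda>s. ennreal (cmod (f s) powr p)) < \<infinity>"
    and B: "(\<integral>\<^sup>+s. ennreal (cmod (g s) powr q) * ennreal (cmod (scalar_density m \<nu> u s)) \<partial>m) < \<infinity>"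
    and fin: "ac_vector_measure.wnorm m \<nu> (\<lambda>t. ennreal ((c * cmod (vec_convolution m \<nu> f g u t)) powr r)) < \<infinity>"
  shows "(\<lambda>t. complex_of_real ((c * cmod (vec_convolution m \<nu> f g u t)) powr r)) \<in> L1 \<nu>"
proof -
  interpret haar_vector_measure m \<nu> by fact
  define F where "F t = cmod (vec_convolution m \<nu> f g u t)" for t
  have Fb [measurable]: "F \<in> borel_measurable borel"
    unfolding F_def using borel_measurable_vec_convolution[OF f g dual_ball_in_dual[OF u]] by measurable
  have F0: "0 \<le> F t" for t by (simp add: F_def)
  show ?thesis
    unfolding F_def[symmetric]
  proof (rule L1_if_truncations_converge)
    show "ac_vector_measure m \<nu>" by unfold_locales
    show "(\<lambda>t. (c * F t) powr r) \<in> borel_measurable borel" by measurable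
    show "wnorm (\<lambda>t. ennreal ((c * F t) powr r)) < \<infinity>" using fin by (simp add: F_def)
    fix e :: real assume e: "0 < e"
    define k where "k = (2 * c) powr r"
    have k: "0 \<le> k" by (simp add: k_def)
    obtain C where C: "0 \<le> C" "wnorm (\<lambda>t. ennreal (max 0 (F t - C) powr r)) \<le> ennreal (e / (k + 1))"
      using truncated_vec_convolution_small[OF f g u p q r A B, of "e / (k + 1)"] e k unfolding F_def by auto
    define h where "h t = max 0 (F t - C)" for t
    have hb [measurable]: "h \<in> borel_measurable borel" unfolding h_def by measurable
    have le: "(c * F t) powr r - min ((c * F t) powr r) ((2 * c * C) powr r) \<le> k * h t powr r" for t
    proof (cases "h t \<le> C")
      case True
      then have "F t \<le> 2 * C" by (simp add: h_def)
      then have "c * F t \<le> c * (2 * C)" using c by (rule mult_left_mono)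
      then have "(c * F t) powr r \<le> (2 * c * C) powr r"
        using c F0[of t] r(1) by (intro powr_mono2) (auto simp: mult_ac)
      then show ?thesis using k by simp
    next
      case False
      then have "F t \<le> 2 * h t" using C(1) by (auto simp: h_def)
      then have "c * F t \<le> c * (2 * h t)" using c by (rule mult_left_mono)
      then have "(c * F t) powr r \<le> (2 * c * h t) powr r"
        using c F0[of t] r(1) by (intro powr_mono2) (auto simp: mult_ac)
      also have "\<dots> = k * h t powr r" using c by (simp add: k_def powr_mult h_def)
      finally have "(c * F t) powr r \<le> k * h t powr r" .
      moreover have "0 \<le> min ((c * F t) powr r) ((2 * c * C) powr r)" by simp
      ultimately show ?thesis by linarith
    qed
    have "wnorm (\<lambda>t. ennreal ((c * F t) powr r - min ((c * F t) powr r) ((2 * c * C) powr r)))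
      \<le> wnorm (\<lambda>t. ennreal k * ennreal (h t powr r))"
      using le k by (intro wnorm_mono) (simp add: ennreal_mult[symmetric] ennreal_leI)
    also have "\<dots> \<le> ennreal k * wnorm (\<lambda>t. ennreal (h t powr r))" by (rule wnorm_cmult) measurable
    also have "\<dots> \<le> ennreal k * ennreal (e / (k + 1))" using C(2) by (intro mult_left_mono) (auto simp: h_def)
    also have "\<dots> = ennreal (k * (e / (k + 1)))" using k e by (intro ennreal_mult[symmetric]) auto
    also have "\<dots> \<le> ennreal e" using k e by (intro ennreal_leI) (simp add: field_simps)
    finally show "\<exists>b\<ge>0. wnorm (\<lambda>t. ennreal ((c * F t) powr r - min ((c * F t) powr r) b)) \<le> ennreal e"
      by (intro exI[of _ "(2 * c * C) powr r"]) simp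
  qed simp
qed

section \<open>The convolution operator\<close>

context haar_vector_measure
begin

text \<open>
  Bounds on the dual ball suffice, since the convolution is homogeneous in \<open>x'\<close> at every point and
  every functional is its norm times an element of the ball.
\<close>

lemma vec_convolution_dual_operator:
  assumes f: "f \<in> borel_measurable borel" and p: "1 \<le> p"
    and fin: "power_wnorm p f < \<infinity>"
    and g: "g \<in> L1w \<nu>" and b: "0 \<le> b" and r: "0 < r"
    and bound: "\<And>u. u \<in> dual_ball \<Longrightarrow> norm_bound r b (vec_convolution m \<nu> f g u)"
  shows "vec_convolution m \<nu> f g \<in> dual_operators \<nu> r (Lpw \<nu> r)"
    and "dual_operator_norm \<nu> r (vec_convolution m \<nu> f g) \<le> ennreal b"
proof -
  have gb: "g \<in> borel_measurable borel" using g by (simp add: L1w_iff)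
  have bound': "norm_bound r (onorm x' * b) (vec_convolution m \<nu> f g x')" if x': "x' \<in> dual_space" for x'
  proof -
    obtain u where u: "u \<in> dual_ball" "x' = (\<lambda>x. complex_of_real (onorm x') * u x)"
      using dual_space_normalize[OF x'] by blast
    have p0: "0 \<le> onorm x'" using onorm_pos_le dual_space_linear[OF x'] by blast
    have "vec_convolution m \<nu> f g x' = (\<lambda>t. complex_of_real (onorm x') * vec_convolution m \<nu> f g u t)"
      by (subst u(2)) (rule ext, rule vec_convolution_mult[OF f gb dual_ball_in_dual[OF u(1)]])
    then show ?thesis using norm_bound_mult[OF bound[OF u(1)] p0 b] by simp
  qed
  have nn: "0 \<le> onorm x'" if "x' \<in> dual_space" for x' :: "'x \<Rightarrow> complex"
    using onorm_pos_le dual_space_linear[OF that] by blast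
  have mult: "ae_vec \<nu> (\<lambda>t. vec_convolution m \<nu> f g (\<lambda>x. c * x' x) t = c * vec_convolution m \<nu> f g x' t)"
    if "x' \<in> dual_space" for c x'
    by (rule ae_vec_everywhere) (rule vec_convolution_mult[OF f gb that])
  show "vec_convolution m \<nu> f g \<in> dual_operators \<nu> r (Lpw \<nu> r)"
    unfolding dual_operators_def
  proof (intro CollectI conjI ballI allI)
    show "vec_convolution m \<nu> f g x' \<in> Lpw \<nu> r" if "x' \<in> dual_space" for x'
      by (rule norm_bound_Lpw[OF bound'[OF that]])
    show "\<exists>C\<ge>0. \<forall>x'\<in>dual_space. Lp_norm \<nu> r (vec_convolution m \<nu> f g x') \<le> ennreal (C * onorm x')"
      using norm_bound_Lp_norm[OF bound' _ r] nn b by (intro exI[of _ b]) (auto simp: mult.commute)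
  qed (auto intro!: vec_convolution_add[OF f p fin g] mult)
  show "dual_operator_norm \<nu> r (vec_convolution m \<nu> f g) \<le> ennreal b"
    unfolding dual_operator_norm_def
    by (intro SUP_least norm_bound_Lp_norm[OF bound b r])
qed

text \<open>
  For \<open>r = \<infinity>\<close> the exponents are conjugate and Hoelder's inequality gives a bound at every point, while
  for \<open>r < \<infinity>\<close> this is Young's inequality. Both are used with bounds \<open>\<alpha> > a\<close>, \<open>\<beta> > b\<close> that tend to \<open>a\<close>, \<open>b\<close>.
\<close>

lemma norm_bound_finite_exponents:
  assumes f: "f \<in> borel_measurable borel" and g: "g \<in> borel_measurable borel" and u: "u \<in> dual_ball"
    and p: "1 \<le> p" and q: "1 \<le> q" and r: "0 < r" "inverse (ennreal p) + inverse (ennreal q) = 1 + inverse r"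
    and ab: "0 \<le> a" "0 \<le> b"
    and A: "power_wnorm p f = ennreal a"
    and B: "power_wnorm q g = ennreal b"
  shows "norm_bound r (a powr (1 / p) * b powr (1 / q)) (vec_convolution m \<nu> f g u)"
proof -
  have ud: "u \<in> dual_space" by (rule dual_ball_in_dual[OF u])
  have inv: "inverse (ennreal p) = ennreal (1 / p)" "inverse (ennreal q) = ennreal (1 / q)"
    using p q by (simp_all add: inverse_ennreal inverse_eq_divide)
  have Fb: "vec_convolution m \<nu> f g u \<in> borel_measurable borel"
    by (rule borel_measurable_vec_convolution[OF f g ud])
  have Bu: "(\<integral>\<^sup>+s. ennreal (cmod (g s) powr q) * adens u s \<partial>m) \<le> ennreal b"
    using wnorm_upper[OF u, of "\<lambda>s. ennreal (cmod (g s) powr q)"] B by simp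
  show ?thesis
  proof (cases "r = \<infinity>")
    case True
    have "ennreal (1 / p + 1 / q) = ennreal 1"
      using r(2) True p q unfolding inv by (simp add: ennreal_plus)
    moreover have "0 \<le> 1 / p + 1 / q" "0 \<le> (1::real)" using p q by auto
    ultimately have "1 / p + 1 / q = 1" by (simp only: ennreal_inj)
    then have pq: "1 / p + 1 / q = 1 + 0" by simp
    have "cmod (vec_convolution m \<nu> f g u t) \<le> a powr (1 / p) * b powr (1 / q)" for t
    proof -
      have "abs_convolution f g u t \<le> ennreal (a powr (1 / p) * b powr (1 / q))"
      proof (rule ennreal_le_powr_limit[OF ab])
        fix \<alpha> \<beta> assume "a < \<alpha>" "b < \<beta>"
        then have "abs_convolution f g u t \<le> ennreal (1 powr 0 * \<alpha> powr (1 / p - 0) * \<beta> powr (1 / q - 0))"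
          using ab A order_trans[OF Bu ennreal_leI[of b \<beta>]]
          by (intro young_pointwise_abs_convolution[OF f g u p q _ pq]) (auto intro: ennreal_leI)
        then show "abs_convolution f g u t \<le> ennreal (\<alpha> powr (1 / p) * \<beta> powr (1 / q))" by simp
      qed (use p q in auto)
      with vec_convolution_le_abs[OF f g ud, of t]
      have "ennreal (cmod (vec_convolution m \<nu> f g u t)) \<le> ennreal (a powr (1 / p) * b powr (1 / q))" by (rule order_trans)
      then show ?thesis by (subst (asm) ennreal_le_iff) auto
    qed
    then show ?thesis using True Fb by (simp add: norm_bound_def)
  next
    case False
    define R where "R = enn2real r"
    have R: "0 < R" and pq: "1 / p + 1 / q = 1 + 1 / R"
      using exponents_real[OF p q r(1) False r(2)] by (simp_all add: R_def)
    have "wnorm (\<lambda>t. ennreal (cmod (vec_convolution m \<nu> f g u t) powr R)) \<le> ennreal (a powr (R / p) * b powr (R / q))"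
    proof (rule ennreal_le_powr_limit[OF ab])
      fix \<alpha> \<beta> assume "a < \<alpha>" "b < \<beta>"
      then show "wnorm (\<lambda>t. ennreal (cmod (vec_convolution m \<nu> f g u t) powr R)) \<le> ennreal (\<alpha> powr (R / p) * \<beta> powr (R / q))"
        using ab A order_trans[OF Bu ennreal_leI[of b \<beta>]] vec_convolution_le_abs[OF f g ud]
        by (intro young_convolution[OF f g u p q R pq]) (auto intro: ennreal_leI)
    qed (use p q R in auto)
    also have "a powr (R / p) * b powr (R / q) = (a powr (1 / p) * b powr (1 / q)) powr R"
      by (simp add: powr_mult powr_powr)
    finally show ?thesis using False Fb by (simp add: norm_bound_def R_def)
  qed
qed

lemma norm_bound_bounded_factor:
  assumes f: "f \<in> borel_measurable borel" and g: "g \<in> borel_measurable borel" and u: "u \<in> dual_ball"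
    and a: "0 \<le> a" "wnorm (\<lambda>s. ennreal (cmod (f s))) = ennreal a"
    and c: "0 \<le> c" "ae_vec \<nu> (\<lambda>t. cmod (g t) \<le> c)"
  shows "norm_bound \<infinity> (a * c) (vec_convolution m \<nu> f g u)"
proof -
  have ud: "u \<in> dual_space" by (rule dual_ball_in_dual[OF u])
  note [measurable] = f g dens_borel[OF ud]
  have "cmod (vec_convolution m \<nu> f g u t) \<le> a * c" for t
  proof -
    have "abs_convolution f g u t \<le> (\<integral>\<^sup>+s. ennreal c * (ennreal (cmod (f (t - s))) * adens u s) \<partial>m)"
      unfolding abs_convolution_def
    proof (rule nn_integral_mono_AE)
      show "AE s in m. ennreal (cmod (f (t - s))) * ennreal (cmod (g s)) * adens u s
        \<le> ennreal c * (ennreal (cmod (f (t - s))) * adens u s)"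
        using ae_vecD[OF c(2) ud]
      proof eventually_elim
        fix s assume s: "dens u s \<noteq> 0 \<longrightarrow> cmod (g s) \<le> c"
        show "ennreal (cmod (f (t - s))) * ennreal (cmod (g s)) * adens u s
          \<le> ennreal c * (ennreal (cmod (f (t - s))) * adens u s)"
        proof (cases "dens u s = 0")
          case False
          then have "ennreal (cmod (g s)) \<le> ennreal c" using s by (intro ennreal_leI) simp
          from mult_right_mono[OF this, of "ennreal (cmod (f (t - s))) * adens u s"]
          show ?thesis by (simp add: mult_ac)
        qed simp
      qed
    qed
    also have "\<dots> = ennreal c * (\<integral>\<^sup>+s. ennreal (cmod (f (t - s))) * adens u s \<partial>m)"
      by (rule nn_integral_cmult) simp
    also have "\<dots> \<le> ennreal c * wnorm (\<lambda>s. ennreal (cmod (f (t - s))))"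
      by (intro mult_left_mono wnorm_upper u) simp
    also have "wnorm (\<lambda>s. ennreal (cmod (f (t - s)))) = ennreal a"
      using wnorm_reflect[of "\<lambda>s. ennreal (cmod (f s))" t] a by simp
    also have "ennreal c * ennreal a = ennreal (a * c)" using a c by (simp add: ennreal_mult mult.commute)
    finally have "abs_convolution f g u t \<le> ennreal (a * c)" .
    with vec_convolution_le_abs[OF f g ud, of t]
    have "ennreal (cmod (vec_convolution m \<nu> f g u t)) \<le> ennreal (a * c)" by (rule order_trans)
    then show ?thesis using a c by (subst (asm) ennreal_le_iff) auto
  qed
  then show ?thesis using borel_measurable_vec_convolution[OF f g ud] by (simp add: norm_bound_def)
qed

lemma L1w_if_Linf:
  assumes "g \<in> Linf \<nu>"
  shows "g \<in> L1w \<nu>"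
  unfolding L1w_iff
proof (intro conjI ballI)
  show "g \<in> borel_measurable borel" using assms by (simp add: Linf_def)
  fix x' :: "'x \<Rightarrow> complex" assume x': "x' \<in> dual_space"
  obtain c where c: "ae_vec \<nu> (\<lambda>t. cmod (g t) \<le> c)" using assms by (auto simp: Linf_def)
  have "(\<integral>\<^sup>+t. ennreal (cmod (g t)) * adens x' t \<partial>m) \<le> (\<integral>\<^sup>+t. ennreal c * adens x' t \<partial>m)"
    using ae_vecD[OF c x'] by (intro nn_integral_mono_AE) (auto elim!: eventually_mono simp: mult_right_mono ennreal_leI)
  also have "\<dots> = ennreal c * (\<integral>\<^sup>+t. adens x' t \<partial>m)"
    using dens_borel[OF x'] by (intro nn_integral_cmult) simp
  also have "\<dots> < \<infinity>" using dens_integrable[OF x'] by (auto simp: integrable_iff_bounded ennreal_mult_less_top)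
  finally show "(\<integral>\<^sup>+t. ennreal (cmod (g t)) * adens x' t \<partial>m) < \<infinity>" .
qed

end

lemma vec_convolution_Lp:
  fixes \<nu> :: "'g::{topological_group_add,t2_space} set \<Rightarrow> 'x::{complex_normed_vector,banach}"
  assumes haar: "haar_vector_measure m \<nu>"
    and f: "f \<in> borel_measurable borel" and g: "g \<in> borel_measurable borel" and x': "x' \<in> dual_space"
    and p: "1 \<le> p" and q: "1 \<le> q" and r: "0 < r" "1 / p + 1 / q = 1 + 1 / r"
    and A: "ac_vector_measure.wnorm m \<nu> (\<lambda>s. ennreal (cmod (f s) powr p)) < \<infinity>"
    and B: "ac_vector_measure.wnorm m \<nu> (\<lambda>s. ennreal (cmod (g s) powr q)) < \<infinity>"
    and F: "vec_convolution m \<nu> f g x' \<in> Lpw \<nu> (ennreal r)"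
  shows "vec_convolution m \<nu> f g x' \<in> Lp \<nu> (ennreal r)"
proof -
  interpret haar_vector_measure m \<nu> by fact
  obtain u where u: "u \<in> dual_ball" "x' = (\<lambda>x. complex_of_real (onorm x') * u x)"
    using dual_space_normalize[OF x'] by blast
  have p0: "0 \<le> onorm x'" using onorm_pos_le dual_space_linear[OF x'] by blast
  have "vec_convolution m \<nu> f g x' t = complex_of_real (onorm x') * vec_convolution m \<nu> f g u t" for t
    by (subst u(2)) (rule vec_convolution_mult[OF f g dual_ball_in_dual[OF u(1)]])
  then have eq: "cmod (vec_convolution m \<nu> f g x' t) = onorm x' * cmod (vec_convolution m \<nu> f g u t)" for t
    using p0 by (simp add: norm_mult)
  have "(\<lambda>t. complex_of_real ((onorm x' * cmod (vec_convolution m \<nu> f g u t)) powr r)) \<in> L1 \<nu>"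
  proof (rule vec_convolution_Lr[OF haar f g u(1) p0 p q r A])
    show "(\<integral>\<^sup>+s. ennreal (cmod (g s) powr q) * adens u s \<partial>m) < \<infinity>"
      using wnorm_upper[OF u(1), of "\<lambda>s. ennreal (cmod (g s) powr q)"] B by (rule order_le_less_trans)
    show "wnorm (\<lambda>t. ennreal ((onorm x' * cmod (vec_convolution m \<nu> f g u t)) powr r)) < \<infinity>"
      using Lpw_finite_D(2)[OF F] r by (simp add: eq)
  qed
  then show ?thesis
    using Lpw_finite_D(1)[OF F] r(1) by (simp add: Lp_def abs_powr_def[abs_def] eq)
qed

theorem corollary6p5:
  fixes m :: "'g::{topological_group_add,t2_space} measure"
    and \<nu> :: "'g set \<Rightarrow> 'x::{operator_space,banach}"
    and f g :: "'g \<Rightarrow> complex"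
    and p q r :: ennreal
  assumes "compact (UNIV :: 'g set)"
    and "normalized_haar m"
    and "\<nu> \<in> M_ac m"
    and "semivariation_translation_invariant \<nu>"
    and "semivariation_inversion_invariant \<nu>"
    and "\<nu> UNIV \<noteq> 0"
    and "1 \<le> p" and "p < \<infinity>"
    and "1 \<le> q" and "q \<le> conj_exponent p"
    and "inverse p + inverse q = 1 + inverse r"
    and "f \<in> Lp \<nu> p"
    and "g \<in> Lpw \<nu> q"
  shows "vec_convolution m \<nu> f g \<in> dual_operators \<nu> r (Lpw \<nu> r)
    \<and> dual_operator_norm \<nu> r (vec_convolution m \<nu> f g) \<le> Lp_norm \<nu> p f * Lp_norm \<nu> q g
    \<and> (g \<in> Lp \<nu> q \<longrightarrow> vec_convolution m \<nu> f g \<in> dual_operators \<nu> r (Lp \<nu> r))"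
proof -
  have haar: "haar_vector_measure m \<nu>"
    using assms(2-6) unfolding normalized_haar_def by unfold_locales auto
  interpret haar_vector_measure m \<nu> by (rule haar)
  define P where "P = enn2real p"
  have pP: "p = ennreal P" using \<open>p < \<infinity>\<close> by (simp add: P_def)
  have P: "1 \<le> P" using \<open>1 \<le> p\<close> unfolding pP by simp
  have f: "f \<in> Lpw \<nu> (ennreal P)" using \<open>f \<in> Lp \<nu> p\<close> P unfolding pP by (auto simp: Lp_def Lpw_def L1_def)
  have fb: "f \<in> borel_measurable borel" and fin: "power_wnorm P f < \<infinity>"
    using Lpw_finite_D[OF f] P by auto
  obtain a where a: "0 \<le> a" "power_wnorm P f = ennreal a"
    using fin by (cases "power_wnorm P f") auto
  have fnorm: "Lp_norm \<nu> p f = ennreal (a powr (1 / P))"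
    unfolding pP using P a by (subst Lp_norm_finite_exponent[OF fb]) (auto simp: ennreal_powr_def)
  have "inverse p + inverse q \<noteq> \<infinity>"
    using \<open>1 \<le> p\<close> \<open>1 \<le> q\<close> by (auto simp: ennreal_inverse_eq_top_iff)
  then have "r \<noteq> 0" using \<open>inverse p + inverse q = 1 + inverse r\<close> by auto
  then have r: "0 < r" by (simp add: zero_less_iff_neq_zero)
  show ?thesis
  proof (cases "q = \<infinity>")
    case True
    \<comment> \<open>An infinite \<open>q\<close> forces \<open>p = 1\<close> and \<open>r = \<infinity>\<close>.\<close>
    have "inverse p \<le> 1" using P le_imp_inverse_le[of 1 P] by (simp add: pP inverse_ennreal)
    moreover have eq: "inverse p = 1 + inverse r" using \<open>inverse p + inverse q = 1 + inverse r\<close> True by simp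
    ultimately have "inverse r = 0"
      by (metis add.right_neutral ennreal_add_left_cancel_le ennreal_one_neq_top infinity_ennreal_def le_zero_eq)
    then have rinf: "r = \<infinity>" by (simp add: ennreal_inverse_eq_0_iff)
    have "inverse p = 1" using eq \<open>inverse r = 0\<close> by simp
    then have "P = 1" using P by (simp add: pP inverse_ennreal flip: ennreal_1)
    have g: "g \<in> Linf \<nu>" using \<open>g \<in> Lpw \<nu> q\<close> True by (simp add: Lpw_def)
    then have gb: "g \<in> borel_measurable borel" by (simp add: Linf_def)
    obtain c where c: "0 \<le> c" "Lp_norm \<nu> \<infinity> g = ennreal c" "ae_vec \<nu> (\<lambda>t. cmod (g t) \<le> c)"
      using Linf_norm[OF g] by blast
    have "norm_bound r (a * c) (vec_convolution m \<nu> f g u)" if "u \<in> dual_ball" for u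
      unfolding rinf using a(2) \<open>P = 1\<close> by (intro norm_bound_bounded_factor[OF fb gb that a(1) _ c(1,3)]) simp
    then have res: "vec_convolution m \<nu> f g \<in> dual_operators \<nu> r (Lpw \<nu> r)"
      "dual_operator_norm \<nu> r (vec_convolution m \<nu> f g) \<le> ennreal (a * c)"
      using vec_convolution_dual_operator[OF fb P fin L1w_if_Linf[OF g] _ r, of "a * c"] a c by auto
    have "Lp_norm \<nu> p f * Lp_norm \<nu> q g = ennreal (a * c)"
      using a c True \<open>P = 1\<close> by (simp add: fnorm ennreal_mult)
    moreover have "Lp \<nu> r = Lpw \<nu> r" by (simp add: rinf Lp_def Lpw_def)
    ultimately show ?thesis using res by simp
  next
    case False
    define Q where "Q = enn2real q"
    have qQ: "q = ennreal Q" using False by (simp add: Q_def less_top)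
    have Q: "1 \<le> Q" using \<open>1 \<le> q\<close> unfolding qQ by simp
    have g: "g \<in> Lpw \<nu> (ennreal Q)" using \<open>g \<in> Lpw \<nu> q\<close> by (simp add: qQ)
    have gb: "g \<in> borel_measurable borel" and gfin: "power_wnorm Q g < \<infinity>"
      using Lpw_finite_D[OF g] Q by auto
    obtain b where b: "0 \<le> b" "power_wnorm Q g = ennreal b"
      using gfin by (cases "power_wnorm Q g") auto
    have gnorm: "Lp_norm \<nu> q g = ennreal (b powr (1 / Q))"
      unfolding qQ using Q b by (subst Lp_norm_finite_exponent[OF gb]) (auto simp: ennreal_powr_def)
    have exps: "inverse (ennreal P) + inverse (ennreal Q) = 1 + inverse r"
      using \<open>inverse p + inverse q = 1 + inverse r\<close> by (simp add: pP qQ)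
    let ?b = "a powr (1 / P) * b powr (1 / Q)"
    have bound: "norm_bound r ?b (vec_convolution m \<nu> f g u)" if "u \<in> dual_ball" for u
      by (rule norm_bound_finite_exponents[OF fb gb that P Q r exps a(1) b(1) a(2) b(2)])
    have res: "vec_convolution m \<nu> f g \<in> dual_operators \<nu> r (Lpw \<nu> r)"
      "dual_operator_norm \<nu> r (vec_convolution m \<nu> f g) \<le> ennreal ?b"
      using vec_convolution_dual_operator[OF fb P fin L1w_if_Lpw[OF g Q] _ r bound] by auto
    have norms: "Lp_norm \<nu> p f * Lp_norm \<nu> q g = ennreal ?b" by (simp add: fnorm gnorm ennreal_mult)
    have strong: "vec_convolution m \<nu> f g x' \<in> Lp \<nu> r" if x': "x' \<in> dual_space" for x'
    proof -
      have F: "vec_convolution m \<nu> f g x' \<in> Lpw \<nu> r" using res(1) x' by (simp add: dual_operators_def)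
      show ?thesis
      proof (cases "r = \<infinity>")
        case True
        then show ?thesis using F by (simp add: Lp_def Lpw_def)
      next
        case False
        define R where "R = enn2real r"
        have rR: "r = ennreal R" and R: "0 < R" and "1 / P + 1 / Q = 1 + 1 / R"
          using exponents_real[OF P Q r False exps] by (simp_all add: R_def)
        then show ?thesis
          using vec_convolution_Lp[OF haar fb gb x' P Q R _ fin gfin] F by (simp add: rR)
      qed
    qed
    then have "vec_convolution m \<nu> f g \<in> dual_operators \<nu> r (Lp \<nu> r)"
      using res(1) by (simp add: dual_operators_def)
    then show ?thesis using res norms by simp
  qed
qed

end
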